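(* Let $\Delta$ be a $(d-1)$-dimensional balanced Cohen–Macaulay simplicial complex with vertex partition $V=V_1\sqcup\dots\sqcup V_d$. Let $n:=|V|$, $n_i:=|V_i|$ and $b:=\sum_{i=1}^{d}\binom{n_i}{2}$. Let $x_px_q$ be the $b$-th largest degree $2$ monomial of $\mathbb{F}[x_1,\ldots,x_{n-d}]$ in lexicographic order, with $p\leq q$. Then $$\beta_{i,i+j}(\mathbb{F}[\Delta])\leq\sum_{\ell=p+1}^{n-d}\binom{\ell-p+j-1}{j}\binom{\ell-1}{i-1}+\sum_{\ell=q+1}^{n-d}\binom{\ell-q+j-2}{j-1}\binom{\ell-1}{i-1}$$ for any $i\geq 0$ and $2\leq j\leq d$.
   Context: $\mathbb{F}$ is a field. For a simplicial complex $\Delta$ on vertex set $[n]$, $\mathbb{F}[\Delta]=S/I_\Delta$ is the Stanley–Reisner ring over $S=\mathbb{F}[x_1,\dots,x_n]$ and $\beta_{i,i+j}(\mathbb{F}[\Delta])=\dim_{\mathbb{F}}\mathrm{Tor}_i^S(\mathbb{F}[\Delta],\mathbb{F})_{i+j}$. $\Delta$ is Cohen–Macaulay if $\mathbb{F}[\Delta]$ is a Cohen–Macaulay ring. $\Delta$ (of dimension $d-1$) is balanced if its vertex set has a partition into $d$ color classes $V_1,\dots,V_d$ such that each face meets each $V_i$ in at most one vertex. Lexicographic order has $x_1>\dots>x_{n-d}$. Binomial coefficients with negative lower index are $0$. *)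

theory Defs
  imports
    "HOL-Algebra.Algebra"
    "HOL-Algebra.Algebraic_Closure_Type"
    "HOL-Library.Poly_Mapping"
    "HOL-Library.Extended_Nat"
    "HOL-Library.Disjoint_Sets"
begin

section \<open>Cohen--Macaulay rings\<close>

definition prime_height :: "('a, 'm) ring_scheme \<Rightarrow> 'a set \<Rightarrow> enat" where
  "prime_height R P = Sup {enat n | n. \<exists>C :: nat \<Rightarrow> 'a set.
     (\<forall>i\<le>n. primeideal (C i) R) \<and> (\<forall>i<n. C i \<subset> C (Suc i)) \<and> C n = P}"

definition regular_sequence :: "('a, 'm) ring_scheme \<Rightarrow> 'a list \<Rightarrow> bool" where
  "regular_sequence R xs \<longleftrightarrow>
     set xs \<subseteq> carrier R \<and>
     (\<forall>i<length xs. \<forall>a\<in>carrier R.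
        xs ! i \<otimes>\<^bsub>R\<^esub> a \<in> Idl\<^bsub>R\<^esub> (set (take i xs)) \<longrightarrow> a \<in> Idl\<^bsub>R\<^esub> (set (take i xs))) \<and>
     Idl\<^bsub>R\<^esub> (set xs) \<noteq> carrier R"

definition ideal_depth :: "('a, 'm) ring_scheme \<Rightarrow> 'a set \<Rightarrow> enat" where
  "ideal_depth R I = Sup {enat (length xs) | xs. set xs \<subseteq> I \<and> regular_sequence R xs}"

text \<open>
  For a maximal ideal \<open>P\<close> of a Noetherian ring, \<open>ideal_depth R P\<close> is the depth and
  \<open>prime_height R P\<close> the Krull dimension of the local ring at \<open>P\<close>; the definition below
  is the one in Eisenbud's \<^emph>\<open>Commutative Algebra\<close>, Section 18.2.
\<close>
definition cohen_macaulay_ring :: "('a, 'm) ring_scheme \<Rightarrow> bool" where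
  "cohen_macaulay_ring R \<longleftrightarrow>
     cring R \<and> noetherian_ring R \<and>
     (\<forall>P. maximalideal P R \<longrightarrow> ideal_depth R P = prime_height R P)"


section \<open>Polynomial rings\<close>

text \<open>
  A monomial is given by its exponent vector. The variables of the polynomial ring are
  indexed by a type, which for Stanley--Reisner rings is the (finite) type of vertices.
\<close>
type_synonym 'v monom = "'v \<Rightarrow>\<^sub>0 nat"
type_synonym ('v, 'k) mpoly = "'v monom \<Rightarrow>\<^sub>0 'k"

definition mdeg :: "'v monom \<Rightarrow> nat" where
  "mdeg m = (\<Sum>v\<in>Poly_Mapping.keys m. Poly_Mapping.lookup m v)"

definition mvar :: "'v \<Rightarrow> 'v monom" where
  "mvar v = Poly_Mapping.single v 1"

definition pvar :: "'v \<Rightarrow> ('v, 'k::field) mpoly" where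
  "pvar v = Poly_Mapping.single (mvar v) 1"

text \<open>\<open>homogeneous c 0\<close> holds for every \<open>c\<close>.\<close>
definition homogeneous :: "nat \<Rightarrow> ('v, 'k::field) mpoly \<Rightarrow> bool" where
  "homogeneous c f \<longleftrightarrow> (\<forall>m\<in>Poly_Mapping.keys f. mdeg m = c)"

abbreviation poly_ring :: "('v, 'k::field) mpoly ring" where
  "poly_ring \<equiv> ring_of_type_algebra"


section \<open>Simplicial complexes and Stanley--Reisner rings\<close>

text \<open>
  Simplicial complexes live on the vertex set \<open>UNIV :: 'v set\<close>, with \<open>'v\<close> finite. Elements of
  \<open>'v\<close> are not required to be faces.
\<close>
definition simplicial_complex :: "'v set set \<Rightarrow> bool" where
  "simplicial_complex \<Delta> \<longleftrightarrow> {} \<in> \<Delta> \<and> (\<forall>F\<in>\<Delta>. \<forall>G. G \<subseteq> F \<longrightarrow> G \<in> \<Delta>)"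

definition complex_dim :: "('v::finite) set set \<Rightarrow> int" where
  "complex_dim \<Delta> = int (Max (card ` \<Delta>)) - 1"

definition balanced_colouring :: "('v::finite) set set \<Rightarrow> nat \<Rightarrow> (nat \<Rightarrow> 'v set) \<Rightarrow> bool" where
  "balanced_colouring \<Delta> d V \<longleftrightarrow>
     complex_dim \<Delta> = int d - 1 \<and>
     (\<Union>i\<in>{1..d}. V i) = UNIV \<and> disjoint_family_on V {1..d} \<and>
     (\<forall>F\<in>\<Delta>. \<forall>i\<in>{1..d}. card (F \<inter> V i) \<le> 1)"

definition SR_ideal :: "('v::finite) set set \<Rightarrow> ('v, 'k::field) mpoly set" where
  "SR_ideal \<Delta> = Idl\<^bsub>poly_ring\<^esub> {\<Prod>v\<in>F. pvar v | F. F \<notin> \<Delta>}"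

definition SR_ring :: "('v::finite) set set \<Rightarrow> ('v, 'k::field) mpoly set ring" where
  "SR_ring \<Delta> = poly_ring Quot SR_ideal \<Delta>"

definition cohen_macaulay_complex :: "'k::field itself \<Rightarrow> ('v::finite) set set \<Rightarrow> bool" where
  "cohen_macaulay_complex _ \<Delta> \<longleftrightarrow>
     cohen_macaulay_ring (SR_ring \<Delta> :: ('v, 'k) mpoly set ring)"


section \<open>Graded free resolutions, Tor and graded Betti numbers\<close>

text \<open>
  Finitely supported functions \<open>nat \<Rightarrow>\<^sub>0 'a\<close> with support in \<open>B\<close> form the free \<open>'a\<close>-module with
  basis \<open>B\<close>. A map out of it is given by the images \<open>D a\<close> of the basis elements \<open>a \<in> B\<close>.
\<close>
definition free_mod :: "nat set \<Rightarrow> (nat \<Rightarrow>\<^sub>0 'a::comm_ring_1) set" where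
  "free_mod B = {v. Poly_Mapping.keys v \<subseteq> B}"

definition fscale :: "'a::comm_ring_1 \<Rightarrow> (nat \<Rightarrow>\<^sub>0 'a) \<Rightarrow> (nat \<Rightarrow>\<^sub>0 'a)" where
  "fscale c v = Poly_Mapping.map (\<lambda>x. c * x) v"

definition lin_ext :: "(nat \<Rightarrow> (nat \<Rightarrow>\<^sub>0 'a::comm_ring_1)) \<Rightarrow> (nat \<Rightarrow>\<^sub>0 'a) \<Rightarrow> (nat \<Rightarrow>\<^sub>0 'a)" where
  "lin_ext D v = (\<Sum>a\<in>Poly_Mapping.keys v. fscale (Poly_Mapping.lookup v a) (D a))"

lemma lookup_fscale: "Poly_Mapping.lookup (fscale c v) b = c * Poly_Mapping.lookup v b"
  by (simp add: fscale_def Poly_Mapping.map.rep_eq when_def)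

lemma vector_space_fscale: "vector_space (fscale :: 'k::field \<Rightarrow> _)"
  by unfold_locales
    (rule poly_mapping_eqI, simp add: lookup_fscale lookup_add algebra_simps)+

text \<open>
  Data of a complex \<open>\<dots> \<rightarrow> F\<^sub>2 \<rightarrow> F\<^sub>1 \<rightarrow> F\<^sub>0\<close> of free modules over \<open>S = \<bbbF>[x\<^sub>v]\<close>: \<open>F\<^sub>i\<close> has basis
  \<open>{..<gf_rank i}\<close>, the basis element \<open>a\<close> of \<open>F\<^sub>i\<close> has degree \<open>gf_deg i a\<close>, and
  \<open>gf_diff i\<close> lists the images of the basis of \<open>F\<^bsub>i+1\<^esub>\<close> in \<open>F\<^sub>i\<close>. The augmentation from \<open>F\<^sub>0\<close>
  to \<open>S/I\<close> sends the basis element \<open>a\<close> to the class of \<open>gf_aug a\<close>.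
\<close>
record (overloaded) ('v, 'k) graded_free =
  gf_rank :: "nat \<Rightarrow> nat"
  gf_deg :: "nat \<Rightarrow> nat \<Rightarrow> nat"
  gf_aug :: "nat \<Rightarrow> ('v, 'k) mpoly"
  gf_diff :: "nat \<Rightarrow> nat \<Rightarrow> (nat \<Rightarrow>\<^sub>0 ('v, 'k) mpoly)"

definition gf_mod :: "('v, 'k::field) graded_free \<Rightarrow> nat \<Rightarrow> (nat \<Rightarrow>\<^sub>0 ('v, 'k) mpoly) set" where
  "gf_mod R i = free_mod {..<gf_rank R i}"

definition aug_map ::
  "('v, 'k::field) mpoly set \<Rightarrow> ('v, 'k) graded_free \<Rightarrow> (nat \<Rightarrow>\<^sub>0 ('v, 'k) mpoly) \<Rightarrow> ('v, 'k) mpoly set"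
  where
  "aug_map I R v =
     I +>\<^bsub>poly_ring\<^esub> (\<Sum>a\<in>Poly_Mapping.keys v. Poly_Mapping.lookup v a * gf_aug R a)"

definition graded_free_resolution ::
  "('v, 'k::field) mpoly set \<Rightarrow> ('v, 'k) graded_free \<Rightarrow> bool" where
  "graded_free_resolution I R \<longleftrightarrow>
     \<comment> \<open>the maps are well defined and homogeneous of degree 0\<close>
     (\<forall>a<gf_rank R 0. homogeneous (gf_deg R 0 a) (gf_aug R a)) \<and>
     (\<forall>i. \<forall>a<gf_rank R (Suc i). gf_diff R i a \<in> gf_mod R i \<and>
        (\<forall>b. \<forall>m\<in>Poly_Mapping.keys (Poly_Mapping.lookup (gf_diff R i a) b).
           mdeg m + gf_deg R i b = gf_deg R (Suc i) a)) \<and>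
     \<comment> \<open>exactness\<close>
     aug_map I R ` gf_mod R 0 = carrier (poly_ring Quot I) \<and>
     {v \<in> gf_mod R 0. aug_map I R v = \<zero>\<^bsub>poly_ring Quot I\<^esub>} = lin_ext (gf_diff R 0) ` gf_mod R 1 \<and>
     (\<forall>i. {v \<in> gf_mod R (Suc i). lin_ext (gf_diff R i) v = 0} =
        lin_ext (gf_diff R (Suc i)) ` gf_mod R (Suc (Suc i)))"

text \<open>
  Tensoring with \<open>\<bbbF> = S/(x\<^sub>v)\<close> turns a free \<open>S\<close>-module into the \<open>\<bbbF>\<close>-vector space on the same
  basis, and replaces the matrix entries of the differential by their constant terms. The part
  of degree \<open>c\<close> is spanned by the basis elements of degree \<open>c\<close>.
\<close>
definition tensor_mod :: "('v, 'k::field) graded_free \<Rightarrow> nat \<Rightarrow> nat \<Rightarrow> (nat \<Rightarrow>\<^sub>0 'k) set" where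
  "tensor_mod R i c = free_mod {a. a < gf_rank R i \<and> gf_deg R i a = c}"

definition tensor_diff :: "('v, 'k::field) graded_free \<Rightarrow> nat \<Rightarrow> (nat \<Rightarrow>\<^sub>0 'k) \<Rightarrow> (nat \<Rightarrow>\<^sub>0 'k)" where
  "tensor_diff R i =
     lin_ext (\<lambda>a. Poly_Mapping.map (\<lambda>f. Poly_Mapping.lookup f 0) (gf_diff R i a))"

definition tensor_cycles :: "('v, 'k::field) graded_free \<Rightarrow> nat \<Rightarrow> nat \<Rightarrow> (nat \<Rightarrow>\<^sub>0 'k) set" where
  "tensor_cycles R i c = (case i of
     0 \<Rightarrow> tensor_mod R 0 c
   | Suc i' \<Rightarrow> {w \<in> tensor_mod R i c. tensor_diff R i' w = 0})"

definition tensor_boundaries :: "('v, 'k::field) graded_free \<Rightarrow> nat \<Rightarrow> nat \<Rightarrow> (nat \<Rightarrow>\<^sub>0 'k) set"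
  where
  "tensor_boundaries R i c = tensor_diff R i ` tensor_mod R (Suc i) c"

text \<open>
  The dimension of the degree \<open>c\<close> part of \<open>Tor\<^sub>i(S/I, \<bbbF>)\<close>. Up to isomorphism Tor does not depend
  on the resolution. Boundaries are a subspace of the finite-dimensional space of cycles, so the
  difference of the dimensions is the dimension of the homology.
\<close>
definition tor_dim :: "('v, 'k::field) mpoly set \<Rightarrow> nat \<Rightarrow> nat \<Rightarrow> nat" where
  "tor_dim I i c = (let R = (SOME R. graded_free_resolution I R) in
     vector_space.dim fscale (tensor_cycles R i c) -
     vector_space.dim fscale (tensor_boundaries R i c))"

definition graded_betti :: "'k::field itself \<Rightarrow> ('v::finite) set set \<Rightarrow> nat \<Rightarrow> nat \<Rightarrow> nat" where
  "graded_betti _ \<Delta> i c = tor_dim (SR_ideal \<Delta> :: ('v, 'k) mpoly set) i c"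


section \<open>Lexicographic order and binomial coefficients\<close>

definition monomials :: "nat \<Rightarrow> nat \<Rightarrow> nat monom set" where
  "monomials m c = {u. Poly_Mapping.keys u \<subseteq> {1..m} \<and> mdeg u = c}"

text \<open>
  The order on \<open>nat \<Rightarrow>\<^sub>0 nat\<close> compares the values at the smallest index where they differ.
  On exponent vectors this is the lexicographic order with \<open>x\<^sub>1 > x\<^sub>2 > \<dots>\<close>.
\<close>
lemma monom_less_iff_lex:
  fixes u w :: "nat monom"
  shows "u < w \<longleftrightarrow> (\<exists>k. Poly_Mapping.lookup u k < Poly_Mapping.lookup w k \<and>
    (\<forall>l<k. Poly_Mapping.lookup u l = Poly_Mapping.lookup w l))"
  by (simp add: less_poly_mapping.rep_eq less_fun_def)

definition kth_largest :: "nat \<Rightarrow> 'a::linorder set \<Rightarrow> 'a \<Rightarrow> bool" where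
  "kth_largest k A u \<longleftrightarrow> u \<in> A \<and> card {w \<in> A. u \<le> w} = k"

text \<open>Binomial coefficient with integer lower index, zero if that index is negative.\<close>
definition ibinom :: "nat \<Rightarrow> int \<Rightarrow> nat" where
  "ibinom n k = (if k < 0 then 0 else n choose nat k)"

end

theory Submission
  imports Defs
begin

text \<open>
  Let \<open>\<theta>\<^sub>c\<close> be the sum of the variables of colour \<open>c\<close>. Since \<open>\<Delta>\<close> is Cohen--Macaulay there is some regular
  sequence of length \<open>d\<close> in the irrelevant ideal of \<open>S/I\<close>; by depth sensitivity of Koszul cohomology
  the system of parameters \<open>\<theta>\<close> is regular as well. For any linear forms \<open>y\<^sub>1, \<dots>, y\<^sub>m\<close>, where \<open>m = n - d\<close>,
  completing \<open>\<theta>\<close> to a basis, the long exact sequences of Tor for \<open>S/(\<theta>, y\<^sub>1, \<dots>, y\<^sub>l)\<close> give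
  \<open>\<beta>\<^bsub>i,i+j\<^esub> \<le> \<Sum>\<^sub>l ((m - 1 - l) choose (i - 1)) * dim (S/(I, \<theta>, y\<^sub>1, \<dots>, y\<^sub>l))\<^sub>j\<close>. Modulo \<open>I + (\<theta>)\<close> the
  product of any two variables of the same colour vanishes, so initially the degree \<open>j\<close> part is spanned by
  the \<open>j\<close>-cliques of a complete multipartite graph. Taking for \<open>y\<close> the differences of the \<open>a\<close>-th
  variable of each colour and the \<open>a\<close>-th variable of a largest colour class, for \<open>a = 1, 2, \<dots>\<close>, merges
  vertices of this graph, and each merging at level \<open>a\<close> of a graph with \<open>l\<close> vertices destroys exactly
  \<open>l - a\<close> edges. This keeps the number of edges below the number of quadratic monomials outside the
  lexicographic segment ending in \<open>x\<^sub>p x\<^sub>q\<close>, and a weak form of the Kruskal--Katona theorem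
  bounds the number of \<open>j\<close>-cliques.
\<close>

section \<open>Koszul cohomology and regular sequences\<close>

text \<open>The field may be finite, so linear forms in general position need not exist; the
  explicit differences take their place. They have to be regular on the polynomial ring only, and
  any part of a basis of the linear forms is. The Cohen-Macaulay hypothesis yields elements without
  constant term that are regular on \<open>S/I\<close> but possibly inhomogeneous; Koszul cohomology
  passes from them to the colour sums without localisation or prime avoidance. The number
  \<open>b\<close> is tuned to the initial graph. The colour sums remove one variable of each class,
  so a class of size \<open>n_i\<close> leaves \<open>n_i - 1\<close> vertices, and there are
  \<open>b - m\<close> pairs within the classes. The graph therefore has exactly as many edges as
  there are quadratic monomials below \<open>x_p x_q\<close>. A largest class supplies a partner at
  every level, and what remains after all merges has no edge. The increasing order of levels makes
  the deficit against the lexicographic count unimodal, so that its two ends control it. Tor is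
  computed from an arbitrary chosen resolution, which need not be minimal. Hence dimensions of
  homology are bounded by counting generators modulo boundaries.\<close>

interpretation ideal: Modules.module "(*) :: 'a::comm_ring_1 \<Rightarrow> 'a \<Rightarrow> 'a"
  by unfold_locales (auto simp: algebra_simps)

declare ideal.scale_scale [simp del] \<comment> \<open>the reverse of \<open>mult.assoc\<close>\<close>

lemma ideal_span_span_Un: "ideal.span (ideal.span A \<union> T) = ideal.span (A \<union> T)"
proof
  show "ideal.span (ideal.span A \<union> T) \<subseteq> ideal.span (A \<union> T)"
    using ideal.span_mono[of A "A \<union> T"] ideal.span_superset[of "A \<union> T"]
    by (intro ideal.span_minimal) auto
  show "ideal.span (A \<union> T) \<subseteq> ideal.span (ideal.span A \<union> T)"
    using ideal.span_superset[of A] by (intro ideal.span_mono) auto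
qed

lemma ideal_span_insert:
  "x \<in> ideal.span (insert a A) \<longleftrightarrow> (\<exists>k. x - k * a \<in> ideal.span A)"
  by (simp add: ideal.span_insert)

section \<open>Signs and the differential of the Koszul complex\<close>

definition ksgn :: "nat \<Rightarrow> nat set \<Rightarrow> 'a::comm_ring_1" where
  "ksgn k A = (-1) ^ card {a\<in>A. a < k}"

lemma ksgn_square [simp]: "ksgn k A * ksgn k A = 1"
  by (simp add: ksgn_def flip: power_mult_distrib)

lemma ksgn_remove_le: "l \<ge> k \<Longrightarrow> ksgn k (A - {l}) = ksgn k A"
  unfolding ksgn_def by (rule arg_cong[where f = "\<lambda>S. (-1) ^ card S"]) auto

lemma ksgn_remove_less:
  assumes "finite A" "l \<in> A" "l < k"
  shows "ksgn k (A - {l}) = - ksgn k A"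
proof -
  have "{a \<in> A. a < k} = insert l {a \<in> A - {l}. a < k}" using assms by auto
  then have "card {a \<in> A. a < k} = Suc (card {a \<in> A - {l}. a < k})"
    using assms(1) by simp
  then show ?thesis unfolding ksgn_def by simp
qed

lemma ksgn_insert_less:
  assumes "finite A" "l \<notin> A" "l < k"
  shows "ksgn k (insert l A) = - (ksgn k A :: 'a::comm_ring_1)"
proof -
  have "insert l A - {l} = A" using assms by auto
  then have "ksgn k A = - (ksgn k (insert l A) :: 'a::comm_ring_1)"
    using ksgn_remove_less[of "insert l A" l k, where ?'a = 'a] assms by simp
  then show ?thesis by (simp only: minus_minus)
qed

lemma ksgn_insert_le:
  assumes "l \<notin> A" "l \<ge> k"
  shows "ksgn k (insert l A) = ksgn k A"
  using ksgn_remove_le[of k l "insert l A", symmetric] assms by simp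

text \<open>Removing the smaller of two elements flips the sign of the larger, while removing the
  larger leaves the sign of the smaller; so exactly one side changes sign.\<close>

lemma ksgn_swap:
  assumes "finite A" "k \<in> A" "l \<in> A" "k \<noteq> l"
  shows "ksgn k A * ksgn l (A - {k}) = - (ksgn l A * ksgn k (A - {l}))"
proof (cases "k < l")
  case True
  then show ?thesis using assms by (simp add: ksgn_remove_less ksgn_remove_le mult.commute)
next
  case False
  then show ?thesis using assms by (simp add: ksgn_remove_less ksgn_remove_le mult.commute)
qed

definition kdiff :: "(nat \<Rightarrow> 'a::comm_ring_1) \<Rightarrow> (nat set \<Rightarrow> 'a) \<Rightarrow> nat set \<Rightarrow> 'a" where
  "kdiff \<theta> f A = (\<Sum>k\<in>A. ksgn k A * \<theta> k * f (A - {k}))"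

text \<open>The terms cancel in pairs off the diagonal. Showing that the sum equals its own negative
  would not suffice in characteristic 2.\<close>

lemma antisymmetric_double_sum_zero:
  fixes t :: "nat \<Rightarrow> nat \<Rightarrow> 'a::ab_group_add"
  assumes "finite A" "\<And>k l. k \<in> A \<Longrightarrow> l \<in> A \<Longrightarrow> k \<noteq> l \<Longrightarrow> t k l = - t l k"
  shows "(\<Sum>k\<in>A. \<Sum>l\<in>A - {k}. t k l) = 0"
  using assms
proof (induction A rule: finite_induct)
  case empty
  then show ?case by simp
next
  case (insert a A)
  have "(\<Sum>k\<in>A. \<Sum>l\<in>insert a A - {k}. t k l) = (\<Sum>k\<in>A. t k a + (\<Sum>l\<in>A - {k}. t k l))"
  proof (intro sum.cong refl)
    fix k assume "k \<in> A"
    then have "insert a A - {k} = insert a (A - {k})" using insert.hyps by auto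
    then show "(\<Sum>l\<in>insert a A - {k}. t k l) = t k a + (\<Sum>l\<in>A - {k}. t k l)"
      using insert.hyps by simp
  qed
  also have "\<dots> = (\<Sum>k\<in>A. t k a)"
  proof -
    have "(\<Sum>k\<in>A. \<Sum>l\<in>A - {k}. t k l) = 0" by (rule insert.IH) (rule insert.prems, auto)
    then show ?thesis by (simp add: sum.distrib)
  qed
  also have "\<dots> = (\<Sum>k\<in>A. - t a k)"
  proof (intro sum.cong refl)
    fix k assume "k \<in> A"
    with insert.hyps show "t k a = - t a k" by (intro insert.prems) auto
  qed
  also have "\<dots> = - (\<Sum>k\<in>A. t a k)" by (simp add: sum_negf)
  finally have "(\<Sum>k\<in>A. \<Sum>l\<in>insert a A - {k}. t k l) = - (\<Sum>k\<in>A. t a k)" .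
  moreover have "(\<Sum>l\<in>insert a A - {a}. t a l) = (\<Sum>k\<in>A. t a k)"
    using insert.hyps by (intro sum.cong) auto
  ultimately show ?case unfolding sum.insert[OF insert.hyps] by (metis add.right_inverse)
qed

lemma kdiff_kdiff:
  assumes "finite A"
  shows "kdiff \<theta> (kdiff \<theta> f) A = 0"
proof -
  have "kdiff \<theta> (kdiff \<theta> f) A =
      (\<Sum>k\<in>A. \<Sum>l\<in>A - {k}. (ksgn k A * ksgn l (A - {k})) * (\<theta> k * \<theta> l * f (A - {k} - {l})))"
    unfolding kdiff_def sum_distrib_left by (intro sum.cong refl) (simp only: ac_simps)
  also have "\<dots> = 0"
  proof (rule antisymmetric_double_sum_zero)
    fix k l assume *: "k \<in> A" "l \<in> A" "k \<noteq> l"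
    have "A - {k} - {l} = A - {l} - {k}" by auto
    then show "(ksgn k A * ksgn l (A - {k})) * (\<theta> k * \<theta> l * f (A - {k} - {l})) =
      - ((ksgn l A * ksgn k (A - {l})) * (\<theta> l * \<theta> k * f (A - {l} - {k})))"
      by (simp only: ksgn_swap[OF assms *, where ?'a = 'a] mult_minus_left mult.commute[of "\<theta> k"])
  qed (fact assms)
  finally show ?thesis .
qed

text \<open>Contraction with the \<open>k\<close>-th basis vector of the exterior algebra.\<close>

definition kcontr :: "nat \<Rightarrow> (nat set \<Rightarrow> 'a::comm_ring_1) \<Rightarrow> nat set \<Rightarrow> 'a" where
  "kcontr k f A = (if k \<in> A then 0 else ksgn k A * f (insert k A))"

text \<open>Multiplication by \<open>\<theta> k\<close> is null-homotopic and so acts as zero on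
  Koszul cohomology. For \<open>k\<close> in \<open>A\<close> only the summand at \<open>k\<close>
  of the first term survives; otherwise the summand at \<open>k\<close> of the second term is
  \<open>\<theta> k * f A\<close> and its other summands cancel the first term.\<close>

lemma kdiff_homotopy:
  assumes "finite A"
  shows "kdiff \<theta> (kcontr k f) A + kcontr k (kdiff \<theta> f) A = \<theta> k * f A"
proof (cases "k \<in> A")
  case True
  have "kdiff \<theta> (kcontr k f) A = (\<Sum>l\<in>A. if l = k then \<theta> k * f A else 0)"
    unfolding kdiff_def
  proof (intro sum.cong refl)
    fix l assume "l \<in> A"
    show "ksgn l A * \<theta> l * kcontr k f (A - {l}) = (if l = k then \<theta> k * f A else 0)"
    proof (cases "l = k")
      case True
      have "insert k (A - {k}) = A" using \<open>k \<in> A\<close> by auto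
      then have "kcontr k f (A - {k}) = ksgn k A * f A" by (simp add: kcontr_def ksgn_remove_le)
      moreover have "ksgn k A * \<theta> k * (ksgn k A * f A) = (ksgn k A * ksgn k A) * (\<theta> k * f A)"
        by (simp only: ac_simps)
      ultimately show ?thesis using True by simp
    next
      case False
      then show ?thesis using \<open>k \<in> A\<close> by (simp add: kcontr_def)
    qed
  qed
  then show ?thesis using True assms by (simp add: kcontr_def)
next
  case False
  have "kcontr k (kdiff \<theta> f) A = ksgn k A * kdiff \<theta> f (insert k A)"
    using False by (simp add: kcontr_def)
  also have "\<dots> = ksgn k A * (ksgn k A * \<theta> k * f A) +
      (\<Sum>l\<in>A. ksgn k A * (ksgn l (insert k A) * \<theta> l * f (insert k A - {l})))"
    unfolding kdiff_def using False assms ksgn_insert_le[of k A k, where ?'a = 'a]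
    by (simp add: distrib_left sum_distrib_left)
  also have "ksgn k A * (ksgn k A * \<theta> k * f A) = (ksgn k A * ksgn k A) * (\<theta> k * f A)"
    by (simp only: ac_simps)
  also have "\<dots> = \<theta> k * f A" by simp
  also have "(\<Sum>l\<in>A. ksgn k A * (ksgn l (insert k A) * \<theta> l * f (insert k A - {l}))) =
      - kdiff \<theta> (kcontr k f) A"
    unfolding kdiff_def sum_negf[symmetric]
  proof (intro sum.cong refl)
    fix l assume l: "l \<in> A"
    then have lk: "l \<noteq> k" "insert k A - {l} = insert k (A - {l})" using False by auto
    have sg: "ksgn k A * ksgn l (insert k A) = (- (ksgn l A * ksgn k (A - {l})) :: 'a)"
    proof (cases "l < k")
      case True
      then show ?thesis using l assms False ksgn_remove_less[of A l k, where ?'a = 'a]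
          ksgn_insert_le[of k A l, where ?'a = 'a] by simp
    next
      case False
      then show ?thesis using l assms \<open>k \<notin> A\<close> \<open>l \<noteq> k\<close> ksgn_remove_le[of k l A, where ?'a = 'a]
          ksgn_insert_less[of A k l, where ?'a = 'a] by simp
    qed
    define F where "F = f (insert k (A - {l}))"
    have c: "kcontr k f (A - {l}) = ksgn k (A - {l}) * F"
      using False by (simp add: kcontr_def F_def)
    have "ksgn k A * (ksgn l (insert k A) * \<theta> l * F) = (ksgn k A * ksgn l (insert k A)) * (\<theta> l * F)"
      by (simp only: ac_simps)
    also have "\<dots> = - ((ksgn l A * ksgn k (A - {l})) * (\<theta> l * F))" by (simp only: sg mult_minus_left)
    also have "(ksgn l A * ksgn k (A - {l})) * (\<theta> l * F) = ksgn l A * \<theta> l * (ksgn k (A - {l}) * F)"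
      by (simp only: ac_simps)
    finally show "ksgn k A * (ksgn l (insert k A) * \<theta> l * f (insert k A - {l})) =
        - (ksgn l A * \<theta> l * kcontr k f (A - {l}))"
      unfolding c lk(2) F_def .
  qed
  finally have "kcontr k (kdiff \<theta> f) A = \<theta> k * f A + - kdiff \<theta> (kcontr k f) A" .
  then show ?thesis by (simp only: add.commute[of "\<theta> k * f A"] add_minus_cancel)
qed

lemma kdiff_add: "kdiff \<theta> (\<lambda>A. f A + g A) A = kdiff \<theta> f A + kdiff \<theta> g A"
  by (simp only: kdiff_def distrib_left sum.distrib)

lemma kdiff_diff: "kdiff \<theta> (\<lambda>A. f A - g A) A = kdiff \<theta> f A - kdiff \<theta> g A"
  by (simp only: kdiff_def right_diff_distrib sum_subtractf)

lemma kdiff_scale: "kdiff \<theta> (\<lambda>A. c * f A) A = c * kdiff \<theta> f A"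
  by (simp only: kdiff_def sum_distrib_left mult.left_commute[of _ c])

lemma kdiff_mem:
  assumes "ideal.subspace J" "\<And>k. k \<in> A \<Longrightarrow> f (A - {k}) \<in> J"
  shows "kdiff \<theta> f A \<in> J"
  unfolding kdiff_def using assms
  by (intro ideal.subspace_sum) (auto intro: ideal.subspace_scale)

text \<open>An \<open>i\<close>-cochain of the Koszul complex is a function on the \<open>i\<close>-element subsets of \<open>{..<n}\<close>;
  the values on other sets are irrelevant.\<close>
definition koszul_acyclic :: "(nat \<Rightarrow> 'a::comm_ring_1) \<Rightarrow> nat \<Rightarrow> 'a set \<Rightarrow> nat \<Rightarrow> bool" where
  "koszul_acyclic \<theta> n J i \<longleftrightarrow>
    (\<forall>f. (\<forall>A\<subseteq>{..<n}. card A = Suc i \<longrightarrow> kdiff \<theta> f A \<in> J) \<longrightarrow>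
      (\<exists>g. \<forall>A\<subseteq>{..<n}. card A = i \<longrightarrow> f A - kdiff \<theta> g A \<in> J))"

text \<open>If \<open>y\<close> is regular modulo \<open>J\<close>, then vanishing for \<open>J + (y)\<close> makes multiplication by \<open>y\<close>
  injective on the next cohomology; being nilpotent there, it forces this cohomology to vanish.\<close>
lemma koszul_acyclic_step:
  fixes \<theta> :: "nat \<Rightarrow> 'a::comm_ring_1"
  assumes J: "ideal.subspace J"
    and reg: "\<And>a. y * a \<in> J \<Longrightarrow> a \<in> J"
    and nil: "y ^ e \<in> ideal.span (J \<union> \<theta> ` {..<n})"
    and IH: "\<And>i'. i = Suc i' \<Longrightarrow> koszul_acyclic \<theta> n (ideal.span (insert y J)) i'"
  shows "koszul_acyclic \<theta> n J i"
  unfolding koszul_acyclic_def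
proof (intro allI impI)
  fix f assume f: "\<forall>A\<subseteq>{..<n}. card A = Suc i \<longrightarrow> kdiff \<theta> f A \<in> J"
  define H where "H f \<longleftrightarrow> (\<exists>g. \<forall>A\<subseteq>{..<n}. card A = i \<longrightarrow> f A - kdiff \<theta> g A \<in> J)" for f
  have fin: "finite A" if "A \<subseteq> {..<n}" for A using that by (rule finite_subset) simp
  have cycle: "kdiff \<theta> (\<lambda>A. c * f A) A \<in> J" if "A \<subseteq> {..<n}" "card A = Suc i" for A c
    using f that J by (simp add: kdiff_scale ideal.subspace_scale)
  \<comment> \<open>The annihilator of the class of \<open>f\<close> in cohomology. It contains
    \<open>J\<close> and every \<open>\<theta> k\<close>, hence also the given power of
    \<open>y\<close>.\<close>
  have H_ideal: "ideal.subspace {c. H (\<lambda>A. c * f A)}"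
  proof (rule ideal.subspaceI)
    show "0 \<in> {c. H (\<lambda>A. c * f A)}" unfolding H_def
      using J by (auto intro!: exI[of _ "\<lambda>_. 0"] simp: kdiff_def ideal.subspace_0)
  next
    fix x y assume "x \<in> {c. H (\<lambda>A. c * f A)}" "y \<in> {c. H (\<lambda>A. c * f A)}"
    then obtain g h where "\<forall>A\<subseteq>{..<n}. card A = i \<longrightarrow> x * f A - kdiff \<theta> g A \<in> J"
      "\<forall>A\<subseteq>{..<n}. card A = i \<longrightarrow> y * f A - kdiff \<theta> h A \<in> J" unfolding H_def by auto
    then have "\<forall>A\<subseteq>{..<n}. card A = i \<longrightarrow>
        (x * f A - kdiff \<theta> g A) + (y * f A - kdiff \<theta> h A) \<in> J"
      using J ideal.subspace_add by blast
    then show "x + y \<in> {c. H (\<lambda>A. c * f A)}" unfolding H_def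
      by (auto intro!: exI[of _ "\<lambda>A. g A + h A"] simp: kdiff_add algebra_simps)
  next
    fix c x assume "x \<in> {c. H (\<lambda>A. c * f A)}"
    then obtain g where "\<forall>A\<subseteq>{..<n}. card A = i \<longrightarrow> x * f A - kdiff \<theta> g A \<in> J"
      unfolding H_def by auto
    then have "\<forall>A\<subseteq>{..<n}. card A = i \<longrightarrow> c * (x * f A - kdiff \<theta> g A) \<in> J"
      using J ideal.subspace_scale by blast
    then show "c * x \<in> {c. H (\<lambda>A. c * f A)}" unfolding H_def
      by (intro CollectI exI[of _ "\<lambda>A. c * g A"])
        (simp only: kdiff_scale right_diff_distrib mult.assoc)
  qed
  have H_theta: "H (\<lambda>A. \<theta> k * f A)" if "k < n" for k
    unfolding H_def
  proof (intro exI allI impI)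
    fix A assume A: "A \<subseteq> {..<n}" "card A = i"
    have "kcontr k (kdiff \<theta> f) A \<in> J"
    proof (cases "k \<in> A")
      case False
      then have "card (insert k A) = Suc i" "insert k A \<subseteq> {..<n}"
        using A fin[OF A(1)] that by auto
      then show ?thesis using f False J by (auto simp: kcontr_def intro: ideal.subspace_scale)
    qed (use J in \<open>auto simp: kcontr_def ideal.subspace_0\<close>)
    then show "\<theta> k * f A - kdiff \<theta> (kcontr k f) A \<in> J"
      using kdiff_homotopy[OF fin[OF A(1)], of \<theta> k f] by (metis add_diff_cancel_left')
  qed
  have H_J: "H (\<lambda>A. a * f A)" if "a \<in> J" for a
    unfolding H_def
  proof (intro exI[of _ "\<lambda>_. 0"] allI impI)
    fix A
    have "f A * a \<in> J" by (rule ideal.subspace_scale[OF J that])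
    then show "a * f A - kdiff \<theta> (\<lambda>_. 0) A \<in> J" by (simp add: kdiff_def mult.commute[of a])
  qed
  have "ideal.span (J \<union> \<theta> ` {..<n}) \<subseteq> {c. H (\<lambda>A. c * f A)}"
    by (rule ideal.span_minimal[OF _ H_ideal]) (use H_theta H_J in auto)
  then have Hye: "H (\<lambda>A. y ^ e * f A)" using nil by auto
  \<comment> \<open>If \<open>y f'\<close> is the coboundary of \<open>g\<close> modulo
    \<open>J\<close>, then \<open>g\<close> is a cocycle modulo \<open>J + (y)\<close>. By
    \<open>IH\<close> it is a coboundary plus \<open>y g'\<close>, and cancelling \<open>y\<close>
    shows that \<open>f'\<close> is the coboundary of \<open>g'\<close>.\<close>
  have H_cancel: "H f'" if Hy: "H (\<lambda>A. y * f' A)" for f'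
  proof (cases i)
    case 0
    then have "f' {} \<in> J" using Hy reg unfolding H_def by (auto simp: kdiff_def)
    then show ?thesis unfolding H_def using 0 fin by (auto simp: kdiff_def)
  next
    case (Suc i')
    obtain g where g: "\<And>A. A \<subseteq> {..<n} \<Longrightarrow> card A = i \<Longrightarrow> y * f' A - kdiff \<theta> g A \<in> J"
      using Hy unfolding H_def by auto
    let ?J' = "ideal.span (insert y J)"
    have "kdiff \<theta> g A \<in> ?J'" if "A \<subseteq> {..<n}" "card A = Suc i'" for A
    proof -
      have "y * f' A - kdiff \<theta> g A \<in> ?J'" using g[of A] that Suc by (intro ideal.span_base) auto
      moreover have "f' A * y \<in> ?J'" by (intro ideal.span_scale ideal.span_base) auto
      ultimately have "f' A * y - (y * f' A - kdiff \<theta> g A) \<in> ?J'" using ideal.span_diff by blast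
      then show ?thesis by (simp add: mult.commute)
    qed
    then obtain h where h: "\<And>A. A \<subseteq> {..<n} \<Longrightarrow> card A = i' \<Longrightarrow> g A - kdiff \<theta> h A \<in> ?J'"
      using IH[OF Suc] unfolding koszul_acyclic_def by metis
    have "\<exists>k. g A - kdiff \<theta> h A - k * y \<in> J" if "A \<subseteq> {..<n}" "card A = i'" for A
      using h[OF that] ideal_span_insert[of _ y J] ideal.span_eq_iff[THEN iffD2, OF J] by simp
    then obtain g' where g': "\<And>A. A \<subseteq> {..<n} \<Longrightarrow> card A = i' \<Longrightarrow> g A - kdiff \<theta> h A - g' A * y \<in> J"
      by metis
    have "f' A - kdiff \<theta> g' A \<in> J" if A: "A \<subseteq> {..<n}" "card A = i" for A
    proof (rule reg)
      have "kdiff \<theta> (\<lambda>A. g A - kdiff \<theta> h A - y * g' A) A \<in> J"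
      proof (rule kdiff_mem[OF J])
        fix k assume "k \<in> A"
        then have "A - {k} \<subseteq> {..<n}" "card (A - {k}) = i'" using A Suc fin[OF A(1)] by auto
        from g'[OF this] show "g (A - {k}) - kdiff \<theta> h (A - {k}) - y * g' (A - {k}) \<in> J"
          by (simp add: mult.commute[of y])
      qed
      also have "kdiff \<theta> (\<lambda>A. g A - kdiff \<theta> h A - y * g' A) A = kdiff \<theta> g A - y * kdiff \<theta> g' A"
        using kdiff_kdiff[OF fin[OF A(1)], of \<theta> h] by (simp add: kdiff_diff kdiff_scale)
      finally have "(y * f' A - kdiff \<theta> g A) + (kdiff \<theta> g A - y * kdiff \<theta> g' A) \<in> J"
        using g[OF A] J ideal.subspace_add by blast
      then show "y * (f' A - kdiff \<theta> g' A) \<in> J" by (simp add: right_diff_distrib)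
    qed
    then show ?thesis unfolding H_def by blast
  qed
  have H_root: "H (\<lambda>A. y ^ e * f A) \<Longrightarrow> H f" for e
  proof (induction e)
    case (Suc e)
    have "H (\<lambda>A. y * (y ^ e * f A))" using Suc.prems by (simp only: power_Suc mult.assoc)
    then show ?case by (rule Suc.IH[OF H_cancel])
  qed simp
  have "H f" using Hye by (rule H_root)
  then show "\<exists>g. \<forall>A\<subseteq>{..<n}. card A = i \<longrightarrow> f A - kdiff \<theta> g A \<in> J"
    unfolding H_def by blast
qed

section \<open>Depth sensitivity and the first syzygies\<close>

text \<open>Regularity in the weak sense: \<open>J\<close> and the list may together generate the
  unit ideal.\<close>

definition ideal_regular :: "'a::comm_ring_1 set \<Rightarrow> 'a list \<Rightarrow> bool" where
  "ideal_regular J ys \<longleftrightarrow> (\<forall>s<length ys. \<forall>a.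
     ys ! s * a \<in> ideal.span (J \<union> set (take s ys)) \<longrightarrow> a \<in> ideal.span (J \<union> set (take s ys)))"

text \<open>Depth sensitivity: cohomology vanishes below the length of a regular sequence in the
  radical of \<open>J + (\<theta>)\<close>. Passing to the ideal enlarged by the first element
  trades one element of the sequence for one cohomological degree.\<close>

lemma koszul_acyclic_of_regular:
  fixes \<theta> :: "nat \<Rightarrow> 'a::comm_ring_1"
  assumes "ideal.subspace J" "ideal_regular J ys"
    and "\<And>y. y \<in> set ys \<Longrightarrow> \<exists>e. y ^ e \<in> ideal.span (J \<union> \<theta> ` {..<n})"
    and "i < length ys"
  shows "koszul_acyclic \<theta> n J i"
  using assms
proof (induction ys arbitrary: J i)
  case (Cons y ys)
  let ?J' = "ideal.span (insert y J)"
  have spanJ: "ideal.span J = J" using Cons.prems(1) by simp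
  obtain e where e: "y ^ e \<in> ideal.span (J \<union> \<theta> ` {..<n})" using Cons.prems(3) by auto
  have sp: "ideal.span (?J' \<union> T) = ideal.span (J \<union> insert y T)" for T
    using ideal_span_span_Un[of "insert y J" T] by simp
  have reg': "ideal_regular ?J' ys"
    unfolding ideal_regular_def
  proof (intro allI impI)
    fix s a assume "s < length ys" "ys ! s * a \<in> ideal.span (?J' \<union> set (take s ys))"
    then show "a \<in> ideal.span (?J' \<union> set (take s ys))"
      using Cons.prems(2)[unfolded ideal_regular_def, rule_format, of "Suc s" a] by (simp add: sp)
  qed
  show ?case
  proof (rule koszul_acyclic_step[OF Cons.prems(1) _ e])
    show "a \<in> J" if "y * a \<in> J" for a
      using Cons.prems(2)[unfolded ideal_regular_def, rule_format, of 0 a] that spanJ by simp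
    show "koszul_acyclic \<theta> n ?J' i'" if "i = Suc i'" for i'
    proof (rule Cons.IH[OF _ reg'])
      show "\<exists>e. y' ^ e \<in> ideal.span (?J' \<union> \<theta> ` {..<n})" if "y' \<in> set ys" for y'
      proof -
        have "ideal.span (J \<union> \<theta> ` {..<n}) \<subseteq> ideal.span (?J' \<union> \<theta> ` {..<n})"
          unfolding sp by (rule ideal.span_mono) auto
        then show ?thesis using Cons.prems(3)[of y'] that by auto
      qed
    qed (use Cons.prems that in auto)
  qed
qed simp

text \<open>Koszul self-duality: a relation is a cocycle in degree \<open>n - 1\<close>, with
  \<open>a k\<close> placed on the complement of \<open>k\<close>, and a cochain of which it is the
  coboundary is an alternating matrix. That \<open>b k k = 0\<close> is listed separately because
  antisymmetry does not give it in characteristic 2.\<close>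

lemma relation_trivial:
  fixes \<theta> :: "nat \<Rightarrow> 'a::comm_ring_1"
  assumes ac: "koszul_acyclic \<theta> n J (n - 1)" and n: "n > 0" 
    and rel: "(\<Sum>k<n. \<theta> k * a k) \<in> J" and J: "ideal.subspace J"
  shows "\<exists>b. (\<forall>k l. b k l = - b l k) \<and> (\<forall>k. b k k = 0) \<and>
           (\<forall>k<n. a k - (\<Sum>l<n. b k l * \<theta> l) \<in> J)"
proof -
  let ?U = "{..<n}"
  \<comment> \<open>On the complement of \<open>k\<close> the sum has the single term
    \<open>ksgn k ?U * a k\<close>; summing avoids naming the missing index.\<close>
  define f where "f A = (\<Sum>k\<in>?U - A. ksgn k ?U * a k)" for A
  have f: "f (?U - {k}) = ksgn k ?U * a k" if "k < n" for k
  proof -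
    have "?U - (?U - {k}) = {k}" using that by auto
    then show ?thesis unfolding f_def by simp
  qed
  have "kdiff \<theta> f ?U = (\<Sum>k<n. \<theta> k * a k)"
    unfolding kdiff_def
  proof (intro sum.cong refl)
    fix k assume "k \<in> ?U"
    then have "ksgn k ?U * \<theta> k * f (?U - {k}) = ksgn k ?U * \<theta> k * (ksgn k ?U * a k)"
      using f by simp
    also have "\<dots> = (ksgn k ?U * ksgn k ?U) * (\<theta> k * a k)" by (simp only: ac_simps)
    finally show "ksgn k ?U * \<theta> k * f (?U - {k}) = \<theta> k * a k" by simp
  qed
  then have fU: "kdiff \<theta> f ?U \<in> J" using rel by simp
  have "A = ?U" if "A \<subseteq> ?U" "card A = Suc (n - 1)" for A
    using that n by (intro card_subset_eq) auto
  then have "\<forall>A\<subseteq>?U. card A = Suc (n - 1) \<longrightarrow> kdiff \<theta> f A \<in> J"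
    using fU by metis
  then obtain g where g: "\<And>A. A \<subseteq> ?U \<Longrightarrow> card A = n - 1 \<Longrightarrow> f A - kdiff \<theta> g A \<in> J"
    using ac unfolding koszul_acyclic_def by metis
  define b where "b k l = (if k < n \<and> l < n \<and> k \<noteq> l
      then ksgn k ?U * ksgn l (?U - {k}) * g (?U - {k} - {l}) else 0)" for k l
  have b1: "b k l = - b l k" for k l
  proof (cases "k < n \<and> l < n \<and> k \<noteq> l")
    case True
    have *: "?U - {k} - {l} = ?U - {l} - {k}" by auto
    have "ksgn k ?U * ksgn l (?U - {k}) = - (ksgn l ?U * ksgn k (?U - {l}) :: 'a)"
      using True by (intro ksgn_swap) auto
    then have "ksgn k ?U * ksgn l (?U - {k}) * g (?U - {k} - {l}) =
        - (ksgn l ?U * ksgn k (?U - {l}) * g (?U - {l} - {k}))"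
      by (simp only: * mult_minus_left)
    then show ?thesis using True unfolding b_def by simp
  qed (auto simp: b_def)
  have b3: "a k - (\<Sum>l<n. b k l * \<theta> l) \<in> J" if k: "k < n" for k
  proof -
    have "f (?U - {k}) - kdiff \<theta> g (?U - {k}) \<in> J" using k by (intro g) auto
    then have "ksgn k ?U * (f (?U - {k}) - kdiff \<theta> g (?U - {k})) \<in> J"
      using J ideal.subspace_scale by blast
    also have "ksgn k ?U * (f (?U - {k}) - kdiff \<theta> g (?U - {k})) =
        a k - (\<Sum>l\<in>?U - {k}. b k l * \<theta> l)"
    proof -
      have "ksgn k ?U * f (?U - {k}) = a k" using f[OF k] by (metis ksgn_square mult.assoc mult_1)
      moreover have "ksgn k ?U * kdiff \<theta> g (?U - {k}) = (\<Sum>l\<in>?U - {k}. b k l * \<theta> l)"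
        unfolding kdiff_def sum_distrib_left
      proof (intro sum.cong refl)
        fix l assume "l \<in> ?U - {k}"
        then have "b k l = ksgn k ?U * ksgn l (?U - {k}) * g (?U - {k} - {l})"
          using k unfolding b_def by auto
        then show "ksgn k ?U * (ksgn l (?U - {k}) * \<theta> l * g (?U - {k} - {l})) = b k l * \<theta> l"
          by (simp only: ac_simps)
      qed
      ultimately show ?thesis by (simp add: right_diff_distrib)
    qed
    also have "(\<Sum>l\<in>?U - {k}. b k l * \<theta> l) = (\<Sum>l<n. b k l * \<theta> l)"
      using k by (subst sum.remove[of ?U k]) (auto simp: b_def)
    finally show ?thesis .
  qed
  have b2: "b k k = 0" for k by (simp add: b_def)
  show ?thesis by (rule exI[of _ b], intro conjI allI impI b1 b2 b3)
qed

section \<open>Graded polynomial rings\<close>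

lemma mdeg_superset:
  assumes "finite A" "Poly_Mapping.keys m \<subseteq> A"
  shows "mdeg m = (\<Sum>v\<in>A. Poly_Mapping.lookup m v)"
  unfolding mdeg_def using assms by (intro sum.mono_neutral_left) (auto simp: in_keys_iff)

lemma mdeg_add: "mdeg (a + b) = mdeg a + mdeg b"
proof -
  let ?A = "Poly_Mapping.keys a \<union> Poly_Mapping.keys b"
  have "mdeg (a + b) = (\<Sum>v\<in>?A. Poly_Mapping.lookup (a + b) v)"
    by (intro mdeg_superset) (auto simp: Poly_Mapping.keys_add)
  also have "\<dots> = mdeg a + mdeg b"
    by (simp add: lookup_add sum.distrib mdeg_superset[of ?A a] mdeg_superset[of ?A b])
  finally show ?thesis .
qed

lemma mdeg_0 [simp]: "mdeg 0 = 0" by (simp add: mdeg_def)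
lemma mdeg_mvar [simp]: "mdeg (mvar v) = 1" by (simp add: mdeg_def mvar_def)

lemma mdeg_eq_0_iff: "mdeg m = 0 \<longleftrightarrow> m = 0"
proof
  assume "mdeg m = 0"
  then show "m = 0" by (intro poly_mapping_eqI) (auto simp: mdeg_def in_keys_iff)
qed simp

definition hcomp :: "nat \<Rightarrow> ('v, 'k::field) mpoly \<Rightarrow> ('v, 'k) mpoly" where
  "hcomp e f = (\<Sum>m | m \<in> Poly_Mapping.keys f \<and> mdeg m = e. Poly_Mapping.single m (Poly_Mapping.lookup f m))"

lemma lookup_hcomp: "Poly_Mapping.lookup (hcomp e f) m = (if mdeg m = e then Poly_Mapping.lookup f m else 0)"
proof -
  have "Poly_Mapping.lookup (hcomp e f) m =
      (\<Sum>m' | m' \<in> Poly_Mapping.keys f \<and> mdeg m' = e. if m' = m then Poly_Mapping.lookup f m else 0)"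
    unfolding hcomp_def lookup_sum by (intro sum.cong) (auto simp: lookup_single)
  then show ?thesis by (auto simp: in_keys_iff)
qed

lemma hcomp_0 [simp]: "hcomp e 0 = 0"
  by (rule poly_mapping_eqI) (simp add: lookup_hcomp)

lemma hcomp_add: "hcomp e (f + g) = hcomp e f + hcomp e g"
  by (rule poly_mapping_eqI) (simp add: lookup_hcomp lookup_add)

lemma hcomp_uminus: "hcomp e (- f) = - hcomp e f"
  by (rule poly_mapping_eqI) (simp add: lookup_hcomp)

lemma hcomp_diff: "hcomp e (f - g) = hcomp e f - hcomp e g"
  by (rule poly_mapping_eqI) (simp add: lookup_hcomp lookup_minus)

lemma hcomp_sum: "hcomp e (sum f A) = (\<Sum>x\<in>A. hcomp e (f x))"
  by (induction A rule: infinite_finite_induct) (auto simp: hcomp_add)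

lemma homogeneous_hcomp [simp]: "homogeneous e (hcomp e f)"
  by (auto simp: homogeneous_def in_keys_iff lookup_hcomp split: if_splits)

lemma hcomp_homogeneous: "homogeneous c f \<Longrightarrow> hcomp e f = (if e = c then f else 0)"
  by (rule poly_mapping_eqI) (auto simp: homogeneous_def lookup_hcomp in_keys_iff)

lemma homogeneous_0 [simp]: "homogeneous c 0" by (simp add: homogeneous_def)

lemma homogeneous_add: "homogeneous c f \<Longrightarrow> homogeneous c g \<Longrightarrow> homogeneous c (f + g)"
  unfolding homogeneous_def using Poly_Mapping.keys_add[of f g] by blast

lemma homogeneous_uminus: "homogeneous c f \<Longrightarrow> homogeneous c (- f)"
  unfolding homogeneous_def by (simp add: in_keys_iff)

lemma homogeneous_diff: "homogeneous c f \<Longrightarrow> homogeneous c g \<Longrightarrow> homogeneous c (f - g)"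
  using homogeneous_add[of c f "- g"] homogeneous_uminus[of c g] by simp

lemma homogeneous_sum: "(\<And>x. x \<in> A \<Longrightarrow> homogeneous c (f x)) \<Longrightarrow> homogeneous c (sum f A)"
  by (induction A rule: infinite_finite_induct) (auto intro: homogeneous_add)

lemma homogeneous_mult: "homogeneous c f \<Longrightarrow> homogeneous e g \<Longrightarrow> homogeneous (c + e) (f * g)"
  unfolding homogeneous_def using Poly_Mapping.keys_mult[of f g] by (force simp: mdeg_add)

lemma homogeneous_single: "homogeneous (mdeg m) (Poly_Mapping.single m c)"
  by (simp add: homogeneous_def)

lemma homogeneous_pvar [simp]: "homogeneous 1 (pvar v)"
  unfolding pvar_def using homogeneous_single[of "mvar v" 1] by simp

lemma sum_hcomp: "f = (\<Sum>e\<in>mdeg ` Poly_Mapping.keys f. hcomp e f)"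
proof (rule poly_mapping_eqI)
  fix m
  show "Poly_Mapping.lookup f m = Poly_Mapping.lookup (\<Sum>e\<in>mdeg ` Poly_Mapping.keys f. hcomp e f) m"
    by (auto simp: lookup_sum lookup_hcomp in_keys_iff image_iff)
qed

lemma hcomp_mult_homogeneous:
  assumes "homogeneous c g"
  shows "hcomp e (g * f) = (if e < c then 0 else g * hcomp (e - c) f)"
proof -
  have hom: "homogeneous (c + e') (g * hcomp e' f)" for e'
    using assms by (intro homogeneous_mult) auto
  have "hcomp e (g * f) = hcomp e (g * (\<Sum>e'\<in>mdeg ` Poly_Mapping.keys f. hcomp e' f))"
    using sum_hcomp[of f] by simp
  also have "\<dots> = (\<Sum>e'\<in>mdeg ` Poly_Mapping.keys f. if e = c + e' then g * hcomp e' f else 0)"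
    by (simp add: sum_distrib_left hcomp_sum hcomp_homogeneous[OF hom])
  also have "\<dots> = (\<Sum>e'\<in>mdeg ` Poly_Mapping.keys f. if e' = e - c then (if e < c then 0 else g * hcomp (e - c) f) else 0)"
    by (intro sum.cong refl) auto
  also have "\<dots> = (if e < c then 0 else g * hcomp (e - c) f)"
  proof (cases "e - c \<in> mdeg ` Poly_Mapping.keys f")
    case True
    then show ?thesis by simp
  next
    case False
    have "hcomp (e - c) f = 0"
    proof (rule poly_mapping_eqI)
      fix m show "Poly_Mapping.lookup (hcomp (e - c) f) m = Poly_Mapping.lookup 0 m"
      proof (cases "m \<in> Poly_Mapping.keys f")
        case True
        then have "mdeg m \<noteq> e - c" using False by (metis imageI)
        then show ?thesis by (simp add: lookup_hcomp)
      qed (auto simp: lookup_hcomp in_keys_iff)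
    qed
    then show ?thesis by simp
  qed
  finally show ?thesis .
qed

definition graded_ideal :: "('v, 'k::field) mpoly set \<Rightarrow> bool" where
  "graded_ideal J \<longleftrightarrow> ideal.subspace J \<and> (\<forall>f\<in>J. \<forall>e. hcomp e f \<in> J)"

lemma graded_ideal_span:
  assumes "\<And>g. g \<in> G \<Longrightarrow> \<exists>c. homogeneous c g"
  shows "graded_ideal (ideal.span G)"
  unfolding graded_ideal_def
proof (intro conjI ballI allI)
  fix f e assume "f \<in> ideal.span G"
  then show "hcomp e f \<in> ideal.span G"
  proof (induction f rule: ideal.span_induct_alt)
    case base
    show ?case by (simp add: ideal.span_zero)
  next
    case (step r g f)
    obtain c where "homogeneous c g" using assms step by auto
    then have "hcomp e (r * g) = (if e < c then 0 else hcomp (e - c) r * g)"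
      using hcomp_mult_homogeneous[of c g e r] by (simp add: mult.commute)
    then have "hcomp e (r * g) \<in> ideal.span G"
      using step by (auto intro: ideal.span_zero ideal.span_scale ideal.span_base)
    then show ?case using step by (simp add: hcomp_add ideal.span_add)
  qed
qed simp

lemma ideal_span_Un_image:
  fixes \<theta> :: "nat \<Rightarrow> 'a::comm_ring_1"
  assumes "ideal.subspace J"
  shows "x \<in> ideal.span (J \<union> \<theta> ` {..<k}) \<longleftrightarrow> (\<exists>g. x - (\<Sum>l<k. g l * \<theta> l) \<in> J)"
proof (induction k arbitrary: x)
  case 0
  have sp: "ideal.span J = J" using assms by simp
  show ?case by (simp add: sp)
next
  case (Suc k)
  have "x \<in> ideal.span (J \<union> \<theta> ` {..<Suc k}) \<longleftrightarrow> (\<exists>c. x - c * \<theta> k \<in> ideal.span (J \<union> \<theta> ` {..<k}))"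
    by (simp add: lessThan_Suc ideal_span_insert)
  also have "\<dots> \<longleftrightarrow> (\<exists>c g. x - c * \<theta> k - (\<Sum>l<k. g l * \<theta> l) \<in> J)"
    using Suc.IH by blast
  also have "\<dots> \<longleftrightarrow> (\<exists>g. x - (\<Sum>l<Suc k. g l * \<theta> l) \<in> J)"
  proof
    assume "\<exists>c g. x - c * \<theta> k - (\<Sum>l<k. g l * \<theta> l) \<in> J"
    then obtain c g where *: "x - c * \<theta> k - (\<Sum>l<k. g l * \<theta> l) \<in> J" by auto
    have "(\<Sum>l<Suc k. (g(k := c)) l * \<theta> l) = (\<Sum>l<k. g l * \<theta> l) + c * \<theta> k"
      by simp
    then have "x - (\<Sum>l<Suc k. (g(k := c)) l * \<theta> l) = x - c * \<theta> k - (\<Sum>l<k. g l * \<theta> l)"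
      by (simp only: diff_diff_eq add.commute[of "c * \<theta> k"])
    with * have "x - (\<Sum>l<Suc k. (g(k := c)) l * \<theta> l) \<in> J" by (simp only:)
    then show "\<exists>g. x - (\<Sum>l<Suc k. g l * \<theta> l) \<in> J" by (rule exI[of _ "g(k := c)"])
  next
    assume "\<exists>g. x - (\<Sum>l<Suc k. g l * \<theta> l) \<in> J"
    then obtain g where "x - (\<Sum>l<Suc k. g l * \<theta> l) \<in> J" by auto
    then have "x - g k * \<theta> k - (\<Sum>l<k. g l * \<theta> l) \<in> J"
      by (simp only: sum.lessThan_Suc diff_diff_eq add.commute[of "g k * \<theta> k"])
    then show "\<exists>c g. x - c * \<theta> k - (\<Sum>l<k. g l * \<theta> l) \<in> J" by blast
  qed
  finally show ?case .
qed

text \<open>The first Koszul homology of the first \<open>k\<close> forms modulo \<open>J\<close>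
  vanishes on cycles with entries of degree \<open>e\<close>. The entries of \<open>b\<close> may be
  inhomogeneous; components are taken where a degree matters.\<close>

definition trivial_relations ::
    "('v, 'k::field) mpoly set \<Rightarrow> (nat \<Rightarrow> ('v, 'k) mpoly) \<Rightarrow> nat \<Rightarrow> nat \<Rightarrow> bool" where
  "trivial_relations J \<theta> k e \<longleftrightarrow> (\<forall>a. (\<forall>i<k. homogeneous e (a i)) \<longrightarrow> (\<Sum>i<k. \<theta> i * a i) \<in> J \<longrightarrow>
     (\<exists>b. (\<forall>i l. b i l = - b l i) \<and> (\<forall>i. b i i = 0) \<and>
        (\<forall>i<k. a i - (\<Sum>l<k. b i l * \<theta> l) \<in> J)))"

text \<open>The last row of the alternating matrix of a relation is a relation of smaller degree.\<close>
lemma trivial_relations_pred: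
  assumes J: "graded_ideal J" and \<theta>: "\<And>i. i \<le> k \<Longrightarrow> homogeneous 1 (\<theta> i)"
    and Suck: "\<And>e. trivial_relations J \<theta> (Suc k) e"
  shows "trivial_relations J \<theta> k e"
proof (induction e)
  have sub: "ideal.subspace J" using J by (simp add: graded_ideal_def)
  have hc: "hcomp e f \<in> J" if "f \<in> J" for e f using J that by (auto simp: graded_ideal_def)
  \<comment> \<open>The relation is padded with coefficient 0 at \<open>\<theta> k\<close>. Row
    \<open>k\<close> of the resulting matrix then represents 0, that is, it is itself a relation
    modulo \<open>J\<close>.\<close>
  have ex: "\<exists>b. (\<forall>i l. b i l = - b l i) \<and> (\<forall>i. b i i = 0) \<and>
      (\<forall>i<k. a i - (\<Sum>l<Suc k. b i l * \<theta> l) \<in> J) \<and> (\<Sum>l<Suc k. b k l * \<theta> l) \<in> J"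
    if "\<forall>i<k. homogeneous e (a i)" "(\<Sum>i<k. \<theta> i * a i) \<in> J" for a e
  proof -
    have "(\<Sum>i<Suc k. \<theta> i * (a(k := 0)) i) = (\<Sum>i<k. \<theta> i * a i)" by simp
    then have rel: "(\<Sum>i<Suc k. \<theta> i * (a(k := 0)) i) \<in> J" using that(2) by (simp only:)
    have hom: "\<forall>i<Suc k. homogeneous e ((a(k := 0)) i)" using that(1) by (auto simp: less_Suc_eq)
    obtain b where b: "\<forall>i l. b i l = - b l i" "\<forall>i. b i i = 0"
        "\<forall>i<Suc k. (a(k := 0)) i - (\<Sum>l<Suc k. b i l * \<theta> l) \<in> J"
      using Suck[of e, unfolded trivial_relations_def, THEN spec, THEN mp, OF hom, THEN mp, OF rel]
      by (elim exE conjE) (rule that)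
    have "- (\<Sum>l<Suc k. b k l * \<theta> l) \<in> J" using b(3)[rule_format, of k] by simp
    from ideal.subspace_neg[OF sub this] have bs: "(\<Sum>l<Suc k. b k l * \<theta> l) \<in> J"
      by (simp only: minus_minus)
    have bi: "a i - (\<Sum>l<Suc k. b i l * \<theta> l) \<in> J" if "i < k" for i
      using b(3)[rule_format, of i] that by simp
    show ?thesis
      by (rule exI[of _ b], intro conjI allI impI b(1)[rule_format] b(2)[rule_format] bi bs)
  qed
  {
    case 0
    show ?case unfolding trivial_relations_def
    proof (intro allI impI)
      fix a assume a: "\<forall>i<k. homogeneous 0 (a i)" "(\<Sum>i<k. \<theta> i * a i) \<in> J"
      from ex[OF this] obtain b where b: "\<forall>i<k. a i - (\<Sum>l<Suc k. b i l * \<theta> l) \<in> J" by blast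
      \<comment> \<open>Multiples of linear forms have no component of degree 0, so the entries of
        \<open>a\<close> lie in \<open>J\<close> already.\<close>
      have "a i \<in> J" if i: "i < k" for i
      proof -
        have "hcomp 0 (a i - (\<Sum>l<Suc k. b i l * \<theta> l)) \<in> J" using b i hc by blast
        also have "hcomp 0 (a i - (\<Sum>l<Suc k. b i l * \<theta> l)) =
            hcomp 0 (a i) - (\<Sum>l<Suc k. hcomp 0 (\<theta> l * b i l))"
          by (simp only: hcomp_diff hcomp_sum mult.commute)
        also have "(\<Sum>l<Suc k. hcomp 0 (\<theta> l * b i l)) = 0"
          using \<theta> by (intro sum.neutral) (auto simp: hcomp_mult_homogeneous[where c = 1])
        also have "hcomp 0 (a i) - 0 = a i" using hcomp_homogeneous[of 0 "a i" 0] a i by simp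
        finally show ?thesis .
      qed
      then show "\<exists>b. (\<forall>i l. b i l = - b l i) \<and> (\<forall>i. b i i = 0) \<and>
          (\<forall>i<k. a i - (\<Sum>l<k. b i l * \<theta> l) \<in> J)"
        by (intro exI[of _ "\<lambda>_ _. 0"]) simp
    qed
  next
    case (Suc e)
    show ?case unfolding trivial_relations_def
    proof (intro allI impI)
      fix a assume a: "\<forall>i<k. homogeneous (Suc e) (a i)" "(\<Sum>i<k. \<theta> i * a i) \<in> J"
      from ex[OF this] obtain b0 where b0: "\<forall>i l. b0 i l = - b0 l i" "\<forall>i. b0 i i = 0"
        "\<forall>i<k. a i - (\<Sum>l<Suc k. b0 i l * \<theta> l) \<in> J" "(\<Sum>l<Suc k. b0 k l * \<theta> l) \<in> J"
        by (elim exE conjE) (rule that)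
      define b where "b i l = hcomp e (b0 i l)" for i l
      have b1: "b i l = - b l i" for i l 
        unfolding b_def by (simp only: b0(1)[rule_format, of i l] hcomp_uminus)
      have b2: "b i i = 0" for i unfolding b_def by (simp add: b0(2))
      have comp: "hcomp (Suc e) (\<Sum>l<Suc k. b0 i l * \<theta> l) = (\<Sum>l<Suc k. b i l * \<theta> l)" for i
      proof -
        have "hcomp (Suc e) (b0 i l * \<theta> l) = b i l * \<theta> l" if "l \<le> k" for l
          using hcomp_mult_homogeneous[OF \<theta>[OF that], of "Suc e" "b0 i l"] by (simp add: mult.commute b_def)
        then show ?thesis unfolding hcomp_sum by (intro sum.cong refl) auto
      qed
      have b3: "a i - (\<Sum>l<Suc k. b i l * \<theta> l) \<in> J" if "i < k" for i
      proof -
        have "hcomp (Suc e) (a i - (\<Sum>l<Suc k. b0 i l * \<theta> l)) \<in> J" using hc b0(3) that by blast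
        then show ?thesis unfolding hcomp_diff comp
          using a(1) that hcomp_homogeneous[of "Suc e" "a i" "Suc e"] by simp
      qed
      have b4: "(\<Sum>l<k. \<theta> l * b l k) \<in> J"
      proof -
        have "hcomp (Suc e) (\<Sum>l<Suc k. b0 k l * \<theta> l) \<in> J" using hc b0(4) by blast
        then have "(\<Sum>l<Suc k. b k l * \<theta> l) \<in> J" unfolding comp .
        then have "(\<Sum>l<k. b k l * \<theta> l) \<in> J" using b2 by simp
        then have "- (\<Sum>l<k. b k l * \<theta> l) \<in> J" by (rule ideal.subspace_neg[OF sub])
        also have "- (\<Sum>l<k. b k l * \<theta> l) = (\<Sum>l<k. \<theta> l * b l k)"
          unfolding sum_negf[symmetric]
        proof (intro sum.cong refl)
          fix l
          show "- (b k l * \<theta> l) = \<theta> l * b l k"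
            by (simp only: b1[of k l] mult_minus_left minus_minus mult.commute[of "\<theta> l"])
        qed
        finally show ?thesis .
      qed
      have b5: "\<forall>l<k. homogeneous e (b l k)" by (simp add: b_def)
      obtain c where c: "\<forall>i l. c i l = - c l i" "\<forall>i. c i i = 0"
          "\<forall>i<k. b i k - (\<Sum>l<k. c i l * \<theta> l) \<in> J"
        using Suc.IH[unfolded trivial_relations_def, THEN spec, THEN mp, OF b5, THEN mp, OF b4]
        by (elim exE conjE) (rule that)
      \<comment> \<open>By \<open>c\<close> the last column \<open>b i k\<close> is a combination of
        the first \<open>k\<close> forms; inserting it as the coefficient of
        \<open>\<theta> k\<close> distributes the last column over the others.\<close>
      define r where "r i l = b i l + c i l * \<theta> k" for i l
      have r1: "r i l = - r l i" for i l
      proof -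
        have "r i l = - b l i + - c l i * \<theta> k"
          unfolding r_def by (simp only: b1[of i l] c(1)[rule_format, of i l])
        then show ?thesis unfolding r_def by simp
      qed
      have r2: "r i i = 0" for i unfolding r_def using b2 c(2) by simp
      have r3: "a i - (\<Sum>l<k. r i l * \<theta> l) \<in> J" if i: "i < k" for i
      proof -
        have "\<theta> k * (b i k - (\<Sum>l<k. c i l * \<theta> l)) \<in> J"
          using c(3) i ideal.subspace_scale[OF sub] by blast
        then have "(a i - (\<Sum>l<Suc k. b i l * \<theta> l)) + \<theta> k * (b i k - (\<Sum>l<k. c i l * \<theta> l)) \<in> J"
          using b3[OF i] ideal.subspace_add[OF sub] by blast
        also have "(a i - (\<Sum>l<Suc k. b i l * \<theta> l)) + \<theta> k * (b i k - (\<Sum>l<k. c i l * \<theta> l)) =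
            a i - (\<Sum>l<k. r i l * \<theta> l)"
        proof -
          have "(\<Sum>l<k. r i l * \<theta> l) = (\<Sum>l<k. b i l * \<theta> l) + \<theta> k * (\<Sum>l<k. c i l * \<theta> l)"
            unfolding r_def sum_distrib_left sum.distrib[symmetric]
            by (intro sum.cong refl) (simp only: distrib_left distrib_right ac_simps)
          moreover have "x - (S + bk * t) + t * (bk - T) = x - (S + t * T)" for x S bk t T :: "('a, 'b) mpoly"
            by (simp add: algebra_simps)
          ultimately show ?thesis by (simp only: sum.lessThan_Suc)
        qed
        finally show ?thesis .
      qed
      show "\<exists>b. (\<forall>i l. b i l = - b l i) \<and> (\<forall>i. b i i = 0) \<and>
          (\<forall>i<k. a i - (\<Sum>l<k. b i l * \<theta> l) \<in> J)"
        by (rule exI[of _ r], intro conjI allI impI r1 r2 r3)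
    qed
  }
qed

text \<open>Vanishing of the first Koszul homology descends from all \<open>n\<close> forms to the
  first \<open>k + 1\<close>. Then \<open>\<theta> k * f\<close> in
  \<open>J + (\<theta> 0, ..., \<theta> (k - 1))\<close> is a trivial relation, and its last row
  expresses \<open>f\<close> by the earlier forms since the diagonal entry is 0. It serves both for
  the colour sums modulo the Stanley-Reisner ideal and, with the zero ideal, for all parameters on
  the polynomial ring.\<close>

theorem graded_parameters_regular:
  assumes J: "graded_ideal J" and \<theta>: "\<And>i. i < n \<Longrightarrow> homogeneous 1 (\<theta> i)"
    and reg: "ideal_regular J ys" "n \<le> length ys"
    and nil: "\<And>y. y \<in> set ys \<Longrightarrow> \<exists>e. y ^ e \<in> ideal.span (J \<union> \<theta> ` {..<n})"
    and k: "k < n" and f: "homogeneous e f" "\<theta> k * f \<in> ideal.span (J \<union> \<theta> ` {..<k})"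
  shows "f \<in> ideal.span (J \<union> \<theta> ` {..<k})"
proof -
  have sub: "ideal.subspace J" using J by (simp add: graded_ideal_def)
  have top: "trivial_relations J \<theta> n e" for e
    unfolding trivial_relations_def
  proof (intro allI impI)
    fix a assume "(\<Sum>i<n. \<theta> i * a i) \<in> J"
    moreover have "koszul_acyclic \<theta> n J (n - 1)"
      using k reg nil by (intro koszul_acyclic_of_regular[OF sub reg(1)]) auto
    ultimately show "\<exists>b. (\<forall>i l. b i l = - b l i) \<and> (\<forall>i. b i i = 0) \<and>
        (\<forall>i<n. a i - (\<Sum>l<n. b i l * \<theta> l) \<in> J)"
      using k by (intro relation_trivial[OF _ _ _ sub]) auto
  qed
  have "trivial_relations J \<theta> (Suc k) e" for e
    using Suc_leI[OF k]
  proof (induction arbitrary: e rule: inc_induct)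
    case base
    show ?case by (rule top)
  next
    case (step m)
    show ?case
    proof (rule trivial_relations_pred[OF J])
      show "homogeneous 1 (\<theta> i)" if "i \<le> m" for i using that step.hyps \<theta> by simp
    qed (rule step.IH)
  qed
  note triv = this
  obtain g where g: "\<theta> k * f - (\<Sum>l<k. g l * \<theta> l) \<in> J"
    using f(2) ideal_span_Un_image[OF sub] by blast
  define a where "a l = (if l = k then f else - hcomp e (g l))" for l
  have "hcomp (Suc e) (\<theta> k * f - (\<Sum>l<k. g l * \<theta> l)) \<in> J"
    using g J by (auto simp: graded_ideal_def)
  also have "hcomp (Suc e) (\<theta> k * f - (\<Sum>l<k. g l * \<theta> l)) =
      hcomp (Suc e) (\<theta> k * f) - (\<Sum>l<k. hcomp (Suc e) (\<theta> l * g l))"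
    by (simp only: hcomp_diff hcomp_sum mult.commute)
  also have "hcomp (Suc e) (\<theta> k * f) = \<theta> k * f"
    using hcomp_mult_homogeneous[OF \<theta>[OF k], of "Suc e" f] f(1) by (simp add: hcomp_homogeneous)
  also have "(\<Sum>l<k. hcomp (Suc e) (\<theta> l * g l)) = (\<Sum>l<k. \<theta> l * hcomp e (g l))"
    using k \<theta> by (intro sum.cong refl) (auto simp: hcomp_mult_homogeneous[where c = 1])
  also have "\<theta> k * f - \<dots> = (\<Sum>i<Suc k. \<theta> i * a i)"
    by (simp add: a_def sum_negf)
  finally have rel: "(\<Sum>i<Suc k. \<theta> i * a i) \<in> J" .
  have hom: "\<forall>i<Suc k. homogeneous e (a i)"
    using f(1) by (auto simp: a_def intro: homogeneous_uminus)
  obtain b where b: "\<forall>i l. b i l = - b l i" "\<forall>i. b i i = 0"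
      "\<forall>i<Suc k. a i - (\<Sum>l<Suc k. b i l * \<theta> l) \<in> J"
    using triv[of e, unfolded trivial_relations_def, THEN spec, THEN mp, OF hom, THEN mp, OF rel]
    by (elim exE conjE) (rule that)
  have "f - (\<Sum>l<k. b k l * \<theta> l) \<in> J" using b(2) b(3)[rule_format, of k] by (simp add: a_def)
  then show ?thesis using ideal_span_Un_image[OF sub] by blast
qed

section \<open>Free modules and the ring of a type\<close>

text \<open>Additive extension of a map given on single terms. \<open>lin_ext\<close> covers maps
  linear over the ring; the contracting homotopy and the projections to a degree are merely
  additive.\<close>

definition pm_ext :: "('a \<Rightarrow> 'b \<Rightarrow> 'c) \<Rightarrow> ('a \<Rightarrow>\<^sub>0 'b::zero) \<Rightarrow> 'c::comm_monoid_add" where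
  "pm_ext \<phi> p = (\<Sum>k\<in>Poly_Mapping.keys p. \<phi> k (Poly_Mapping.lookup p k))"

lemma pm_ext_superset:
  assumes "finite A" "Poly_Mapping.keys p \<subseteq> A" "\<And>k. \<phi> k 0 = 0"
  shows "pm_ext \<phi> p = (\<Sum>k\<in>A. \<phi> k (Poly_Mapping.lookup p k))"
  unfolding pm_ext_def using assms by (intro sum.mono_neutral_left) (auto simp: in_keys_iff)

lemma pm_ext_add:
  fixes \<phi> :: "'a \<Rightarrow> 'b::monoid_add \<Rightarrow> 'c::comm_monoid_add"
  assumes "\<And>k. \<phi> k 0 = 0" "\<And>k a b. \<phi> k (a + b) = \<phi> k a + \<phi> k b"
  shows "pm_ext \<phi> (p + q) = pm_ext \<phi> p + pm_ext \<phi> q"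
proof -
  let ?A = "Poly_Mapping.keys p \<union> Poly_Mapping.keys q"
  have "pm_ext \<phi> (p + q) = (\<Sum>k\<in>?A. \<phi> k (Poly_Mapping.lookup (p + q) k))"
    using Poly_Mapping.keys_add[of p q] assms(1) by (intro pm_ext_superset) auto
  also have "\<dots> = pm_ext \<phi> p + pm_ext \<phi> q"
    using assms by (simp add: lookup_add sum.distrib pm_ext_superset[of ?A p] pm_ext_superset[of ?A q])
  finally show ?thesis .
qed

lemma pm_ext_0 [simp]: "pm_ext \<phi> 0 = 0" by (simp add: pm_ext_def)

lemma pm_ext_single: "\<phi> k 0 = 0 \<Longrightarrow> pm_ext \<phi> (Poly_Mapping.single k c) = \<phi> k c"
  by (cases "c = 0") (auto simp: pm_ext_def)

lemma sum_single_lookup: "(\<Sum>k\<in>Poly_Mapping.keys p. Poly_Mapping.single k (Poly_Mapping.lookup p k)) = p"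
proof (rule poly_mapping_eqI)
  fix k
  have "Poly_Mapping.lookup (\<Sum>k\<in>Poly_Mapping.keys p. Poly_Mapping.single k (Poly_Mapping.lookup p k)) k =
      (\<Sum>k'\<in>Poly_Mapping.keys p. if k' = k then Poly_Mapping.lookup p k else 0)"
    unfolding lookup_sum by (intro sum.cong) (auto simp: lookup_single)
  then show "Poly_Mapping.lookup (\<Sum>k\<in>Poly_Mapping.keys p. Poly_Mapping.single k (Poly_Mapping.lookup p k)) k =
      Poly_Mapping.lookup p k" by (auto simp: in_keys_iff)
qed

lemma free_mod_0 [simp]: "0 \<in> free_mod A" by (simp add: free_mod_def)
lemma free_mod_add: "u \<in> free_mod A \<Longrightarrow> v \<in> free_mod A \<Longrightarrow> u + v \<in> free_mod A"
  using Poly_Mapping.keys_add[of u v] by (auto simp: free_mod_def)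
lemma free_mod_single: "b \<in> A \<Longrightarrow> Poly_Mapping.single b c \<in> free_mod A"
  by (simp add: free_mod_def)
lemma free_mod_sum: "(\<And>x. x \<in> Y \<Longrightarrow> f x \<in> free_mod A) \<Longrightarrow> sum f Y \<in> free_mod A"
  by (induction Y rule: infinite_finite_induct) (auto intro: free_mod_add)

lemma sum_closed:
  assumes "P 0" "\<And>u v. P u \<Longrightarrow> P v \<Longrightarrow> P (u + v)" "\<And>x. x \<in> A \<Longrightarrow> P (f x)"
  shows "P (sum f A)"
  using assms(3) by (induction A rule: infinite_finite_induct) (auto intro: assms(1,2))

lemma free_mod_term_induct [consumes 1, case_names zero add monomial]:
  fixes v :: "nat \<Rightarrow>\<^sub>0 ('v, 'k::field) mpoly"
  assumes "v \<in> free_mod A"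
    and "P 0" and add: "\<And>u w. P u \<Longrightarrow> P w \<Longrightarrow> P (u + w)"
    and "\<And>b m c. b \<in> A \<Longrightarrow> P (Poly_Mapping.single b (Poly_Mapping.single m c))"
  shows "P v"
proof -
  have 1: "P (Poly_Mapping.single b f)" if "b \<in> A" for b f
  proof -
    have "Poly_Mapping.single b f = (\<Sum>m\<in>Poly_Mapping.keys f.
        Poly_Mapping.single b (Poly_Mapping.single m (Poly_Mapping.lookup f m)))"
    proof -
      have "Poly_Mapping.single b (sum q M) = (\<Sum>m\<in>M. Poly_Mapping.single b (q m))" for q and M :: "'c set"
        by (induction M rule: infinite_finite_induct) (auto simp: single_add)
      then show ?thesis using sum_single_lookup[of f] by metis
    qed
    then show ?thesis using assms(2,4) that by (metis (mono_tags, lifting) add sum_closed)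
  qed
  have "P (\<Sum>b\<in>Poly_Mapping.keys v. Poly_Mapping.single b (Poly_Mapping.lookup v b))"
    by (rule sum_closed[of P]) (use assms 1 in \<open>auto simp: free_mod_def\<close>)
  then show ?thesis by (simp add: sum_single_lookup)
qed

lemma fscale_0 [simp]: "fscale 0 v = 0" "fscale c 0 = 0"
  by (rule poly_mapping_eqI, simp add: lookup_fscale)+
lemma fscale_1 [simp]: "fscale 1 v = v" by (rule poly_mapping_eqI) (simp add: lookup_fscale)
lemma fscale_add_left: "fscale (a + b) v = fscale a v + fscale b v"
  by (rule poly_mapping_eqI) (simp add: lookup_fscale lookup_add algebra_simps)
lemma fscale_add_right: "fscale a (u + v) = fscale a u + fscale a v"
  by (rule poly_mapping_eqI) (simp add: lookup_fscale lookup_add algebra_simps)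
lemma fscale_fscale: "fscale a (fscale b v) = fscale (a * b) v"
  by (rule poly_mapping_eqI) (simp add: lookup_fscale mult.assoc)
lemma fscale_single: "fscale a (Poly_Mapping.single b c) = Poly_Mapping.single b (a * c)"
  by (rule poly_mapping_eqI) (simp add: lookup_fscale lookup_single when_def)
lemma fscale_sum: "fscale a (sum f A) = (\<Sum>x\<in>A. fscale a (f x))"
  by (induction A rule: infinite_finite_induct) (auto simp: fscale_add_right)
lemma free_mod_fscale: "v \<in> free_mod A \<Longrightarrow> fscale c v \<in> free_mod A"
  unfolding free_mod_def using in_keys_iff[of _ v] by (fastforce simp: in_keys_iff lookup_fscale)

lemma lin_ext_pm_ext: "lin_ext D = pm_ext (\<lambda>a c. fscale c (D a))"
  by (rule ext) (simp add: lin_ext_def pm_ext_def)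

lemma lin_ext_0 [simp]: "lin_ext D 0 = 0" by (simp add: lin_ext_pm_ext)
lemma lin_ext_add: "lin_ext D (u + v) = lin_ext D u + lin_ext D v"
  unfolding lin_ext_pm_ext by (intro pm_ext_add) (auto simp: fscale_add_left)
lemma lin_ext_single: "lin_ext D (Poly_Mapping.single b c) = fscale c (D b)"
  unfolding lin_ext_pm_ext by (simp add: pm_ext_single)
lemma lin_ext_sum: "lin_ext D (sum f A) = (\<Sum>x\<in>A. lin_ext D (f x))"
  by (induction A rule: infinite_finite_induct) (auto simp: lin_ext_add)

lemma lin_ext_superset:
  assumes "finite A" "Poly_Mapping.keys v \<subseteq> A"
  shows "lin_ext D v = (\<Sum>a\<in>A. fscale (Poly_Mapping.lookup v a) (D a))"
  unfolding lin_ext_pm_ext using assms by (intro pm_ext_superset) auto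

lemma lin_ext_fscale: "lin_ext D (fscale c v) = fscale c (lin_ext D v)"
proof -
  have "lin_ext D (fscale c v) = (\<Sum>a\<in>Poly_Mapping.keys v. fscale (c * Poly_Mapping.lookup v a) (D a))"
    by (subst lin_ext_superset[of "Poly_Mapping.keys v"]) (auto simp: lookup_fscale in_keys_iff)
  then show ?thesis by (simp add: lin_ext_def fscale_sum fscale_fscale)
qed

lemma lin_ext_closed:
  assumes "v \<in> free_mod A" "\<And>a. a \<in> A \<Longrightarrow> D a \<in> free_mod A'"
  shows "lin_ext D v \<in> free_mod A'"
  unfolding lin_ext_def using assms by (intro free_mod_sum free_mod_fscale) (auto simp: free_mod_def)

section \<open>Ideals and cosets in the ring of a type\<close>

lemma poly_ring_simps [simp]:
  "carrier (ring_of_type_algebra :: 'a::ring_1 ring) = UNIV"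
  "monoid.mult (ring_of_type_algebra :: 'a::ring_1 ring) = (*)"
  "monoid.one (ring_of_type_algebra :: 'a::ring_1 ring) = 1"
  "ring.zero (ring_of_type_algebra :: 'a::ring_1 ring) = 0"
  "ring.add (ring_of_type_algebra :: 'a::ring_1 ring) = (+)"
  by (simp_all add: ring_of_type_algebra_def)

lemma cring_type_ring: "cring (ring_of_type_algebra :: 'a::comm_ring_1 ring)"
  by (rule cring_from_type_algebra)

lemma ideal_type_ring_iff:
  "ideal I (ring_of_type_algebra :: 'a::comm_ring_1 ring) \<longleftrightarrow> ideal.subspace I"
proof
  assume "ideal I (ring_of_type_algebra :: 'a ring)"
  then interpret I: ideal I "ring_of_type_algebra :: 'a ring" .
  show "ideal.subspace I"
    using I.I_l_closed additive_subgroup.a_closed[OF I.additive_subgroup_axioms]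
      additive_subgroup.zero_closed[OF I.additive_subgroup_axioms]
    by (intro ideal.subspaceI) auto
next
  assume I: "ideal.subspace I"
  interpret R: cring "ring_of_type_algebra :: 'a ring" by (rule cring_type_ring)
  have inv: "inv\<^bsub>add_monoid (ring_of_type_algebra :: 'a ring)\<^esub> x = - x" for x :: 'a
  proof -
    have "\<ominus>\<^bsub>(ring_of_type_algebra :: 'a ring)\<^esub> x = - x"
      by (rule R.minus_equality) simp_all
    then show ?thesis by (simp only: a_inv_def)
  qed
  show "ideal I (ring_of_type_algebra :: 'a ring)"
  proof (rule idealI[OF R.ring_axioms])
    show "subgroup I (add_monoid (ring_of_type_algebra :: 'a ring))"
    proof (rule subgroup.intro)
      show "inv\<^bsub>add_monoid (ring_of_type_algebra :: 'a ring)\<^esub> x \<in> I" if "x \<in> I" for x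
        unfolding inv using that by (rule ideal.subspace_neg[OF I])
    qed (use I in \<open>auto simp: ideal.subspace_0 ideal.subspace_add\<close>)
  qed (use ideal.subspace_scale[OF I] in \<open>auto simp: mult.commute\<close>)
qed

lemma genideal_type_ring: "Idl\<^bsub>(ring_of_type_algebra :: 'a::comm_ring_1 ring)\<^esub> S = ideal.span S"
proof -
  have "Idl\<^bsub>(ring_of_type_algebra :: 'a ring)\<^esub> S = \<Inter> {I. ideal.subspace I \<and> S \<subseteq> I}"
    by (simp add: genideal_def ideal_type_ring_iff)
  also have "\<dots> = ideal.span S" by (simp add: ideal.span_def hull_def)
  finally show ?thesis .
qed

lemma coset_type_ring: "I +>\<^bsub>(ring_of_type_algebra :: 'a::comm_ring_1 ring)\<^esub> x = (\<lambda>h. h + x) ` I"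
  by (auto simp: a_r_coset_def r_coset_def)

lemma coset_eq_iff:
  assumes "ideal.subspace (I :: 'a::comm_ring_1 set)"
  shows "I +>\<^bsub>ring_of_type_algebra\<^esub> x = I +>\<^bsub>ring_of_type_algebra\<^esub> y \<longleftrightarrow> x - y \<in> I"
proof
  assume "I +>\<^bsub>ring_of_type_algebra\<^esub> x = I +>\<^bsub>ring_of_type_algebra\<^esub> y"
  moreover have "x \<in> I +>\<^bsub>ring_of_type_algebra\<^esub> x"
    using ideal.subspace_0[OF assms] by (force simp: coset_type_ring)
  ultimately obtain h where "h \<in> I" "x = h + y" by (auto simp: coset_type_ring)
  then show "x - y \<in> I" by simp
next
  assume *: "x - y \<in> I"
  have "(\<lambda>h. h + x) ` I \<subseteq> (\<lambda>h. h + y) ` I" if "x - y \<in> I" for x y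
  proof
    fix t assume "t \<in> (\<lambda>h. h + x) ` I"
    then obtain h where "h \<in> I" "t = h + x" by auto
    then have "t = (h + (x - y)) + y" "h + (x - y) \<in> I"
      using that ideal.subspace_add[OF assms] by auto
    then show "t \<in> (\<lambda>h. h + y) ` I" by blast
  qed
  moreover have "y - x \<in> I" using ideal.subspace_neg[OF assms *] by simp
  ultimately show "I +>\<^bsub>ring_of_type_algebra\<^esub> x = I +>\<^bsub>ring_of_type_algebra\<^esub> y"
    using * unfolding coset_type_ring by blast
qed

lemma carrier_Quot_type_ring:
  "carrier ((ring_of_type_algebra :: 'a::comm_ring_1 ring) Quot I) = range (\<lambda>x. I +>\<^bsub>ring_of_type_algebra\<^esub> x)"
  by (auto simp: FactRing_def A_RCOSETS_defs a_r_coset_def)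

lemma zero_Quot: "\<zero>\<^bsub>R Quot I\<^esub> = I" by (simp add: FactRing_def)

lemma coset_eq_self_iff:
  assumes "ideal.subspace (I :: 'a::comm_ring_1 set)"
  shows "I +>\<^bsub>ring_of_type_algebra\<^esub> x = I \<longleftrightarrow> x \<in> I"
proof -
  have "I +>\<^bsub>ring_of_type_algebra\<^esub> 0 = I" by (simp add: coset_type_ring)
  then show ?thesis using coset_eq_iff[OF assms, of x 0] by simp
qed

section \<open>A redundant Taylor resolution\<close>

definition sqmon :: "'v set \<Rightarrow> 'v monom" where
  "sqmon A = (\<Sum>v\<in>A. mvar v)"

lemma lookup_sqmon: "finite A \<Longrightarrow> Poly_Mapping.lookup (sqmon A) v = (if v \<in> A then 1 else 0)"
  unfolding sqmon_def lookup_sum by (simp add: mvar_def lookup_single when_def)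

lemma sqmon_empty [simp]: "sqmon {} = 0" by (simp add: sqmon_def)

lemma sqmon_split: "finite A \<Longrightarrow> B \<subseteq> A \<Longrightarrow> sqmon A = sqmon (A - B) + sqmon B"
  unfolding sqmon_def using sum.subset_diff[of B A mvar] by simp

lemma mdeg_sqmon: "finite A \<Longrightarrow> mdeg (sqmon A) = card A"
  unfolding sqmon_def by (induction A rule: finite_induct) (auto simp: mdeg_add)

lemma prod_pvar: "(\<Prod>v\<in>A. pvar v) = (Poly_Mapping.single (sqmon A) 1 :: ('v, 'k::field) mpoly)"
proof (induction A rule: infinite_finite_induct)
  case (insert v A)
  then show ?case by (simp add: pvar_def mult_single sqmon_def)
qed (auto simp: sqmon_def)

lemma sqmon_le_split:
  assumes "finite A" "A \<subseteq> Poly_Mapping.keys m"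
  shows "m = (m - sqmon A) + sqmon A"
proof (rule poly_mapping_eqI)
  fix v
  have "v \<in> A \<Longrightarrow> Poly_Mapping.lookup m v \<noteq> 0" using assms(2) by (auto simp: in_keys_iff)
  then show "Poly_Mapping.lookup m v = Poly_Mapping.lookup (m - sqmon A + sqmon A) v"
    using assms(1) by (auto simp: lookup_add lookup_minus lookup_sqmon)
qed

lemma keys_add_nat: "Poly_Mapping.keys (a + b :: 'v monom) = Poly_Mapping.keys a \<union> Poly_Mapping.keys b"
  by (auto simp: in_keys_iff lookup_add)

lemma keys_sqmon: "finite A \<Longrightarrow> Poly_Mapping.keys (sqmon A) = A"
  unfolding set_eq_iff in_keys_iff by (simp add: lookup_sqmon)

text \<open>
  A redundant version of the Taylor resolution of the ideal generated by the squarefree monomials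
  with supports \<open>g 0, \<dots>, g (r - 1)\<close>: the basis of the \<open>i\<close>-th module consists of all \<open>i\<close>-tuples
  of generators, a tuple being coded by its number \<open>a\<close> in base \<open>r\<close>. In each multidegree the
  complex is the augmented chain complex of a full simplex, contracted by prefixing the
  tuples with a fixed generator.
\<close>

primrec tuple_supp :: "nat \<Rightarrow> (nat \<Rightarrow> 'v set) \<Rightarrow> nat \<Rightarrow> nat \<Rightarrow> 'v set" where
  "tuple_supp r g 0 a = {}"
| "tuple_supp r g (Suc i) a = g (a mod r) \<union> tuple_supp r g i (a div r)"

text \<open>The coefficient of the tuple \<open>b\<close> in the boundary of the tuple
  \<open>a\<close>, by the recursion \<partial>(k, t) = t - (k, \<partial>t), where the first entry
  is the lowest digit. Entries may repeat, so faces can coincide and their signs then add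
  up.\<close>

primrec bar_coeff :: "nat \<Rightarrow> nat \<Rightarrow> nat \<Rightarrow> nat \<Rightarrow> 'k::field" where
  "bar_coeff r 0 a b = (if b = 0 then 1 else 0)"
| "bar_coeff r (Suc i) a b = (if b = a div r then 1 else 0) -
     (if b mod r = a mod r then bar_coeff r i (a div r) (b div r) else 0)"

text \<open>For squarefree generators the least common multiple of a tuple is the squarefree
  monomial on the union of the supports, and quotients of such multiples belong to set
  differences.\<close>

definition taylor_diff :: "nat \<Rightarrow> (nat \<Rightarrow> 'v set) \<Rightarrow> nat \<Rightarrow> nat \<Rightarrow> (nat \<Rightarrow>\<^sub>0 ('v, 'k::field) mpoly)" where
  "taylor_diff r g i a = (\<Sum>b<r ^ i. Poly_Mapping.single b
     (Poly_Mapping.single (sqmon (tuple_supp r g (Suc i) a - tuple_supp r g i b)) (bar_coeff r i a b)))"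

lemma finite_tuple_supp: "(\<And>k. finite (g k)) \<Longrightarrow> finite (tuple_supp r g i a)"
  by (induction i arbitrary: a) auto

lemma div_less_power: "a < r ^ Suc i \<Longrightarrow> a div r < (r :: nat) ^ i"
  by (metis less_mult_imp_div_less power_Suc2)

lemma cons_less_power: "k < r \<Longrightarrow> b < r ^ i \<Longrightarrow> k + r * b < (r :: nat) ^ Suc i"
proof -
  assume *: "k < r" "b < r ^ i"
  have "k + r * b < r * (b + 1)" using * by simp
  also have "\<dots> \<le> r * r ^ i" using * by (intro mult_left_mono) auto
  finally show ?thesis by simp
qed

lemma bar_coeff_nonzero:
  assumes "bar_coeff r i a b \<noteq> (0 :: 'k::field)" "a < r ^ Suc i"
  shows "b < r ^ i" "tuple_supp r g i b \<subseteq> tuple_supp r g (Suc i) a"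
proof -
  have "b < r ^ i \<and> tuple_supp r g i b \<subseteq> tuple_supp r g (Suc i) a"
    using assms
  proof (induction i arbitrary: a b)
    case 0
    then show ?case by (auto split: if_splits)
  next
    case (Suc i)
    have "b = a div r \<or> b mod r = a mod r \<and> bar_coeff r i (a div r) (b div r) \<noteq> (0 :: 'k)"
      using Suc.prems(1) by (auto split: if_splits)
    moreover have r: "r > 0" using Suc.prems(2) by (cases r) auto
    moreover have a: "a div r < r ^ Suc i" using Suc.prems(2) by (rule div_less_power)
    moreover have "b < r ^ Suc i" if "b div r < r ^ i"
      using that r cons_less_power[of "b mod r" r "b div r" i] by simp
    ultimately show ?case
      using Suc.IH[of "a div r" "b div r"] by (auto simp del: power_Suc)
  qed
  then show "b < r ^ i" "tuple_supp r g i b \<subseteq> tuple_supp r g (Suc i) a" by auto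
qed

lemma sum_mod_digit:
  fixes f :: "nat \<Rightarrow> 'a::comm_monoid_add"
  assumes "k < r"
  shows "(\<Sum>b<r ^ Suc i. if b mod r = k then f b else 0) = (\<Sum>b<r ^ i. f (k + r * b))"
proof -
  have "(\<Sum>b<r ^ Suc i. if b mod r = k then f b else 0) = (\<Sum>b | b < r ^ Suc i \<and> b mod r = k. f b)"
    by (simp add: sum.If_cases Int_def)
  also have "\<dots> = (\<Sum>b<r ^ i. f (k + r * b))"
    by (rule sum.reindex_bij_witness[of _ "\<lambda>b. k + r * b" "\<lambda>b. b div r"])
      (use assms cons_less_power div_less_power in \<open>auto simp del: power_Suc\<close>)
  finally show ?thesis .
qed

text \<open>By the recursion \<partial>\<partial>(k, t) = \<partial>t - \<partial>(k, \<partial>t) =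
  (k, \<partial>\<partial>t), which is 0 by induction. In the base case the two entries of a pair
  occur with opposite signs, and each has the empty tuple as boundary.\<close>

lemma bar_coeff_comp:
  assumes "a < r ^ Suc (Suc i)"
  shows "(\<Sum>b<r ^ Suc i. bar_coeff r (Suc i) a b * bar_coeff r i b c) = (0 :: 'k::field)"
  using assms
proof (induction i arbitrary: a c)
  case (0 a c)
  then have r: "r > 0" by (cases r) auto
  have lt: "a div r < r" using 0 by (simp add: less_mult_imp_div_less)
  have "(\<Sum>b<r. bar_coeff r (Suc 0) a b * bar_coeff r 0 b c) =
      (\<Sum>b<r. ((if b = a div r then 1 else 0) - (if b = a mod r then 1 else 0)) * (if c = 0 then 1 else 0 :: 'k))"
    using r by (intro sum.cong refl) auto
  also have "\<dots> = 0"
    using lt r by (simp add: sum_distrib_right[symmetric] sum_subtractf)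
  finally show ?case by simp
next
  case (Suc i a c)
  then have r: "r > 0" by (cases r) auto
  let ?k = "a mod r" and ?a = "a div r"
  have a: "?a < r ^ Suc (Suc i)" using Suc.prems by (rule div_less_power)
  have "(\<Sum>b<r ^ Suc (Suc i). bar_coeff r (Suc (Suc i)) a b * bar_coeff r (Suc i) b c) =
      (\<Sum>b<r ^ Suc (Suc i). if b = ?a then bar_coeff r (Suc i) b c else 0) -
      (\<Sum>b<r ^ Suc (Suc i). if b mod r = ?k then bar_coeff r (Suc i) ?a (b div r) * bar_coeff r (Suc i) b c else 0)"
    unfolding sum_subtractf[symmetric]
    by (intro sum.cong refl) (simp only: bar_coeff.simps(2)[of r "Suc i" a], simp add: left_diff_distrib del: bar_coeff.simps)
  also have "(\<Sum>b<r ^ Suc (Suc i). if b = ?a then bar_coeff r (Suc i) b c else 0) = (bar_coeff r (Suc i) ?a c :: 'k)"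
    using a by (simp del: power_Suc bar_coeff.simps)
  also have "(\<Sum>b<r ^ Suc (Suc i). if b mod r = ?k then bar_coeff r (Suc i) ?a (b div r) * bar_coeff r (Suc i) b c else 0)
      = (\<Sum>b<r ^ Suc i. bar_coeff r (Suc i) ?a b * (bar_coeff r (Suc i) (?k + r * b) c :: 'k))"
    using r by (subst sum_mod_digit) (auto simp del: power_Suc bar_coeff.simps)
  also have "\<dots> = (\<Sum>b<r ^ Suc i. if b = c then bar_coeff r (Suc i) ?a b else 0) -
      (\<Sum>b<r ^ Suc i. (if c mod r = ?k then bar_coeff r (Suc i) ?a b * bar_coeff r i b (c div r) else 0))"
    unfolding sum_subtractf[symmetric]
    using r by (intro sum.cong refl) (auto simp: bar_coeff.simps(2)[of r i "_ + _"] right_diff_distrib simp del: bar_coeff.simps)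
  also have "(\<Sum>b<r ^ Suc i. if b = c then bar_coeff r (Suc i) ?a b else 0) = (bar_coeff r (Suc i) ?a c :: 'k)"
    using bar_coeff_nonzero(1)[of r "Suc i" ?a c, where ?'k = 'k] a
    by (auto simp del: power_Suc bar_coeff.simps)
  also have "(\<Sum>b<r ^ Suc i. (if c mod r = ?k then bar_coeff r (Suc i) ?a b * bar_coeff r i b (c div r) else 0)) = (0 :: 'k)"
    using Suc.IH[OF a, of "c div r"] by (cases "c mod r = ?k") (simp_all only: if_True if_False sum.neutral_const simp_thms)
  finally show ?case by simp
qed

text \<open>This has multidegree \<open>\<alpha>\<close> only if \<open>\<alpha>\<close> is divisible by the monomial of the tuple \<open>b\<close>,
  because the subtraction is truncated.\<close>
definition mterm :: "nat \<Rightarrow> (nat \<Rightarrow> 'v set) \<Rightarrow> nat \<Rightarrow> 'v monom \<Rightarrow> nat \<Rightarrow> 'k \<Rightarrow> (nat \<Rightarrow>\<^sub>0 ('v, 'k::field) mpoly)" where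
  "mterm r g i \<alpha> b c = Poly_Mapping.single b (Poly_Mapping.single (\<alpha> - sqmon (tuple_supp r g i b)) c)"

lemma mterm_0 [simp]: "mterm r g i \<alpha> b 0 = 0" by (simp add: mterm_def)
lemma mterm_add: "mterm r g i \<alpha> b (c + c') = mterm r g i \<alpha> b c + mterm r g i \<alpha> b c'"
  by (simp add: mterm_def single_add)
lemma mterm_minus: "mterm r g i \<alpha> b (c - c') = mterm r g i \<alpha> b c - mterm r g i \<alpha> b c'"
  by (simp add: mterm_def single_diff)
lemma mterm_sum: "mterm r g i \<alpha> b (sum f A) = (\<Sum>x\<in>A. mterm r g i \<alpha> b (f x))"
  by (induction A rule: infinite_finite_induct) (auto simp: mterm_add)

lemma taylor_diff_mterm:
  fixes c :: "'k::field"
  assumes fin: "\<And>k. finite (g k)" and a: "a < r ^ Suc i"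
    and \<alpha>: "tuple_supp r g (Suc i) a \<subseteq> Poly_Mapping.keys \<alpha>"
  shows "lin_ext (taylor_diff r g i) (mterm r g (Suc i) \<alpha> a c) =
    (\<Sum>b<r ^ i. mterm r g i \<alpha> b (c * bar_coeff r i a b))"
proof -
  let ?U = "tuple_supp r g (Suc i) a"
  have "lin_ext (taylor_diff r g i) (mterm r g (Suc i) \<alpha> a c) =
      (\<Sum>b<r ^ i. Poly_Mapping.single b (Poly_Mapping.single ((\<alpha> - sqmon ?U) + sqmon (?U - tuple_supp r g i b))
        (c * bar_coeff r i a b)))"
    by (simp add: mterm_def lin_ext_single taylor_diff_def fscale_sum fscale_single mult_single del: tuple_supp.simps)
  also have "\<dots> = (\<Sum>b<r ^ i. mterm r g i \<alpha> b (c * bar_coeff r i a b))"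
  proof (intro sum.cong refl)
    fix b
    show "Poly_Mapping.single b (Poly_Mapping.single ((\<alpha> - sqmon ?U) + sqmon (?U - tuple_supp r g i b))
        (c * bar_coeff r i a b)) = mterm r g i \<alpha> b (c * bar_coeff r i a b)"
    proof (cases "bar_coeff r i a b = (0 :: 'k)")
      case False
      have "sqmon ?U = sqmon (?U - tuple_supp r g i b) + sqmon (tuple_supp r g i b)"
        using bar_coeff_nonzero(2)[OF False a] fin by (intro sqmon_split finite_tuple_supp)
      moreover have "\<alpha> = (\<alpha> - sqmon ?U) + sqmon ?U"
        using \<alpha> fin by (intro sqmon_le_split finite_tuple_supp)
      ultimately have "\<alpha> - sqmon (tuple_supp r g i b) = (\<alpha> - sqmon ?U) + sqmon (?U - tuple_supp r g i b)"
        by (metis add.assoc add_diff_cancel_right')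
      then show ?thesis by (simp add: mterm_def del: tuple_supp.simps)
    qed (simp add: mterm_def)
  qed
  finally show ?thesis .
qed

lemma single_eq_mterm:
  assumes "\<And>k. finite (g k)"
  shows "Poly_Mapping.single b (Poly_Mapping.single m c) =
    mterm r g i (m + sqmon (tuple_supp r g i b)) b c"
  by (simp add: mterm_def)

lemma tuple_supp_subset_keys:
  assumes "\<And>k. finite (g k)"
  shows "tuple_supp r g i b \<subseteq> Poly_Mapping.keys (m + sqmon (tuple_supp r g i b))"
  using keys_sqmon[OF finite_tuple_supp[of g r i b]] assms by (simp add: keys_add_nat)

lemma taylor_diff_closed: "taylor_diff r g i a \<in> free_mod {..<r ^ i}"
  unfolding taylor_diff_def by (intro free_mod_sum free_mod_single) auto

lemma taylor_diff_diff:
  assumes fin: "\<And>k. finite (g k)" and "v \<in> free_mod {..<r ^ Suc (Suc i)}"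
  shows "lin_ext (taylor_diff r g i) (lin_ext (taylor_diff r g (Suc i)) v) = (0 :: nat \<Rightarrow>\<^sub>0 ('v, 'k::field) mpoly)"
  using assms(2)
proof (induction v rule: free_mod_term_induct)
  case (add u w)
  then show ?case by (simp add: lin_ext_add)
next
  case (monomial a m c)
  let ?\<alpha> = "m + sqmon (tuple_supp r g (Suc (Suc i)) a)"
  have a: "a < r ^ Suc (Suc i)" using monomial by auto
  have sub: "tuple_supp r g (Suc (Suc i)) a \<subseteq> Poly_Mapping.keys ?\<alpha>"
    by (rule tuple_supp_subset_keys[OF fin])
  have "lin_ext (taylor_diff r g i) (lin_ext (taylor_diff r g (Suc i)) (Poly_Mapping.single a (Poly_Mapping.single m c))) =
      (\<Sum>b<r ^ Suc i. lin_ext (taylor_diff r g i) (mterm r g (Suc i) ?\<alpha> b (c * bar_coeff r (Suc i) a b)))"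
    unfolding single_eq_mterm[of g, OF fin, of a m c r "Suc (Suc i)"]
      taylor_diff_mterm[of g, OF fin a sub] lin_ext_sum ..
  also have "\<dots> = (\<Sum>b<r ^ Suc i. \<Sum>b'<r ^ i. mterm r g i ?\<alpha> b' (c * (bar_coeff r (Suc i) a b * bar_coeff r i b b')))"
  proof (intro sum.cong refl)
    fix b assume b: "b \<in> {..<r ^ Suc i}"
    show "lin_ext (taylor_diff r g i) (mterm r g (Suc i) ?\<alpha> b (c * bar_coeff r (Suc i) a b)) =
        (\<Sum>b'<r ^ i. mterm r g i ?\<alpha> b' (c * (bar_coeff r (Suc i) a b * bar_coeff r i b b')))"
    proof (cases "bar_coeff r (Suc i) a b = (0 :: 'k)")
      case False
      have "tuple_supp r g (Suc i) b \<subseteq> Poly_Mapping.keys ?\<alpha>"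
        using bar_coeff_nonzero(2)[OF False a, of g] sub by blast
      then show ?thesis using b
        by (subst taylor_diff_mterm[of g, OF fin]) (auto simp: mult.assoc simp del: power_Suc bar_coeff.simps tuple_supp.simps)
    qed (simp del: bar_coeff.simps tuple_supp.simps power_Suc)
  qed
  also have "\<dots> = (\<Sum>b'<r ^ i. mterm r g i ?\<alpha> b' (c * (\<Sum>b<r ^ Suc i. bar_coeff r (Suc i) a b * bar_coeff r i b b')))"
    unfolding sum_distrib_left mterm_sum by (rule sum.swap)
  also have "\<dots> = 0" unfolding bar_coeff_comp[OF a] by simp
  finally show ?case .
qed simp

text \<open>The choice depends on the multidegree alone. All terms of a boundary share the
  multidegree and thus receive the same prefix, which is what makes prefixing a contraction.\<close>

definition supp_choice :: "nat \<Rightarrow> (nat \<Rightarrow> 'v set) \<Rightarrow> 'v monom \<Rightarrow> nat" where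
  "supp_choice r g \<alpha> = (SOME k. k < r \<and> g k \<subseteq> Poly_Mapping.keys \<alpha>)"

definition taylor_htpy :: "nat \<Rightarrow> (nat \<Rightarrow> 'v set) \<Rightarrow> nat \<Rightarrow> (nat \<Rightarrow>\<^sub>0 ('v, 'k::field) mpoly) \<Rightarrow> (nat \<Rightarrow>\<^sub>0 ('v, 'k) mpoly)" where
  "taylor_htpy r g i = pm_ext (\<lambda>b. pm_ext (\<lambda>m c.
     let \<alpha> = m + sqmon (tuple_supp r g i b) in mterm r g (Suc i) \<alpha> (supp_choice r g \<alpha> + r * b) c))"

lemma taylor_htpy_add: "taylor_htpy r g i (u + v) = taylor_htpy r g i u + taylor_htpy r g i v"
  unfolding taylor_htpy_def
  by (intro pm_ext_add) (auto simp: Let_def mterm_add intro!: pm_ext_add)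

lemma taylor_htpy_0 [simp]: "taylor_htpy r g i 0 = 0" by (simp add: taylor_htpy_def)

lemma taylor_htpy_sum: "taylor_htpy r g i (sum f A) = (\<Sum>x\<in>A. taylor_htpy r g i (f x))"
  by (induction A rule: infinite_finite_induct) (auto simp: taylor_htpy_add)

lemma taylor_htpy_mterm:
  assumes "\<And>k. finite (g k)" "c \<noteq> 0 \<Longrightarrow> tuple_supp r g i b \<subseteq> Poly_Mapping.keys \<alpha>"
  shows "taylor_htpy r g i (mterm r g i \<alpha> b c) = mterm r g (Suc i) \<alpha> (supp_choice r g \<alpha> + r * b) c"
proof (cases "c = 0")
  case False
  have "(\<alpha> - sqmon (tuple_supp r g i b)) + sqmon (tuple_supp r g i b) = \<alpha>"
    using assms False by (metis sqmon_le_split finite_tuple_supp)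
  then show ?thesis unfolding taylor_htpy_def mterm_def[of r g i]
    by (simp add: pm_ext_single Let_def del: tuple_supp.simps)
qed simp

lemma supp_choice:
  assumes "k < r" "g k \<subseteq> Poly_Mapping.keys \<alpha>"
  shows "supp_choice r g \<alpha> < r" "g (supp_choice r g \<alpha>) \<subseteq> Poly_Mapping.keys \<alpha>"
  using someI[of "\<lambda>k. k < r \<and> g k \<subseteq> Poly_Mapping.keys \<alpha>" k] assms unfolding supp_choice_def by auto

text \<open>This is \<partial>(k, t) = t - (k, \<partial>t) again. A generator dividing the
  multidegree exists because the first entry of the tuple is one.\<close>

lemma taylor_htpy_identity:
  fixes v :: "nat \<Rightarrow>\<^sub>0 ('v, 'k::field) mpoly"
  assumes fin: "\<And>k. finite (g k)" and "v \<in> free_mod {..<r ^ Suc i}"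
  shows "lin_ext (taylor_diff r g (Suc i)) (taylor_htpy r g (Suc i) v) +
           taylor_htpy r g i (lin_ext (taylor_diff r g i) v) = v"
    and "taylor_htpy r g (Suc i) v \<in> free_mod {..<r ^ Suc (Suc i)}"
proof -
  have *: "lin_ext (taylor_diff r g (Suc i)) (taylor_htpy r g (Suc i) v) +
           taylor_htpy r g i (lin_ext (taylor_diff r g i) v) = v \<and>
       taylor_htpy r g (Suc i) v \<in> free_mod {..<r ^ Suc (Suc i)}"
    using assms(2)
  proof (induction v rule: free_mod_term_induct)
    case (add u w)
    then show ?case by (auto simp: lin_ext_add taylor_htpy_add algebra_simps free_mod_add simp del: power_Suc)
  next
    case (monomial a m c)
    let ?\<alpha> = "m + sqmon (tuple_supp r g (Suc i) a)"
    let ?k = "supp_choice r g ?\<alpha>"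
    have a: "a < r ^ Suc i" using monomial by auto
    then have r: "r > 0" by (cases r) auto
    have sub: "tuple_supp r g (Suc i) a \<subseteq> Poly_Mapping.keys ?\<alpha>"
      by (rule tuple_supp_subset_keys[OF fin])
    have k: "?k < r" "g ?k \<subseteq> Poly_Mapping.keys ?\<alpha>"
      using supp_choice[of "a mod r" r g ?\<alpha>] r sub by auto
    have eq: "Poly_Mapping.single a (Poly_Mapping.single m c) = mterm r g (Suc i) ?\<alpha> a c"
      by (rule single_eq_mterm[OF fin])
    have lt: "?k + r * a < r ^ Suc (Suc i)" using k(1) a by (rule cons_less_power)
    have dm: "(?k + r * b) div r = b" "(?k + r * b) mod r = ?k" for b using k(1) by auto
    have sub2: "tuple_supp r g (Suc (Suc i)) (?k + r * a) \<subseteq> Poly_Mapping.keys ?\<alpha>"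
      using sub k unfolding tuple_supp.simps(2)[of r g "Suc i"] dm by blast
    have h: "taylor_htpy r g (Suc i) (mterm r g (Suc i) ?\<alpha> a c) = mterm r g (Suc (Suc i)) ?\<alpha> (?k + r * a) c"
      by (rule taylor_htpy_mterm[OF fin sub])
    have "lin_ext (taylor_diff r g (Suc i)) (mterm r g (Suc (Suc i)) ?\<alpha> (?k + r * a) c) =
        (\<Sum>b<r ^ Suc i. mterm r g (Suc i) ?\<alpha> b (c * bar_coeff r (Suc i) (?k + r * a) b))"
      by (rule taylor_diff_mterm[OF fin lt sub2])
    also have "\<dots> = (\<Sum>b<r ^ Suc i. if b = a then mterm r g (Suc i) ?\<alpha> b c else 0) -
        (\<Sum>b<r ^ Suc i. if b mod r = ?k then mterm r g (Suc i) ?\<alpha> b (c * bar_coeff r i a (b div r)) else 0)"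
      unfolding sum_subtractf[symmetric]
      by (intro sum.cong refl) (simp only: bar_coeff.simps(2) dm, auto simp: right_diff_distrib mterm_minus simp del: bar_coeff.simps tuple_supp.simps)
    also have "(\<Sum>b<r ^ Suc i. if b = a then mterm r g (Suc i) ?\<alpha> b c else 0) = mterm r g (Suc i) ?\<alpha> a c"
      using a by (simp del: power_Suc tuple_supp.simps)
    also have "(\<Sum>b<r ^ Suc i. if b mod r = ?k then mterm r g (Suc i) ?\<alpha> b (c * bar_coeff r i a (b div r)) else 0) =
        (\<Sum>b<r ^ i. mterm r g (Suc i) ?\<alpha> (?k + r * b) (c * bar_coeff r i a b))"
      unfolding sum_mod_digit[OF k(1)] dm ..
    also have "\<dots> = taylor_htpy r g i (lin_ext (taylor_diff r g i) (mterm r g (Suc i) ?\<alpha> a c))"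
      unfolding taylor_diff_mterm[of g, OF fin a sub] taylor_htpy_sum
    proof (intro sum.cong refl taylor_htpy_mterm[symmetric] fin)
      fix b assume "c * bar_coeff r i a b \<noteq> 0"
      then have "bar_coeff r i a b \<noteq> (0 :: 'k)" by auto
      from bar_coeff_nonzero(2)[OF this a, of g] sub
      show "tuple_supp r g i b \<subseteq> Poly_Mapping.keys ?\<alpha>" by (rule subset_trans)
    qed
    finally show ?case unfolding eq h
      using lt by (auto simp: mterm_def free_mod_single simp del: power_Suc tuple_supp.simps)
  qed simp
  show "lin_ext (taylor_diff r g (Suc i)) (taylor_htpy r g (Suc i) v) +
           taylor_htpy r g i (lin_ext (taylor_diff r g i) v) = v"
    and "taylor_htpy r g (Suc i) v \<in> free_mod {..<r ^ Suc (Suc i)}" using * by auto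
qed

text \<open>The empty tuple offers no generator to prefix, so each monomial of \<open>f\<close> has
  to be divisible by one; this is membership in the monomial ideal.\<close>

lemma taylor_htpy_0_identity:
  fixes f :: "('v, 'k::field) mpoly"
  assumes fin: "\<And>k. finite (g k)"
    and f: "\<And>m. m \<in> Poly_Mapping.keys f \<Longrightarrow> \<exists>k<r. g k \<subseteq> Poly_Mapping.keys m"
  shows "lin_ext (taylor_diff r g 0) (taylor_htpy r g 0 (Poly_Mapping.single 0 f)) = Poly_Mapping.single 0 f \<and>
    taylor_htpy r g 0 (Poly_Mapping.single 0 f) \<in> free_mod {..<r ^ Suc 0}"
proof -
  have mon: "lin_ext (taylor_diff r g 0) (taylor_htpy r g 0 (Poly_Mapping.single 0 (Poly_Mapping.single m c))) =
      Poly_Mapping.single 0 (Poly_Mapping.single m c) \<and>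
      taylor_htpy r g 0 (Poly_Mapping.single 0 (Poly_Mapping.single m c)) \<in> free_mod {..<r ^ Suc 0}"
    if "\<exists>k<r. g k \<subseteq> Poly_Mapping.keys m" for m and c :: 'k
  proof -
    let ?k = "supp_choice r g m"
    have k: "?k < r" "g ?k \<subseteq> Poly_Mapping.keys m" using that supp_choice by blast+
    have eq: "Poly_Mapping.single 0 (Poly_Mapping.single m c) = mterm r g 0 m 0 c"
      by (simp add: mterm_def)
    have h: "taylor_htpy r g 0 (mterm r g 0 m 0 c) = mterm r g (Suc 0) m ?k c"
    proof -
      have "taylor_htpy r g 0 (mterm r g 0 m 0 c) = mterm r g (Suc 0) m (?k + r * 0) c"
        by (rule taylor_htpy_mterm[OF fin]) simp
      then show ?thesis by simp
    qed
    have "lin_ext (taylor_diff r g 0) (mterm r g (Suc 0) m ?k c) = mterm r g 0 m 0 c"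
      using k by (subst taylor_diff_mterm[of g, OF fin]) auto
    then show ?thesis unfolding eq h using k by (auto simp: mterm_def free_mod_single)
  qed
  have "Poly_Mapping.single 0 f = (\<Sum>m\<in>Poly_Mapping.keys f. Poly_Mapping.single (0::nat) (Poly_Mapping.single m (Poly_Mapping.lookup f m)))"
  proof -
    have "Poly_Mapping.single (0::nat) (sum q M) = (\<Sum>m\<in>M. Poly_Mapping.single 0 (q m))"
      for q :: "'v monom \<Rightarrow> ('v, 'k) mpoly" and M
      by (induction M rule: infinite_finite_induct) (auto simp: single_add)
    then show ?thesis using sum_single_lookup[of f] by metis
  qed
  moreover have "lin_ext (taylor_diff r g 0) (taylor_htpy r g 0 (\<Sum>m\<in>Poly_Mapping.keys f. Poly_Mapping.single 0 (Poly_Mapping.single m (Poly_Mapping.lookup f m)))) =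
      (\<Sum>m\<in>Poly_Mapping.keys f. Poly_Mapping.single 0 (Poly_Mapping.single m (Poly_Mapping.lookup f m)))"
    unfolding taylor_htpy_sum lin_ext_sum using mon f by (intro sum.cong refl) blast
  moreover have "taylor_htpy r g 0 (\<Sum>m\<in>Poly_Mapping.keys f. Poly_Mapping.single 0 (Poly_Mapping.single m (Poly_Mapping.lookup f m))) \<in> free_mod {..<r ^ Suc 0}"
    unfolding taylor_htpy_sum using mon f by (intro free_mod_sum) blast
  ultimately show ?thesis by metis
qed

definition taylor_resolution :: "nat \<Rightarrow> (nat \<Rightarrow> 'v set) \<Rightarrow> ('v, 'k::field) graded_free" where
  "taylor_resolution r g = \<lparr>gf_rank = \<lambda>i. r ^ i, gf_deg = \<lambda>i a. card (tuple_supp r g i a),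
     gf_aug = \<lambda>_. 1, gf_diff = taylor_diff r g\<rparr>"

section \<open>The Stanley-Reisner ideal and exactness of the resolution\<close>

lemma SR_ideal_eq:
  "(SR_ideal \<Delta> :: ('v::finite, 'k::field) mpoly set) =
     ideal.span ((\<lambda>F. Poly_Mapping.single (sqmon F) 1) ` (- \<Delta>))"
proof -
  have "{\<Prod>v\<in>F. pvar v | F. F \<notin> \<Delta>} = (\<lambda>F. Poly_Mapping.single (sqmon F) (1 :: 'k)) ` (- \<Delta>)"
    by (auto simp: prod_pvar)
  then show ?thesis unfolding SR_ideal_def genideal_type_ring by simp
qed

lemma keys_SR_ideal:
  assumes "f \<in> (SR_ideal \<Delta> :: ('v::finite, 'k::field) mpoly set)" "m \<in> Poly_Mapping.keys f"
  shows "\<exists>F. F \<notin> \<Delta> \<and> F \<subseteq> Poly_Mapping.keys m"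
proof -
  have "\<forall>m\<in>Poly_Mapping.keys f. \<exists>F. F \<notin> \<Delta> \<and> F \<subseteq> Poly_Mapping.keys m"
    using assms(1) unfolding SR_ideal_eq
  proof (induction f rule: ideal.span_induct_alt)
    case (step c x y)
    then obtain F where F: "F \<notin> \<Delta>" "x = Poly_Mapping.single (sqmon F) 1" by auto
    show ?case
    proof
      fix m assume "m \<in> Poly_Mapping.keys (c * x + y)"
      then have "m \<in> Poly_Mapping.keys (c * x) \<or> m \<in> Poly_Mapping.keys y"
        using Poly_Mapping.keys_add[of "c * x" y] by auto
      moreover have "F \<subseteq> Poly_Mapping.keys m" if mm: "m \<in> Poly_Mapping.keys (c * x)"
      proof -
        obtain m' where "m = m' + sqmon F"
          using subsetD[OF Poly_Mapping.keys_mult mm] F(2) by (auto split: if_splits)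
        then show ?thesis using keys_sqmon[of F] by (simp add: keys_add_nat)
      qed
      ultimately show "\<exists>F. F \<notin> \<Delta> \<and> F \<subseteq> Poly_Mapping.keys m" using step F by blast
    qed
  qed simp
  then show ?thesis using assms(2) by blast
qed

lemma subspace_SR_ideal: "ideal.subspace (SR_ideal \<Delta> :: ('v::finite, 'k::field) mpoly set)"
  unfolding SR_ideal_eq by (rule ideal.subspace_span)

lemma single_in_SR_ideal:
  assumes "F \<notin> \<Delta>" "F \<subseteq> Poly_Mapping.keys m"
  shows "Poly_Mapping.single m c \<in> (SR_ideal \<Delta> :: ('v::finite, 'k::field) mpoly set)"
proof -
  have "Poly_Mapping.single m c = Poly_Mapping.single (m - sqmon F) c * Poly_Mapping.single (sqmon F) 1"
    using sqmon_le_split[of F m] assms(2) by (simp add: mult_single)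
  moreover have "Poly_Mapping.single (sqmon F) 1 \<in> (SR_ideal \<Delta> :: ('v, 'k) mpoly set)"
    unfolding SR_ideal_eq using assms(1) by (intro ideal.span_base) auto
  ultimately show ?thesis using ideal.subspace_scale[OF subspace_SR_ideal] by metis
qed

lemma graded_SR_ideal: "graded_ideal (SR_ideal \<Delta> :: ('v::finite, 'k::field) mpoly set)"
  unfolding SR_ideal_eq by (rule graded_ideal_span) (auto intro: homogeneous_single)

lemma free_mod_1: "v \<in> free_mod {..<Suc 0} \<longleftrightarrow> (v = Poly_Mapping.single 0 (Poly_Mapping.lookup v 0))"
proof
  assume "v \<in> free_mod {..<Suc 0}"
  then show "v = Poly_Mapping.single 0 (Poly_Mapping.lookup v 0)"
    by (intro poly_mapping_eqI) (auto simp: free_mod_def lookup_single when_def in_keys_iff subset_iff)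
next
  assume "v = Poly_Mapping.single 0 (Poly_Mapping.lookup v 0)"
  then show "v \<in> free_mod {..<Suc 0}" by (metis free_mod_single lessThan_iff zero_less_Suc)
qed

lemma taylor_resolution_exact_0:
  assumes g: "g ` {..<r} = - (\<Delta> :: ('v::finite) set set)"
  shows "{v \<in> free_mod {..<Suc 0}. Poly_Mapping.lookup v 0 \<in> (SR_ideal \<Delta> :: ('v, 'k::field) mpoly set)} =
    lin_ext (taylor_diff r g 0) ` free_mod {..<r}"
proof (intro equalityI subsetI)
  fix v :: "nat \<Rightarrow>\<^sub>0 ('v, 'k) mpoly"
  assume v: "v \<in> {v \<in> free_mod {..<Suc 0}. Poly_Mapping.lookup v 0 \<in> SR_ideal \<Delta>}"
  have "\<exists>k<r. g k \<subseteq> Poly_Mapping.keys m" if mm: "m \<in> Poly_Mapping.keys (Poly_Mapping.lookup v 0)" for m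
  proof -
    obtain F where F: "F \<notin> \<Delta>" "F \<subseteq> Poly_Mapping.keys m" using keys_SR_ideal[of "Poly_Mapping.lookup v 0" \<Delta> m] v mm by blast
    then have "F \<in> g ` {..<r}" using g by auto
    then show ?thesis using F by auto
  qed
  from taylor_htpy_0_identity[of g "Poly_Mapping.lookup v 0" r, OF _ this]
  show "v \<in> lin_ext (taylor_diff r g 0) ` free_mod {..<r}"
    using v free_mod_1[of v] by (auto intro!: rev_image_eqI)
next
  fix v :: "nat \<Rightarrow>\<^sub>0 ('v, 'k) mpoly"
  assume "v \<in> lin_ext (taylor_diff r g 0) ` free_mod {..<r}"
  then obtain w where w: "w \<in> free_mod {..<r}" "v = lin_ext (taylor_diff r g 0) w" by auto
  have "v \<in> free_mod {..<Suc 0}"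
    unfolding w(2) using w(1) taylor_diff_closed[of r g 0] by (intro lin_ext_closed) auto
  moreover have "Poly_Mapping.lookup (lin_ext (taylor_diff r g 0) w) 0 \<in> (SR_ideal \<Delta> :: ('v, 'k) mpoly set)"
    using w(1)
  proof (induction w rule: free_mod_term_induct)
    case zero
    then show ?case using ideal.subspace_0[OF subspace_SR_ideal] by simp
  next
    case (add u w)
    then show ?case using ideal.subspace_add[OF subspace_SR_ideal] by (simp add: lin_ext_add lookup_add)
  next
    case (monomial b m c)
    have "g (b mod r) \<notin> \<Delta>" using g monomial by auto
    then show ?case
      by (auto simp: lin_ext_single taylor_diff_def fscale_single mult_single keys_add_nat keys_sqmon
          intro!: single_in_SR_ideal)
  qed
  ultimately show "v \<in> {v \<in> free_mod {..<Suc 0}. Poly_Mapping.lookup v 0 \<in> SR_ideal \<Delta>}"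
    using w(2) by simp
qed

lemma taylor_diff_homogeneous:
  assumes fin: "\<And>k. finite (g k)" and a: "a < r ^ Suc i"
    and m: "m \<in> Poly_Mapping.keys (Poly_Mapping.lookup (taylor_diff r g i a :: nat \<Rightarrow>\<^sub>0 ('v, 'k::field) mpoly) b)"
  shows "mdeg m + card (tuple_supp r g i b) = card (tuple_supp r g (Suc i) a)"
proof -
  let ?U = "tuple_supp r g (Suc i) a" and ?W = "tuple_supp r g i b"
  have lk: "Poly_Mapping.lookup (taylor_diff r g i a) b =
      (\<Sum>b'<r ^ i. if b' = b then Poly_Mapping.single (sqmon (?U - ?W)) (bar_coeff r i a b) else 0)"
    unfolding taylor_diff_def lookup_sum by (intro sum.cong refl) (auto simp: lookup_single)
  have "m = sqmon (?U - ?W)" "bar_coeff r i a b \<noteq> (0 :: 'k)"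
    using m unfolding lk by (auto split: if_splits simp del: tuple_supp.simps)
  moreover have "?W \<subseteq> ?U" using bar_coeff_nonzero(2)[OF calculation(2) a] .
  moreover have "finite ?U" "finite ?W" using finite_tuple_supp fin by blast+
  ultimately show ?thesis
    by (simp add: mdeg_sqmon card_Diff_subset card_mono del: tuple_supp.simps)
qed

text \<open>\<open>tor_dim\<close> evaluates a resolution given by a choice operator; existence
  guarantees that the chosen object is one. The generators enumerated here are the monomials of all
  nonfaces.\<close>

theorem SR_resolution_exists:
  "\<exists>R. graded_free_resolution (SR_ideal \<Delta> :: ('v::finite, 'k::field) mpoly set) R"
proof -
  let ?I = "SR_ideal \<Delta> :: ('v, 'k) mpoly set"
  obtain r and g :: "nat \<Rightarrow> 'v set" where g: "g ` {..<r} = - \<Delta>"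
    using finite_imp_nat_seg_image_inj_on[of "- \<Delta>"] by (auto simp: lessThan_def)
  let ?R = "taylor_resolution r g :: ('v, 'k) graded_free"
  have rank: "gf_mod ?R i = free_mod {..<r ^ i}" for i by (simp add: gf_mod_def taylor_resolution_def)
  have aug: "aug_map ?I ?R v = ?I +>\<^bsub>poly_ring\<^esub> Poly_Mapping.lookup v 0" if "v \<in> free_mod {..<Suc 0}" for v
  proof -
    have "(\<Sum>a\<in>Poly_Mapping.keys v. Poly_Mapping.lookup v a * gf_aug ?R a) = (\<Sum>a\<in>{0}. Poly_Mapping.lookup v a)"
      using that by (intro sum.mono_neutral_cong_left) (auto simp: taylor_resolution_def free_mod_def in_keys_iff)
    then show ?thesis by (simp add: aug_map_def)
  qed
  have fin: "finite (g k)" for k by simp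
  have sub: "ideal.subspace ?I" by (rule subspace_SR_ideal)
  have "graded_free_resolution ?I ?R"
    unfolding graded_free_resolution_def
  proof (intro conjI allI impI)
    show "homogeneous (gf_deg ?R 0 a) (gf_aug ?R a)" for a
      by (simp add: taylor_resolution_def homogeneous_def)
    show "gf_diff ?R i a \<in> gf_mod ?R i" for i a
      unfolding rank by (simp add: taylor_resolution_def taylor_diff_closed)
    show "\<forall>m\<in>Poly_Mapping.keys (Poly_Mapping.lookup (gf_diff ?R i a) b).
        mdeg m + gf_deg ?R i b = gf_deg ?R (Suc i) a" if "a < gf_rank ?R (Suc i)" for i a b
      using that taylor_diff_homogeneous[of g a r i _ b, OF fin]
      by (auto simp: taylor_resolution_def simp del: tuple_supp.simps)
    show "aug_map ?I ?R ` gf_mod ?R 0 = carrier (poly_ring Quot ?I)"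
    proof -
      have "aug_map ?I ?R ` gf_mod ?R 0 = (\<lambda>v. ?I +>\<^bsub>poly_ring\<^esub> Poly_Mapping.lookup v 0) ` free_mod {..<Suc 0}"
        unfolding rank using aug by (intro image_cong) auto
      also have "\<dots> = range (\<lambda>x. ?I +>\<^bsub>poly_ring\<^esub> x)"
      proof (intro equalityI subsetI)
        fix y assume "y \<in> range (\<lambda>x. ?I +>\<^bsub>poly_ring\<^esub> x)"
        then obtain x where "y = ?I +>\<^bsub>poly_ring\<^esub> x" by auto
        then show "y \<in> (\<lambda>v. ?I +>\<^bsub>poly_ring\<^esub> Poly_Mapping.lookup v 0) ` free_mod {..<Suc 0}"
          by (intro image_eqI[of _ _ "Poly_Mapping.single 0 x"]) (auto intro: free_mod_single)
      qed auto
      finally show ?thesis by (simp add: carrier_Quot_type_ring)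
    qed
    show "{v \<in> gf_mod ?R 0. aug_map ?I ?R v = \<zero>\<^bsub>poly_ring Quot ?I\<^esub>} = lin_ext (gf_diff ?R 0) ` gf_mod ?R 1"
    proof -
      have "{v \<in> gf_mod ?R 0. aug_map ?I ?R v = \<zero>\<^bsub>poly_ring Quot ?I\<^esub>} =
          {v \<in> free_mod {..<Suc 0}. Poly_Mapping.lookup v 0 \<in> ?I}"
        unfolding rank zero_Quot using aug coset_eq_self_iff[OF sub] by auto
      then show ?thesis unfolding taylor_resolution_exact_0[OF g] rank
        by (simp add: taylor_resolution_def)
    qed
    show "{v \<in> gf_mod ?R (Suc i). lin_ext (gf_diff ?R i) v = 0} =
        lin_ext (gf_diff ?R (Suc i)) ` gf_mod ?R (Suc (Suc i))" for i
    proof (intro equalityI subsetI)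
      fix v assume "v \<in> {v \<in> gf_mod ?R (Suc i). lin_ext (gf_diff ?R i) v = 0}"
      then have v: "v \<in> free_mod {..<r ^ Suc i}" "lin_ext (taylor_diff r g i) v = 0"
        unfolding rank by (auto simp: taylor_resolution_def)
      have "v = lin_ext (taylor_diff r g (Suc i)) (taylor_htpy r g (Suc i) v)"
        using taylor_htpy_identity(1)[of g v r i, OF fin v(1)] v(2) by simp
      then show "v \<in> lin_ext (gf_diff ?R (Suc i)) ` gf_mod ?R (Suc (Suc i))"
        unfolding rank using taylor_htpy_identity(2)[of g v r i, OF fin v(1)]
        by (intro image_eqI[of _ _ "taylor_htpy r g (Suc i) v"]) (auto simp: taylor_resolution_def)
    next
      fix v assume "v \<in> lin_ext (gf_diff ?R (Suc i)) ` gf_mod ?R (Suc (Suc i))"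
      then obtain w where w: "w \<in> free_mod {..<r ^ Suc (Suc i)}" "v = lin_ext (taylor_diff r g (Suc i)) w"
        unfolding rank by (auto simp: taylor_resolution_def)
      have "v \<in> free_mod {..<r ^ Suc i}"
        unfolding w(2) using w(1) taylor_diff_closed by (rule lin_ext_closed)
      moreover have "lin_ext (taylor_diff r g i) v = 0"
        unfolding w(2) by (rule taylor_diff_diff[OF fin w(1)])
      ultimately show "v \<in> {v \<in> gf_mod ?R (Suc i). lin_ext (gf_diff ?R i) v = 0}"
        unfolding rank by (simp add: taylor_resolution_def)
    qed
  qed
  then show ?thesis by blast
qed

section \<open>Betti numbers along a sequence of linear forms\<close>

context vector_space
begin

text \<open>A subspace of a quotient needs no more generators than the quotient, shown by exchanging
  one generator at a time. Quotients are never formed and the ambient spaces are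
  infinite-dimensional, so generators are counted in place of dimensions.\<close>

lemma subspace_spanned_modulo:
  assumes "finite G" "subspace K" "K \<subseteq> span (G \<union> B)"
  shows "\<exists>G'. finite G' \<and> G' \<subseteq> K \<and> card G' \<le> card G \<and> K \<subseteq> span (G' \<union> B)"
  using assms
proof (induction G arbitrary: K rule: finite_induct)
  case empty
  then show ?case by (intro exI[of _ "{}"]) auto
next
  case (insert g G)
  define K0 where "K0 = K \<inter> span (G \<union> B)"
  have "subspace K0"
    unfolding K0_def using insert.prems(1) by (intro subspace_inter) auto
  from insert.IH[OF this] obtain G' where G': "finite G'" "G' \<subseteq> K0" "card G' \<le> card G"
      "K0 \<subseteq> span (G' \<union> B)"
    unfolding K0_def by blast
  show ?case
  proof (cases "K \<subseteq> span (G \<union> B)")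
    case True
    then have "K0 = K" unfolding K0_def by auto
    with G' insert.hyps show ?thesis by (intro exI[of _ G']) auto
  next
    case False
    \<comment> \<open>\<open>k1\<close> involves \<open>g\<close> with a nonzero coefficient
      \<open>c\<close>, so it can take the place of \<open>g\<close>.\<close>
    then obtain k1 where k1: "k1 \<in> K" "k1 \<notin> span (G \<union> B)" by auto
    have in_ins: "\<exists>c. k - scale c g \<in> span (G \<union> B)" if "k \<in> K" for k
      using insert.prems(2) that span_breakdown_eq[of k g "G \<union> B"] by auto
    obtain c where c: "k1 - scale c g \<in> span (G \<union> B)" using in_ins k1 by blast
    have c0: "c \<noteq> 0" using c k1 by auto
    have "k \<in> span (insert k1 (G' \<union> B))" if k: "k \<in> K" for k
    proof -
      obtain c' where c': "k - scale c' g \<in> span (G \<union> B)" using in_ins k by blast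
      have eq: "k - scale (c' / c) k1 =
          (k - scale c' g) - scale (c' / c) (k1 - scale c g)"
        using c0 by (simp add: scale_right_diff_distrib)
      have "k - scale (c' / c) k1 \<in> span (G \<union> B)"
        unfolding eq by (intro span_diff span_scale c c')
      moreover have "k - scale (c' / c) k1 \<in> K"
        using k k1 insert.prems(1) by (intro subspace_diff subspace_scale)
      ultimately have "k - scale (c' / c) k1 \<in> span (G' \<union> B)"
        using G'(4) unfolding K0_def by auto
      then show ?thesis using span_breakdown_eq by blast
    qed
    then have "K \<subseteq> span (insert k1 G' \<union> B)" by auto
    moreover have "card (insert k1 G') \<le> card (insert g G)"
      using G'(1,3) insert.hyps by (simp add: card_insert_if)
    ultimately show ?thesis using G' k1 unfolding K0_def
      by (intro exI[of _ "insert k1 G'"]) auto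
  qed
qed

text \<open>The finite set \<open>W\<close> makes a basis of \<open>B\<close> finite, so that
  \<open>dim B\<close> is a genuine count.\<close>

lemma dim_le_card_add_dim:
  assumes "finite G" "finite W" "B \<subseteq> span W" "Z \<subseteq> span (G \<union> B)"
  shows "dim Z \<le> card G + dim B"
proof -
  obtain Bs where Bs: "Bs \<subseteq> B" "independent Bs" "B \<subseteq> span Bs" "card Bs = dim B"
    using basis_exists by blast
  have fin: "finite Bs"
    using Bs assms by (meson independent_span_bound order_trans)
  have "span (G \<union> B) \<subseteq> span (G \<union> Bs)"
    using Bs(3) by (metis (no_types, lifting) Un_subset_iff span_mono span_superset span_minimal subspace_span sup_ge1 sup_ge2 order_trans)
  then have "dim Z \<le> card (G \<union> Bs)"
    using assms(1,4) fin by (intro dim_le_card) auto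
  also have "\<dots> \<le> card G + card Bs" by (rule card_Un_le)
  finally show ?thesis using Bs(4) by simp
qed

end

section \<open>Homology of a graded complex modulo commuting operators\<close>

text \<open>Abstracts a graded free resolution with multiplication by linear forms: exactness is
  assumed in positive positions, and the homology in position 0 is the resolved module. Degrees are
  integers, so that the shift \<open>c - 1\<close> never truncates.\<close>

locale graded_complex = vector_space scale
  for scale :: "'k::field \<Rightarrow> 'a::ab_group_add \<Rightarrow> 'a" +
  fixes C :: "nat \<Rightarrow> int \<Rightarrow> 'a set" and d :: "nat \<Rightarrow> 'a \<Rightarrow> 'a"
    and z :: "nat \<Rightarrow> 'a \<Rightarrow> 'a"
  assumes subspace_C: "subspace (C i c)"
    and d_add: "d i (u + v) = d i u + d i v"
    and d_scale: "d i (scale a u) = scale a (d i u)"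
    and d_closed: "u \<in> C (Suc i) c \<Longrightarrow> d i u \<in> C i c"
    and d_d: "u \<in> C (Suc (Suc i)) c \<Longrightarrow> d i (d (Suc i) u) = 0"
    and exact: "u \<in> C (Suc i) c \<Longrightarrow> d i u = 0 \<Longrightarrow> \<exists>w\<in>C (Suc (Suc i)) c. d (Suc i) w = u"
    and z_add: "z l (u + v) = z l u + z l v"
    and z_scale: "z l (scale a u) = scale a (z l u)"
    and z_closed: "u \<in> C i c \<Longrightarrow> z l u \<in> C i (c + 1)"
    and d_z: "d i (z l u) = z l (d i u)"
    and z_z: "z l (z l' u) = z l' (z l u)"
begin

definition N :: "nat \<Rightarrow> nat \<Rightarrow> int \<Rightarrow> 'a set" where
  "N k i c = {\<Sum>l<k. z l (u l) | u. \<forall>l<k. u l \<in> C i (c - 1)}"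

text \<open>\<open>Z\<close> and \<open>B\<close> are the preimages in \<open>C\<close> of the
  cycles and boundaries of the complex modulo \<open>N\<close>. For a free resolution and linear
  forms, \<open>Z\<close> modulo \<open>B\<close> is the homology after tensoring with the quotient
  by the first \<open>k\<close> forms.\<close>

definition Z :: "nat \<Rightarrow> nat \<Rightarrow> int \<Rightarrow> 'a set" where
  "Z k i c = (case i of 0 \<Rightarrow> C 0 c | Suc i' \<Rightarrow> {v \<in> C (Suc i') c. d i' v \<in> N k i' c})"

definition B :: "nat \<Rightarrow> nat \<Rightarrow> int \<Rightarrow> 'a set" where
  "B k i c = {d i w + u | w u. w \<in> C (Suc i) c \<and> u \<in> N k i c}"

definition hom_le :: "nat \<Rightarrow> nat \<Rightarrow> int \<Rightarrow> nat \<Rightarrow> bool" where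
  "hom_le k i c r \<longleftrightarrow> (\<exists>G. finite G \<and> card G \<le> r \<and> Z k i c \<subseteq> span (G \<union> B k i c))"

text \<open>The kernel of multiplication by \<open>z k\<close> on the homology modulo the first
  \<open>k\<close> operators, pulled back to cycles.\<close>

definition K :: "nat \<Rightarrow> nat \<Rightarrow> int \<Rightarrow> 'a set" where
  "K k i c = {u \<in> Z k i c. z k u \<in> B k i (c + 1)}"

lemma d_0 [simp]: "d i 0 = 0" using d_add[of i 0 0] by simp
lemma z_0 [simp]: "z l 0 = 0" using z_add[of l 0 0] by simp
lemma d_minus: "d i (- u) = - d i u" using d_add[of i u "- u"] by (simp add: eq_neg_iff_add_eq_0 add.commute)
lemma d_diff: "d i (u - v) = d i u - d i v" using d_add[of i u "- v"] by (simp add: d_minus)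
lemma d_sum: "d i (sum f A) = sum (\<lambda>x. d i (f x)) A"
  by (induction A rule: infinite_finite_induct) (auto simp: d_add)
lemma z_sum: "z l (sum f A) = sum (\<lambda>x. z l (f x)) A"
  by (induction A rule: infinite_finite_induct) (auto simp: z_add)

lemma subspace_N: "subspace (N k i c)"
proof (rule subspaceI)
  show "0 \<in> N k i c" unfolding N_def
    by (rule CollectI, rule exI[of _ "\<lambda>_. 0"]) (use subspace_C subspace_0 in auto)
next
  fix x y assume "x \<in> N k i c" "y \<in> N k i c"
  then obtain u v where "x = (\<Sum>l<k. z l (u l))" "\<forall>l<k. u l \<in> C i (c - 1)"
    "y = (\<Sum>l<k. z l (v l))" "\<forall>l<k. v l \<in> C i (c - 1)" unfolding N_def by auto
  then show "x + y \<in> N k i c" unfolding N_def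
    by (intro CollectI exI[of _ "\<lambda>l. u l + v l"])
      (auto simp: z_add sum.distrib intro: subspace_add[OF subspace_C])
next
  fix a x assume "x \<in> N k i c"
  then obtain u where "x = (\<Sum>l<k. z l (u l))" "\<forall>l<k. u l \<in> C i (c - 1)"
    unfolding N_def by auto
  then show "scale a x \<in> N k i c" unfolding N_def
    by (intro CollectI exI[of _ "\<lambda>l. scale a (u l)"])
      (auto simp: z_scale scale_sum_right intro: subspace_scale[OF subspace_C])
qed

lemma N_subset_C: "N k i c \<subseteq> C i c"
proof
  fix x assume "x \<in> N k i c"
  then obtain u where "x = (\<Sum>l<k. z l (u l))" "\<forall>l<k. u l \<in> C i (c - 1)"
    unfolding N_def by auto
  then show "x \<in> C i c"
    using z_closed[of _ i "c - 1"] by (auto intro!: subspace_sum[OF subspace_C])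
qed

lemma N_0: "N 0 i c = {0}" unfolding N_def by auto

lemma N_Suc: "x \<in> N (Suc k) i c \<longleftrightarrow> (\<exists>u\<in>C i (c - 1). x - z k u \<in> N k i c)"
proof
  assume "x \<in> N (Suc k) i c"
  then obtain u where "x = (\<Sum>l<Suc k. z l (u l))" "\<forall>l<Suc k. u l \<in> C i (c - 1)"
    unfolding N_def by auto
  then show "\<exists>u\<in>C i (c - 1). x - z k u \<in> N k i c" unfolding N_def
    by (intro bexI[of _ "u k"]) (auto intro!: exI[of _ u])
next
  assume "\<exists>u\<in>C i (c - 1). x - z k u \<in> N k i c"
  then obtain u w where uw: "u \<in> C i (c - 1)" "x - z k u = (\<Sum>l<k. z l (w l))"
    "\<forall>l<k. w l \<in> C i (c - 1)" unfolding N_def by auto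
  then show "x \<in> N (Suc k) i c" unfolding N_def
    by (intro CollectI exI[of _ "w(k := u)"]) (auto simp: algebra_simps less_Suc_eq)
qed

lemma N_mono: "N k i c \<subseteq> N (Suc k) i c"
  using N_Suc[of _ k i c] subspace_0[OF subspace_C] by (force simp: )

lemma z_in_N: "l < k \<Longrightarrow> u \<in> C i (c - 1) \<Longrightarrow> z l u \<in> N k i c"
  unfolding N_def
  by (intro CollectI exI[of _ "\<lambda>l'. if l' = l then u else 0"])
    (auto simp: if_distrib[of "z _"] subspace_0[OF subspace_C] cong: if_cong intro!: sum.cong)

lemma d_N: "x \<in> N k (Suc i) c \<Longrightarrow> d i x \<in> N k i c"
  unfolding N_def by (force simp: d_sum d_z intro: d_closed)

lemma subspace_Z: "subspace (Z k i c)"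
proof (cases i)
  case (Suc i')
  show ?thesis unfolding Z_def Suc using subspace_C[of "Suc i'" c] subspace_N[of k i' c]
    by (auto simp: subspace_def d_add d_scale)
qed (auto simp: Z_def subspace_C)

lemma B_subset_C: "B k i c \<subseteq> C i c"
  unfolding B_def using N_subset_C d_closed by (auto intro!: subspace_add[OF subspace_C])

lemma subspace_B: "subspace (B k i c)"
proof (rule subspaceI)
  show "0 \<in> B k i c" unfolding B_def
    by (rule CollectI, rule exI[of _ 0], rule exI[of _ 0])
      (use subspace_0[OF subspace_C] subspace_0[OF subspace_N] in auto)
next
  fix x y assume "x \<in> B k i c" "y \<in> B k i c"
  then obtain w u w' u' where *: "x = d i w + u" "w \<in> C (Suc i) c" "u \<in> N k i c"
    "y = d i w' + u'" "w' \<in> C (Suc i) c" "u' \<in> N k i c" unfolding B_def by auto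
  then have "x + y = d i (w + w') + (u + u')" by (simp add: d_add)
  with * show "x + y \<in> B k i c" unfolding B_def
    using subspace_add[OF subspace_C] subspace_add[OF subspace_N] by blast
next
  fix a x assume "x \<in> B k i c"
  then obtain w u where *: "x = d i w + u" "w \<in> C (Suc i) c" "u \<in> N k i c"
    unfolding B_def by auto
  then have "scale a x = d i (scale a w) + scale a u" by (simp add: d_scale scale_right_distrib)
  with * show "scale a x \<in> B k i c" unfolding B_def
    using subspace_scale[OF subspace_C] subspace_scale[OF subspace_N] by blast
qed

lemma N_subset_B: "N k i c \<subseteq> B k i c"
proof
  fix x assume "x \<in> N k i c"
  then have "x = d i 0 + x" "0 \<in> C (Suc i) c" using subspace_0[OF subspace_C] by auto
  with \<open>x \<in> N k i c\<close> show "x \<in> B k i c" unfolding B_def by blast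
qed

lemma d_in_B: "w \<in> C (Suc i) c \<Longrightarrow> d i w \<in> B k i c"
  unfolding B_def using subspace_0[OF subspace_N] by force

lemma B_mono: "B k i c \<subseteq> B (Suc k) i c"
  unfolding B_def using N_mono by blast

lemma subspace_K: "subspace (K k i c)"
  unfolding K_def using subspace_Z[of k i c] subspace_B[of k i "c + 1"]
  by (auto simp: subspace_def z_add z_scale)

text \<open>This is the long exact sequence of the pair given by multiplication by \<open>z k\<close>: modulo the
  cokernel on the \<open>Suc i\<close>-th homology, a cycle is determined by its image under the
  connecting map.\<close>
lemma hom_le_step:
  assumes reg: "\<And>i' u. i = Suc i' \<Longrightarrow> u \<in> C i' (c - 1) \<Longrightarrow> z k u \<in> N k i' c \<Longrightarrow>
      u \<in> N k i' (c - 1)"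
    and Kle: "finite G2" "card G2 \<le> r2" "K k i (c - 1) \<subseteq> span (G2 \<union> B k i (c - 1))"
    and hle: "hom_le k (Suc i) c r1"
  shows "hom_le (Suc k) (Suc i) c (r1 + r2)"
proof -
  let ?B = "B (Suc k) (Suc i) c"
  obtain G1 where G1: "finite G1" "card G1 \<le> r1"
      "Z k (Suc i) c \<subseteq> span (G1 \<union> B k (Suc i) c)"
    using hle unfolding hom_le_def by auto
  \<comment> \<open>The generators are moved into the kernel because only its elements lift along
    the connecting map; \<open>f\<close> below is such a lift.\<close>
  obtain G where G: "finite G" "G \<subseteq> K k i (c - 1)" "card G \<le> r2"
      "K k i (c - 1) \<subseteq> span (G \<union> B k i (c - 1))"
    using subspace_spanned_modulo[OF Kle(1) subspace_K Kle(3)] Kle(2) by auto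
  have "\<exists>v\<in>C (Suc i) c. d i v - z k g \<in> N k i c" if "g \<in> G" for g
  proof -
    have "z k g \<in> B k i c" using that G(2) unfolding K_def by auto
    then obtain w u where "z k g = d i w + u" "w \<in> C (Suc i) c" "u \<in> N k i c"
      unfolding B_def by auto
    then show ?thesis using subspace_neg[OF subspace_N] by (intro bexI[of _ w]) auto
  qed
  then obtain f where f: "\<And>g. g \<in> G \<Longrightarrow> f g \<in> C (Suc i) c" 
     "\<And>g. g \<in> G \<Longrightarrow> d i (f g) - z k g \<in> N k i c" by metis
  have Bsub: "B k (Suc i) c \<subseteq> ?B" by (rule B_mono)
  have "v \<in> span ((G1 \<union> f ` G) \<union> ?B)" (is "_ \<in> ?S") if v: "v \<in> Z (Suc k) (Suc i) c" for v
  proof -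
    have vC: "v \<in> C (Suc i) c" and dv: "d i v \<in> N (Suc k) i c"
      using v unfolding Z_def by auto
    obtain u where u: "u \<in> C i (c - 1)" "d i v - z k u \<in> N k i c"
      using dv N_Suc by auto
    \<comment> \<open>Applying \<open>d\<close> to the difference puts \<open>z k (d u)\<close> into
      \<open>N\<close>, and regularity of \<open>z k\<close> on the chain module then makes
      \<open>u\<close> a cycle.\<close>
    have uZ: "u \<in> Z k i (c - 1)"
    proof (cases i)
      case 0
      then show ?thesis using u by (auto simp: Z_def)
    next
      case (Suc i')
      have "d i' (d i v - z k u) \<in> N k i' c" using d_N u(2) Suc by auto
      also have "d i' (d i v - z k u) = - z k (d i' u)"
        using d_d[of v i' c] vC Suc by (simp add: d_diff d_z)
      finally have "z k (d i' u) \<in> N k i' c" using subspace_neg[OF subspace_N] by force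
      then have "d i' u \<in> N k i' (c - 1)" using reg[OF Suc] d_closed u(1) Suc by auto
      then show ?thesis using u(1) Suc by (auto simp: Z_def)
    qed
    have "z k u = d i v + (- (d i v - z k u))" by simp
    then have "z k u \<in> B k i c" unfolding B_def
      using vC subspace_neg[OF subspace_N u(2)] by blast
    with uZ have "u \<in> K k i (c - 1)" unfolding K_def by auto
    then have "u \<in> span (G \<union> B k i (c - 1))" using G by auto
    then obtain g0 b where gb: "g0 \<in> span G" "b \<in> B k i (c - 1)" "u = g0 + b"
      unfolding span_Un span_eq_iff[THEN iffD2, OF subspace_B] by auto
    obtain t where t: "g0 = (\<Sum>g\<in>G. scale (t g) g)"
      using gb(1) span_finite[OF G(1)] by auto
    obtain w b' where wb: "b = d i w + b'" "w \<in> C (Suc i) (c - 1)" "b' \<in> N k i (c - 1)"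
      using gb(2) unfolding B_def by auto
    define s where "s = (\<Sum>g\<in>G. scale (t g) (f g))"
    have zb': "z k b' \<in> N k i c"
    proof -
      obtain y where "b' = (\<Sum>l<k. z l (y l))" "\<forall>l<k. y l \<in> C i (c - 2)"
        using wb(3) unfolding N_def by auto
      then have "z k b' = (\<Sum>l<k. z l (z k (y l)))" "\<forall>l<k. z k (y l) \<in> C i (c - 1)"
        using z_closed[of _ i "c - 2" k] by (auto simp: z_sum z_z[of k] )
      then show ?thesis unfolding N_def by (intro CollectI exI[of _ "\<lambda>l. z k (y l)"]) auto
    qed
    have ds: "d i s - z k g0 \<in> N k i c"
    proof -
      have "d i s - z k g0 = (\<Sum>g\<in>G. scale (t g) (d i (f g) - z k g))"
        unfolding s_def t by (simp add: d_sum z_sum d_scale z_scale sum_subtractf scale_right_diff_distrib)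
      then show ?thesis using f(2) subspace_sum[OF subspace_N] subspace_scale[OF subspace_N]
        by (metis (no_types, lifting))
    qed
    \<comment> \<open>Removing the lifts of the generators and the part coming from the boundary in
      \<open>u\<close> leaves a cycle modulo the first \<open>k\<close> operators.\<close>
    define v' where "v' = v - s - z k w"
    have "d i v' = (d i v - z k u) - (d i s - z k g0) + z k b'"
      unfolding v'_def gb(3) wb(1) by (simp add: d_diff z_add d_z)
    then have dv': "d i v' \<in> N k i c"
      using u(2) ds zb' by (simp add: subspace_add subspace_diff subspace_N)
    have sC: "s \<in> C (Suc i) c" unfolding s_def
      by (intro subspace_sum[OF subspace_C] subspace_scale[OF subspace_C] f)
    have zwC: "z k w \<in> C (Suc i) c" using z_closed[OF wb(2)] by simp
    have "v' \<in> C (Suc i) c" unfolding v'_def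
      by (intro subspace_diff[OF subspace_C] vC sC zwC)
    with dv' have "v' \<in> Z k (Suc i) c" unfolding Z_def by auto
    then have 1: "v' \<in> ?S" using G1(3) Bsub span_mono[of "G1 \<union> B k (Suc i) c" "(G1 \<union> f ` G) \<union> ?B"] by blast
    have 2: "s \<in> ?S" unfolding s_def
      by (intro span_sum span_scale span_base) auto
    have "z k w \<in> N (Suc k) (Suc i) c" using z_in_N[of k "Suc k"] wb(2) by auto
    then have "z k w \<in> ?B" by (rule subsetD[OF N_subset_B])
    then have 3: "z k w \<in> ?S" by (intro span_base) auto
    have "v = v' + s + z k w" unfolding v'_def by simp
    with 1 2 3 show ?thesis by (metis span_add)
  qed
  moreover have "card (G1 \<union> f ` G) \<le> r1 + r2"
    using card_Un_le[of G1 "f ` G"] card_image_le[OF G(1), of f] G1 G by linarith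
  ultimately show ?thesis unfolding hom_le_def using G1 G
    by (intro exI[of _ "G1 \<union> f ` G"]) auto
qed

lemma hom_le_of_K_subset_Z:
  assumes "hom_le k i c r"
  obtains G where "finite G" "card G \<le> r" "K k i c \<subseteq> span (G \<union> B k i c)"
  using assms unfolding hom_le_def K_def by blast

lemma hom_le_0_Suc: "hom_le 0 (Suc i) c 0"
  unfolding hom_le_def
proof (intro exI[of _ "{}"] conjI subsetI)
  fix v assume v: "v \<in> Z 0 (Suc i) c"
  then obtain w where "w \<in> C (Suc (Suc i)) c" "d (Suc i) w = v"
    using exact[of v i c] unfolding Z_def N_0 by auto
  then show "v \<in> span ({} \<union> B 0 (Suc i) c)"
    using d_in_B by (intro span_base) auto
qed auto

text \<open>Pascal's rule. During the first \<open>D\<close> steps multiplication is injective on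
  the homology in position 0 (\<open>K0\<close>), and no higher homology arises. Each later step
  adds to position \<open>Suc i\<close> the previous bound in position \<open>i\<close>, one degree
  lower; for \<open>i = 0\<close> this is \<open>q\<close>. Position and degree move together, so
  their difference stays \<open>j\<close>.\<close>

theorem hom_le_chain:
  assumes reg: "\<And>k i c u. k < n \<Longrightarrow> u \<in> C i c \<Longrightarrow> z k u \<in> N k i (c + 1) \<Longrightarrow> u \<in> N k i c"
    and K0: "\<And>k c. k < D \<Longrightarrow> K k 0 c \<subseteq> B k 0 c"
    and q: "\<And>l. D + l < n \<Longrightarrow> hom_le (D + l) 0 j (q l)"
    and "D + k \<le> n"
  shows "hom_le (D + k) (Suc i) (int (Suc i) + j) (\<Sum>l<k. ((k - 1 - l) choose i) * q l)"
proof -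
  have reg': "u \<in> N k i' (c - 1)" if "k < n" "u \<in> C i' (c - 1)" "z k u \<in> N k i' c"
    for k i' c u using reg[of k u i' "c - 1"] that by simp
  have base: "hom_le k (Suc i) c 0" if "k \<le> D" "k \<le> n" for k i c
    using that
  proof (induction k arbitrary: i c)
    case 0
    then show ?case by (simp add: hom_le_0_Suc)
  next
    case (Suc k)
    obtain G where G: "finite G" "card G \<le> 0" "K k i (c - 1) \<subseteq> span (G \<union> B k i (c - 1))"
    proof (cases i)
      case 0
      then show ?thesis using K0[of k "c - 1"] Suc.prems span_superset[of "B k i (c - 1)"]
        by (intro that[of "{}"]) auto
    next
      case (Suc i')
      then show ?thesis using that hom_le_of_K_subset_Z Suc.IH[of i' "c - 1"] Suc.prems
        by (metis Suc_leD)
    qed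
    from hom_le_step[OF _ G, of 0] show ?case using reg' Suc by auto
  qed
  show ?thesis using \<open>D + k \<le> n\<close>
  proof (induction k arbitrary: i)
    case 0
    then show ?case using base[of D i] by auto
  next
    case (Suc k)
    let ?c = "int (Suc i) + j"
    define r where "r = (case i of 0 \<Rightarrow> q k | Suc i' \<Rightarrow> (\<Sum>l<k. ((k - 1 - l) choose i') * q l))"
    have "hom_le (D + k) i (?c - 1) r"
    proof (cases i)
      case 0
      then show ?thesis using q[of k] Suc.prems unfolding r_def by simp
    next
      case (Suc i')
      then show ?thesis using Suc.IH[of i'] Suc.prems unfolding r_def by (simp add: algebra_simps)
    qed
    then obtain G where G: "finite G" "card G \<le> r"
        "K (D + k) i (?c - 1) \<subseteq> span (G \<union> B (D + k) i (?c - 1))"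
      using hom_le_of_K_subset_Z by blast
    have "hom_le (Suc (D + k)) (Suc i) ?c ((\<Sum>l<k. ((k - 1 - l) choose i) * q l) + r)"
    proof (rule hom_le_step[OF _ G])
      show "u \<in> N (D + k) i' (?c - 1)"
        if "i = Suc i'" "u \<in> C i' (?c - 1)" "z (D + k) u \<in> N (D + k) i' ?c" for i' u
        using reg'[of "D + k" u i' ?c] that Suc.prems by auto
    qed (use Suc in auto)
    also have "(\<Sum>l<k. ((k - 1 - l) choose i) * q l) + r = (\<Sum>l<Suc k. ((Suc k - 1 - l) choose i) * q l)"
    proof (cases i)
      case 0
      then show ?thesis by (simp add: r_def)
    next
      case (Suc i')
      have "((Suc k - 1 - l) choose i) = ((k - 1 - l) choose i') + ((k - 1 - l) choose i)" if "l < k" for l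
      proof -
        have "k - l = Suc (k - 1 - l)" using that by simp
        then show ?thesis by (simp add: Suc)
      qed
      then show ?thesis using Suc by (simp add: r_def sum.distrib add_mult_distrib)
    qed
    finally show ?case by simp
  qed
qed

end

section \<open>Homogeneous components in free modules\<close>

definition sscale :: "'k::field \<Rightarrow> (nat \<Rightarrow>\<^sub>0 ('v, 'k) mpoly) \<Rightarrow> (nat \<Rightarrow>\<^sub>0 ('v, 'k) mpoly)" where
  "sscale c = fscale (Poly_Mapping.single 0 c)"

lemma vector_space_sscale: "vector_space sscale"
  by unfold_locales
    (simp_all add: sscale_def fscale_add_right fscale_add_left fscale_fscale single_add mult_single)

text \<open>Subtracting the degree of a basis element can lead to a negative degree, where the
  component is 0.\<close>

definition ghc :: "int \<Rightarrow> ('v, 'k::field) mpoly \<Rightarrow> ('v, 'k) mpoly" where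
  "ghc c f = (if c < 0 then 0 else hcomp (nat c) f)"

lemma lookup_ghc: "Poly_Mapping.lookup (ghc c f) m = (if int (mdeg m) = c then Poly_Mapping.lookup f m else 0)"
  by (auto simp: ghc_def lookup_hcomp)

lemma ghc_0 [simp]: "ghc c 0 = 0" by (simp add: ghc_def)
lemma ghc_add: "ghc c (f + g) = ghc c f + ghc c g" by (simp add: ghc_def hcomp_add)
lemma ghc_mult: "homogeneous 1 g \<Longrightarrow> ghc (c + 1) (g * f) = g * ghc c f"
  using hcomp_mult_homogeneous[of 1 g "nat (c + 1)" f] by (auto simp: ghc_def nat_add_distrib)

definition degree_part :: "('v, 'k::field) graded_free \<Rightarrow> nat \<Rightarrow> int \<Rightarrow> (nat \<Rightarrow>\<^sub>0 ('v, 'k) mpoly) set" where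
  "degree_part R i c = {v \<in> gf_mod R i. \<forall>b. \<forall>m\<in>Poly_Mapping.keys (Poly_Mapping.lookup v b).
     int (mdeg m + gf_deg R i b) = c}"

definition proj :: "('v, 'k::field) graded_free \<Rightarrow> nat \<Rightarrow> int \<Rightarrow> (nat \<Rightarrow>\<^sub>0 ('v, 'k) mpoly) \<Rightarrow> (nat \<Rightarrow>\<^sub>0 ('v, 'k) mpoly)" where
  "proj R i c = pm_ext (\<lambda>b f. Poly_Mapping.single b (ghc (c - int (gf_deg R i b)) f))"

lemma proj_add: "proj R i c (u + v) = proj R i c u + proj R i c v"
  unfolding proj_def by (intro pm_ext_add) (auto simp: ghc_add single_add)

lemma proj_0 [simp]: "proj R i c 0 = 0" by (simp add: proj_def)

lemma lookup_proj: "Poly_Mapping.lookup (proj R i c v) b = ghc (c - int (gf_deg R i b)) (Poly_Mapping.lookup v b)"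
proof -
  have "Poly_Mapping.lookup (proj R i c v) b = (\<Sum>b'\<in>Poly_Mapping.keys v.
      if b' = b then ghc (c - int (gf_deg R i b)) (Poly_Mapping.lookup v b) else 0)"
    unfolding proj_def pm_ext_def lookup_sum by (intro sum.cong refl) (auto simp: lookup_single)
  then show ?thesis by (auto simp: in_keys_iff)
qed

lemma degree_part_iff: "v \<in> degree_part R i c \<longleftrightarrow> v \<in> gf_mod R i \<and> proj R i c v = v"
proof -
  have "(\<forall>m\<in>Poly_Mapping.keys (Poly_Mapping.lookup v b). int (mdeg m + gf_deg R i b) = c) \<longleftrightarrow>
      ghc (c - int (gf_deg R i b)) (Poly_Mapping.lookup v b) = Poly_Mapping.lookup v b" for b
    unfolding poly_mapping_eq_iff fun_eq_iff lookup_ghc Ball_def in_keys_iff by (auto simp: eq_diff_eq)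
  then show ?thesis unfolding degree_part_def poly_mapping_eq_iff[of "proj R i c v"] fun_eq_iff lookup_proj
    by blast
qed

lemma proj_proj: "proj R i c (proj R i c' v) = (if c = c' then proj R i c v else 0)"
  by (rule poly_mapping_eqI) (auto simp: lookup_proj poly_mapping_eq_iff fun_eq_iff lookup_ghc)

lemma proj_degree_part: "v \<in> degree_part R i c' \<Longrightarrow> proj R i c v = (if c = c' then v else 0)"
  using proj_proj[of R i c c' v] by (auto simp: degree_part_iff)

lemma proj_gf_mod: "v \<in> gf_mod R i \<Longrightarrow> proj R i c v \<in> gf_mod R i"
  unfolding gf_mod_def free_mod_def subset_iff in_keys_iff mem_Collect_eq lookup_proj by (metis ghc_0)

lemma proj_in_degree_part: "v \<in> gf_mod R i \<Longrightarrow> proj R i c v \<in> degree_part R i c"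
  by (simp add: degree_part_iff proj_gf_mod proj_proj)

lemma proj_fscale:
  assumes "homogeneous 1 g"
  shows "proj R i (c + 1) (fscale g v) = fscale g (proj R i c v)"
proof (rule poly_mapping_eqI)
  fix b
  have "c + 1 - int (gf_deg R i b) = (c - int (gf_deg R i b)) + 1" by simp
  then show "Poly_Mapping.lookup (proj R i (c + 1) (fscale g v)) b = Poly_Mapping.lookup (fscale g (proj R i c v)) b"
    unfolding lookup_proj lookup_fscale by (simp only: ghc_mult[OF assms])
qed

section \<open>The complex of a graded resolution\<close>

locale graded_resolution =
  fixes I :: "('v, 'k::field) mpoly set" and R :: "('v, 'k) graded_free" and \<theta> :: "nat \<Rightarrow> ('v, 'k) mpoly"
  assumes I: "graded_ideal I" and R: "graded_free_resolution I R" and \<theta>: "homogeneous 1 (\<theta> l)"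
begin

lemma subI: "ideal.subspace I" using I by (simp add: graded_ideal_def)

definition aug :: "(nat \<Rightarrow>\<^sub>0 ('v, 'k) mpoly) \<Rightarrow> ('v, 'k) mpoly" where
  "aug = pm_ext (\<lambda>a f. f * gf_aug R a)"

lemma aug_add: "aug (u + v) = aug u + aug v"
  unfolding aug_def by (intro pm_ext_add) (auto simp: algebra_simps)

lemma aug_0 [simp]: "aug 0 = 0" by (simp add: aug_def)

lemma aug_fscale: "aug (fscale f v) = f * aug v"
proof -
  have "aug (fscale f v) = (\<Sum>a\<in>Poly_Mapping.keys v. f * Poly_Mapping.lookup v a * gf_aug R a)"
    unfolding aug_def by (subst pm_ext_superset[of "Poly_Mapping.keys v"]) (auto simp: lookup_fscale in_keys_iff)
  then show ?thesis by (simp add: aug_def pm_ext_def sum_distrib_left mult.assoc)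
qed

lemma aug_uminus: "aug (- v) = - aug v"
  using aug_add[of v "- v"] by (simp add: eq_neg_iff_add_eq_0 add.commute)

lemma aug_diff: "aug (u - v) = aug u - aug v"
  using aug_add[of u "- v"] by (simp add: aug_uminus)

lemma aug_sum: "aug (sum f A) = (\<Sum>x\<in>A. aug (f x))"
  by (induction A rule: infinite_finite_induct) (auto simp: aug_add)

lemma aug_map_eq: "aug_map I R v = I +>\<^bsub>poly_ring\<^esub> aug v"
  by (simp add: aug_map_def aug_def pm_ext_def)

lemma diff_closed: "a < gf_rank R (Suc i) \<Longrightarrow> gf_diff R i a \<in> gf_mod R i"
  using R unfolding graded_free_resolution_def by blast

lemma diff_degree: "a < gf_rank R (Suc i) \<Longrightarrow> m \<in> Poly_Mapping.keys (Poly_Mapping.lookup (gf_diff R i a) b) \<Longrightarrow>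
    mdeg m + gf_deg R i b = gf_deg R (Suc i) a"
  using R unfolding graded_free_resolution_def by blast

lemma aug_surj: "\<exists>w\<in>gf_mod R 0. aug w - f \<in> I"
proof -
  have "I +>\<^bsub>poly_ring\<^esub> f \<in> aug_map I R ` gf_mod R 0"
    using R unfolding graded_free_resolution_def by (simp add: carrier_Quot_type_ring)
  then show ?thesis unfolding aug_map_eq using coset_eq_iff[OF subI] by auto
qed

lemma exact0: "v \<in> gf_mod R 0 \<Longrightarrow> aug v \<in> I \<longleftrightarrow> v \<in> lin_ext (gf_diff R 0) ` gf_mod R 1"
proof -
  have "{v \<in> gf_mod R 0. aug_map I R v = \<zero>\<^bsub>poly_ring Quot I\<^esub>} = lin_ext (gf_diff R 0) ` gf_mod R 1"
    using R unfolding graded_free_resolution_def by blast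
  then show "v \<in> gf_mod R 0 \<Longrightarrow> aug v \<in> I \<longleftrightarrow> v \<in> lin_ext (gf_diff R 0) ` gf_mod R 1"
    unfolding zero_Quot aug_map_eq coset_eq_self_iff[OF subI] by blast
qed

lemma exact_Suc: "{v \<in> gf_mod R (Suc i). lin_ext (gf_diff R i) v = 0} =
    lin_ext (gf_diff R (Suc i)) ` gf_mod R (Suc (Suc i))"
  using R unfolding graded_free_resolution_def by blast

lemma lin_ext_diff_closed: "v \<in> gf_mod R (Suc i) \<Longrightarrow> lin_ext (gf_diff R i) v \<in> gf_mod R i"
  unfolding gf_mod_def using diff_closed[of _ i] by (intro lin_ext_closed) (auto simp: gf_mod_def)

lemma gf_mod_add: "u \<in> gf_mod R i \<Longrightarrow> v \<in> gf_mod R i \<Longrightarrow> u + v \<in> gf_mod R i"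
  unfolding gf_mod_def by (rule free_mod_add)
lemma gf_mod_fscale: "v \<in> gf_mod R i \<Longrightarrow> fscale f v \<in> gf_mod R i"
  unfolding gf_mod_def by (rule free_mod_fscale)
lemma gf_mod_sum: "(\<And>x. x \<in> A \<Longrightarrow> f x \<in> gf_mod R i) \<Longrightarrow> sum f A \<in> gf_mod R i"
  unfolding gf_mod_def by (rule free_mod_sum)

lemma gf_mod_0: "0 \<in> gf_mod R i" by (simp add: gf_mod_def)
lemma gf_mod_sscale: "v \<in> gf_mod R i \<Longrightarrow> sscale a v \<in> gf_mod R i"
  unfolding sscale_def by (rule gf_mod_fscale)

lemma diff_term_degree:
  assumes "a < gf_rank R (Suc i)"
  shows "lin_ext (gf_diff R i) (Poly_Mapping.single a (Poly_Mapping.single m c)) \<in>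
    degree_part R i (int (mdeg m + gf_deg R (Suc i) a))"
  unfolding degree_part_def
proof (intro CollectI conjI allI ballI)
  show "lin_ext (gf_diff R i) (Poly_Mapping.single a (Poly_Mapping.single m c)) \<in> gf_mod R i"
    using assms by (intro lin_ext_diff_closed) (auto simp: gf_mod_def intro: free_mod_single)
  fix b m' assume "m' \<in> Poly_Mapping.keys (Poly_Mapping.lookup
      (lin_ext (gf_diff R i) (Poly_Mapping.single a (Poly_Mapping.single m c))) b)"
  then have *: "m' \<in> Poly_Mapping.keys (Poly_Mapping.single m c * Poly_Mapping.lookup (gf_diff R i a) b)"
    by (simp add: lin_ext_single lookup_fscale)
  obtain m2 where m2: "m' = m + m2" "m2 \<in> Poly_Mapping.keys (Poly_Mapping.lookup (gf_diff R i a) b)"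
    using subsetD[OF Poly_Mapping.keys_mult *] by (auto split: if_splits)
  then show "int (mdeg m' + gf_deg R i b) = int (mdeg m + gf_deg R (Suc i) a)"
    using diff_degree[OF assms m2(2)] by (simp add: mdeg_add)
qed

lemma diff_proj:
  assumes "v \<in> gf_mod R (Suc i)"
  shows "lin_ext (gf_diff R i) (proj R (Suc i) c v) = proj R i c (lin_ext (gf_diff R i) v)"
  using assms unfolding gf_mod_def
proof (induction v rule: free_mod_term_induct)
  case (add u w)
  then show ?case by (simp add: proj_add lin_ext_add)
next
  case (monomial a m e)
  then have a: "a < gf_rank R (Suc i)" by simp
  let ?v = "Poly_Mapping.single a (Poly_Mapping.single m e)" and ?c = "int (mdeg m + gf_deg R (Suc i) a)"
  have "?v \<in> degree_part R (Suc i) ?c"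
    using a by (auto simp: degree_part_def gf_mod_def lookup_single when_def intro: free_mod_single)
  then show ?case using proj_degree_part[OF diff_term_degree[OF a, of m e], of c]
    by (simp add: proj_degree_part[of ?v] del: of_nat_add)
qed simp

lemma aug_proj:
  assumes "v \<in> gf_mod R 0"
  shows "aug (proj R 0 c v) = ghc c (aug v)"
  using assms unfolding gf_mod_def
proof (induction v rule: free_mod_term_induct)
  case (add u w)
  then show ?case by (simp add: proj_add aug_add ghc_add)
next
  case (monomial a m e)
  then have a: "a < gf_rank R 0" by simp
  let ?v = "Poly_Mapping.single a (Poly_Mapping.single m e)" and ?c = "int (mdeg m + gf_deg R 0 a)"
  have "?v \<in> degree_part R 0 ?c"
    using a by (auto simp: degree_part_def gf_mod_def lookup_single when_def intro: free_mod_single)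
  moreover have "homogeneous (mdeg m + gf_deg R 0 a) (aug ?v)"
    using R a unfolding graded_free_resolution_def aug_def
    by (auto simp: pm_ext_single intro!: homogeneous_mult homogeneous_single)
  ultimately show ?case
    by (auto simp: proj_degree_part[of ?v] ghc_def hcomp_homogeneous simp del: of_nat_add)
qed simp

sublocale vector_space sscale by (rule vector_space_sscale)

lemma z_degree: "u \<in> degree_part R i c \<Longrightarrow> fscale (\<theta> l) u \<in> degree_part R i (c + 1)"
  unfolding degree_part_iff by (simp add: gf_mod_fscale proj_fscale[OF \<theta>])

lemma sscale_proj: "proj R i c (sscale a u) = sscale a (proj R i c u)"
proof (rule poly_mapping_eqI)
  fix b
  show "Poly_Mapping.lookup (proj R i c (sscale a u)) b = Poly_Mapping.lookup (sscale a (proj R i c u)) b"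
    unfolding lookup_proj sscale_def lookup_fscale ghc_def
    using hcomp_mult_homogeneous[of 0 "Poly_Mapping.single 0 a"] homogeneous_single[of 0 a] by auto
qed

lemma subspace_degree_part: "subspace (degree_part R i c)"
  by (rule subspaceI)
    (auto simp: degree_part_iff proj_add gf_mod_add sscale_proj gf_mod_0 gf_mod_sscale)

sublocale graded_complex sscale "degree_part R" "\<lambda>i. lin_ext (gf_diff R i)" "\<lambda>l. fscale (\<theta> l)"
proof (unfold_locales, rule subspace_degree_part)
  fix i u c
  show "u \<in> degree_part R (Suc i) c \<Longrightarrow> lin_ext (gf_diff R i) u \<in> degree_part R i c"
    unfolding degree_part_iff using diff_proj[of u i c] lin_ext_diff_closed[of u i] by auto
  show "u \<in> degree_part R (Suc (Suc i)) c \<Longrightarrow> lin_ext (gf_diff R i) (lin_ext (gf_diff R (Suc i)) u) = 0"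
    using exact_Suc[of i] unfolding degree_part_def by blast
  \<comment> \<open>A preimage given by exactness may be inhomogeneous; its component of degree
    \<open>c\<close> has the same image.\<close>
  show "\<exists>w\<in>degree_part R (Suc (Suc i)) c. lin_ext (gf_diff R (Suc i)) w = u"
    if u: "u \<in> degree_part R (Suc i) c" "lin_ext (gf_diff R i) u = 0"
  proof -
    obtain w where w: "w \<in> gf_mod R (Suc (Suc i))" "u = lin_ext (gf_diff R (Suc i)) w"
      using exact_Suc[of i] u unfolding degree_part_def by blast
    then have "lin_ext (gf_diff R (Suc i)) (proj R (Suc (Suc i)) c w) = u"
      using diff_proj[OF w(1), of c] u(1) by (simp add: degree_part_iff)
    then show ?thesis using proj_in_degree_part[OF w(1)] by blast
  qed
qed (auto simp: lin_ext_add sscale_def lin_ext_fscale fscale_add_right fscale_fscale z_degree mult.commute)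

text \<open>In a free module, membership in the submodule generated by the forms is a condition on
  each coordinate. The coefficients found there are cut down to degree \<open>c - 1\<close>, which
  preserves the sum because \<open>v\<close> is homogeneous.\<close>

lemma N_iff:
  "v \<in> N k i c \<longleftrightarrow> v \<in> degree_part R i c \<and> (\<forall>b. Poly_Mapping.lookup v b \<in> ideal.span (\<theta> ` {..<k}))"
proof
  assume v: "v \<in> N k i c"
  then obtain u where "v = (\<Sum>l<k. fscale (\<theta> l) (u l))" unfolding N_def by auto
  then have "Poly_Mapping.lookup v b = (\<Sum>l<k. Poly_Mapping.lookup (u l) b * \<theta> l)" for b
    by (simp add: lookup_sum lookup_fscale mult.commute)
  then have "Poly_Mapping.lookup v b \<in> ideal.span (\<theta> ` {..<k})" for b
    by (simp only:, intro ideal.span_sum ideal.span_scale ideal.span_base imageI)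
  then show "v \<in> degree_part R i c \<and> (\<forall>b. Poly_Mapping.lookup v b \<in> ideal.span (\<theta> ` {..<k}))"
    using v N_subset_C by blast
next
  assume v: "v \<in> degree_part R i c \<and> (\<forall>b. Poly_Mapping.lookup v b \<in> ideal.span (\<theta> ` {..<k}))"
  have "\<exists>g. Poly_Mapping.lookup v b = (\<Sum>l<k. g l * \<theta> l)" for b
  proof -
    have "Poly_Mapping.lookup v b \<in> ideal.span ({0} \<union> \<theta> ` {..<k})"
      using v ideal.span_mono[of "\<theta> ` {..<k}" "{0} \<union> \<theta> ` {..<k}"] by auto
    then show ?thesis using ideal_span_Un_image[of "{0}" "Poly_Mapping.lookup v b" \<theta> k]
      by (auto simp: ideal.subspace_single_0)
  qed
  then obtain g where g: "\<And>b. Poly_Mapping.lookup v b = (\<Sum>l<k. g b l * \<theta> l)" by metis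
  define w where "w l = (\<Sum>b\<in>Poly_Mapping.keys v. Poly_Mapping.single b (g b l))" for l
  have lw: "Poly_Mapping.lookup (w l) b = (if b \<in> Poly_Mapping.keys v then g b l else 0)" for l b
  proof -
    have "Poly_Mapping.lookup (w l) b = (\<Sum>b'\<in>Poly_Mapping.keys v. if b' = b then g b l else 0)"
      unfolding w_def lookup_sum by (intro sum.cong refl) (auto simp: lookup_single)
    then show ?thesis by auto
  qed
  have vw: "v = (\<Sum>l<k. fscale (\<theta> l) (w l))"
  proof (rule poly_mapping_eqI)
    fix b
    show "Poly_Mapping.lookup v b = Poly_Mapping.lookup (\<Sum>l<k. fscale (\<theta> l) (w l)) b"
    proof (cases "b \<in> Poly_Mapping.keys v")
      case True
      then show ?thesis using g[of b] by (simp add: lookup_sum lookup_fscale lw mult.commute)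
    qed (simp add: lookup_sum lookup_fscale lw in_keys_iff)
  qed
  have wmod: "w l \<in> gf_mod R i" for l
    using v unfolding w_def degree_part_def gf_mod_def
    by (intro free_mod_sum free_mod_single) (auto simp: free_mod_def)
  have "v = proj R i c v" using v by (simp add: degree_part_iff)
  also have "\<dots> = (\<Sum>l<k. proj R i c (fscale (\<theta> l) (w l)))"
  proof -
    have "proj R i c (sum f A) = (\<Sum>x\<in>A. proj R i c (f x))" for f and A :: "nat set"
      by (induction A rule: infinite_finite_induct) (auto simp: proj_add)
    then show ?thesis using vw by simp
  qed
  also have "\<dots> = (\<Sum>l<k. fscale (\<theta> l) (proj R i (c - 1) (w l)))"
    using proj_fscale[OF \<theta>, of R i "c - 1"] by simp
  finally show "v \<in> N k i c" unfolding N_def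
    by (intro CollectI exI[of _ "\<lambda>l. proj R i (c - 1) (w l)"] conjI allI impI proj_in_degree_part[OF wmod])
qed

lemma N_regular:
  assumes reg: "\<And>e f. homogeneous e f \<Longrightarrow> \<theta> k * f \<in> ideal.span (\<theta> ` {..<k}) \<Longrightarrow> f \<in> ideal.span (\<theta> ` {..<k})"
    and u: "u \<in> degree_part R i c" "fscale (\<theta> k) u \<in> N k i (c + 1)"
  shows "u \<in> N k i c"
  unfolding N_iff
proof (intro conjI allI)
  fix b
  have "homogeneous (nat (c - int (gf_deg R i b))) (Poly_Mapping.lookup u b)"
    using u(1) unfolding degree_part_def homogeneous_def by force
  moreover have "\<theta> k * Poly_Mapping.lookup u b \<in> ideal.span (\<theta> ` {..<k})"
    using u(2) unfolding N_iff lookup_fscale by blast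
  ultimately show "Poly_Mapping.lookup u b \<in> ideal.span (\<theta> ` {..<k})" by (rule reg)
qed (rule u(1))

text \<open>The homology in position 0 is \<open>S/(I, \<theta> 0, ..., \<theta> (k - 1))\<close>,
  seen through the augmentation. For the converse the coefficients of the forms are lifted along
  \<open>aug\<close>; the remainder lies in its kernel modulo \<open>I\<close>, hence is a
  boundary.\<close>

lemma B_0_iff:
  "u \<in> B k 0 c \<longleftrightarrow> u \<in> degree_part R 0 c \<and> aug u \<in> ideal.span (I \<union> \<theta> ` {..<k})"
proof
  assume u: "u \<in> B k 0 c"
  then obtain w y where wy: "u = lin_ext (gf_diff R 0) w + y" "w \<in> degree_part R (Suc 0) c" "y \<in> N k 0 c"
    unfolding B_def by auto
  have "aug (lin_ext (gf_diff R 0) w) \<in> I"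
    using exact0[of "lin_ext (gf_diff R 0) w"] wy(2) lin_ext_diff_closed[of w 0] by (auto simp: degree_part_def)
  then have 1: "aug (lin_ext (gf_diff R 0) w) \<in> ideal.span (I \<union> \<theta> ` {..<k})" by (intro ideal.span_base) auto
  obtain g where "y = (\<Sum>l<k. fscale (\<theta> l) (g l))" using wy(3) unfolding N_def by auto
  then have "aug y = (\<Sum>l<k. aug (g l) * \<theta> l)" by (simp add: aug_sum aug_fscale mult.commute)
  then have "aug y \<in> ideal.span (I \<union> \<theta> ` {..<k})"
    by (simp only:, intro ideal.span_sum ideal.span_scale ideal.span_base UnI2 imageI)
  with 1 have "aug u \<in> ideal.span (I \<union> \<theta> ` {..<k})" unfolding wy(1) aug_add by (rule ideal.span_add)
  then show "u \<in> degree_part R 0 c \<and> aug u \<in> ideal.span (I \<union> \<theta> ` {..<k})" using u B_subset_C by blast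
next
  assume u: "u \<in> degree_part R 0 c \<and> aug u \<in> ideal.span (I \<union> \<theta> ` {..<k})"
  then obtain g where g: "aug u - (\<Sum>l<k. g l * \<theta> l) \<in> I" using ideal_span_Un_image[OF subI] by blast
  have "\<forall>l. \<exists>w. w \<in> gf_mod R 0 \<and> aug w - g l \<in> I" using aug_surj by blast
  then obtain w where w: "\<And>l. w l \<in> gf_mod R 0" "\<And>l. aug (w l) - g l \<in> I" by metis
  define y where "y = (\<Sum>l<k. fscale (\<theta> l) (w l))"
  have eq: "aug u - aug y = (aug u - (\<Sum>l<k. g l * \<theta> l)) - (\<Sum>l<k. \<theta> l * (aug (w l) - g l))"
    unfolding y_def by (simp add: aug_sum aug_fscale algebra_simps sum_subtractf)
  have "(\<Sum>l<k. \<theta> l * (aug (w l) - g l)) \<in> I"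
    by (intro ideal.subspace_sum[OF subI] ideal.subspace_scale[OF subI] w)
  then have "aug (u - y) \<in> I" unfolding aug_diff eq by (rule ideal.subspace_diff[OF subI g])
  moreover have ymod: "y \<in> gf_mod R 0" unfolding y_def by (intro gf_mod_sum gf_mod_fscale w)
  moreover have "u - y \<in> gf_mod R 0"
    using ymod u free_mod_add[of u _ "- y"] by (auto simp: degree_part_def gf_mod_def free_mod_def)
  ultimately obtain x where x: "x \<in> gf_mod R 1" "u - y = lin_ext (gf_diff R 0) x"
    using exact0 by blast
  have "u = proj R 0 c (lin_ext (gf_diff R 0) x + y)"
    using u x(2) by (metis degree_part_iff diff_add_cancel)
  also have "\<dots> = lin_ext (gf_diff R 0) (proj R (Suc 0) c x) + proj R 0 c y"
    using x(1) by (simp add: proj_add diff_proj)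
  also have "proj R 0 c y = (\<Sum>l<k. fscale (\<theta> l) (proj R 0 (c - 1) (w l)))"
  proof -
    have "proj R 0 c (sum f A) = (\<Sum>x\<in>A. proj R 0 c (f x))" for f and A :: "nat set"
      by (induction A rule: infinite_finite_induct) (auto simp: proj_add)
    then show ?thesis unfolding y_def using proj_fscale[OF \<theta>, of R 0 "c - 1"] by simp
  qed
  finally show "u \<in> B k 0 c" unfolding B_def N_def
    using proj_in_degree_part[OF w(1)] proj_in_degree_part[of x R "Suc 0" c] x(1)
    by (intro CollectI exI conjI) auto
qed

lemma K_0_subset_B:
  assumes reg: "\<And>e f. homogeneous e f \<Longrightarrow> \<theta> k * f \<in> ideal.span (I \<union> \<theta> ` {..<k}) \<Longrightarrow> f \<in> ideal.span (I \<union> \<theta> ` {..<k})"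
  shows "K k 0 c \<subseteq> B k 0 c"
proof
  fix u assume "u \<in> K k 0 c"
  then have u: "u \<in> degree_part R 0 c" "fscale (\<theta> k) u \<in> B k 0 (c + 1)"
    unfolding K_def Z_def by auto
  have "aug u = ghc c (aug u)" using u(1) aug_proj[of u c] by (simp add: degree_part_iff)
  then have "homogeneous (nat c) (aug u)" by (metis ghc_def homogeneous_0 homogeneous_hcomp)
  moreover have "\<theta> k * aug u \<in> ideal.span (I \<union> \<theta> ` {..<k})"
    using u(2) unfolding B_0_iff aug_fscale by blast
  ultimately show "u \<in> B k 0 c" using u(1) reg unfolding B_0_iff by blast
qed

text \<open>Lifts of \<open>G\<close> along the augmentation, projected to degree \<open>e\<close>,
  generate the homology in position 0. The elements of \<open>G\<close> may be inhomogeneous: only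
  their components of degree \<open>e\<close> enter.\<close>

lemma hom_le_0:
  assumes G: "finite G" "card G \<le> q"
    and span: "\<And>f. homogeneous e f \<Longrightarrow>
      \<exists>t. f - (\<Sum>g\<in>G. Poly_Mapping.single 0 (t g) * g) \<in> ideal.span (I \<union> \<theta> ` {..<k})"
  shows "hom_le k 0 (int e) q"
proof -
  let ?J = "ideal.span (I \<union> \<theta> ` {..<k})"
  \<comment> \<open>The elements of \<open>I\<close> are replaced by their components, so that the
    ideal has homogeneous generators.\<close>
  have J: "f \<in> ?J \<Longrightarrow> hcomp e f \<in> ?J" for f
  proof -
    have "graded_ideal (ideal.span ((\<Union>f\<in>I. range (\<lambda>e. hcomp e f)) \<union> \<theta> ` {..<k}))"
      by (rule graded_ideal_span) (use \<theta> in \<open>auto intro: homogeneous_hcomp\<close>)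
    moreover have "ideal.span ((\<Union>f\<in>I. range (\<lambda>e. hcomp e f)) \<union> \<theta> ` {..<k}) = ?J"
    proof (rule ideal.span_eq[THEN iffD2], intro conjI subsetI)
      fix x assume "x \<in> (\<Union>f\<in>I. range (\<lambda>e. hcomp e f)) \<union> \<theta> ` {..<k}"
      then show "x \<in> ?J" using I by (auto simp: graded_ideal_def intro!: ideal.span_base)
    next
      fix x assume x: "x \<in> I \<union> \<theta> ` {..<k}"
      let ?S = "(\<Union>f\<in>I. range (\<lambda>e. hcomp e f)) \<union> \<theta> ` {..<k}"
      show "x \<in> ideal.span ?S"
      proof (cases "x \<in> I")
        case True
        then have "(\<Sum>e\<in>mdeg ` Poly_Mapping.keys x. hcomp e x) \<in> ideal.span ?S"
          by (intro ideal.span_sum ideal.span_base) auto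
        then show ?thesis using sum_hcomp[of x] by simp
      qed (use x in \<open>auto intro: ideal.span_base\<close>)
    qed
    ultimately show "f \<in> ?J \<Longrightarrow> hcomp e f \<in> ?J" by (simp add: graded_ideal_def)
  qed
  obtain w where w: "\<And>g. w g \<in> gf_mod R 0" "\<And>g. aug (w g) - g \<in> I" using aug_surj by metis
  define y where "y g = proj R 0 (int e) (w g)" for g
  have yC: "y g \<in> degree_part R 0 (int e)" for g unfolding y_def by (rule proj_in_degree_part[OF w(1)])
  have "aug (y g) - hcomp e g \<in> I" for g
  proof -
    have "hcomp e (aug (w g) - g) \<in> I" using w(2) I by (auto simp: graded_ideal_def)
    then show ?thesis unfolding y_def aug_proj[OF w(1)] by (simp add: ghc_def hcomp_diff)
  qed
  then have y: "aug (y g) - hcomp e g \<in> ?J" for g by (auto intro: ideal.span_base)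
  have "Z k 0 (int e) \<subseteq> span (y ` G \<union> B k 0 (int e))"
  proof
    fix u assume "u \<in> Z k 0 (int e)"
    then have u: "u \<in> degree_part R 0 (int e)" by (simp add: Z_def)
    have "aug u = ghc (int e) (aug u)" using u aug_proj[of u "int e"] by (simp add: degree_part_iff)
    then have hom: "homogeneous e (aug u)" "hcomp e (aug u) = aug u"
      by (metis ghc_def homogeneous_hcomp nat_int of_nat_less_0_iff)+
    obtain t where t: "aug u - (\<Sum>g\<in>G. Poly_Mapping.single 0 (t g) * g) \<in> ?J" using span[OF hom(1)] by blast
    define x where "x = (\<Sum>g\<in>G. sscale (t g) (y g))"
    have "hcomp e (aug u - (\<Sum>g\<in>G. Poly_Mapping.single 0 (t g) * g)) =
        aug u - (\<Sum>g\<in>G. Poly_Mapping.single 0 (t g) * hcomp e g)"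
    proof -
      have "hcomp e (Poly_Mapping.single 0 a * f) = Poly_Mapping.single 0 a * hcomp e f"
        for a :: 'k and f :: "('v, 'k) mpoly"
        using hcomp_mult_homogeneous[OF homogeneous_single[of 0 a], of e f] by simp
      then show ?thesis by (simp add: hcomp_diff hcomp_sum hom(2))
    qed
    then have "aug u - (\<Sum>g\<in>G. Poly_Mapping.single 0 (t g) * hcomp e g) \<in> ?J" using J[OF t] by simp
    moreover have "(\<Sum>g\<in>G. Poly_Mapping.single 0 (t g) * (aug (y g) - hcomp e g)) \<in> ?J"
      by (intro ideal.span_sum ideal.span_scale y)
    ultimately have "(aug u - (\<Sum>g\<in>G. Poly_Mapping.single 0 (t g) * hcomp e g)) -
       (\<Sum>g\<in>G. Poly_Mapping.single 0 (t g) * (aug (y g) - hcomp e g)) \<in> ?J" by (rule ideal.span_diff)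
    also have "(aug u - (\<Sum>g\<in>G. Poly_Mapping.single 0 (t g) * hcomp e g)) -
       (\<Sum>g\<in>G. Poly_Mapping.single 0 (t g) * (aug (y g) - hcomp e g)) = aug (u - x)"
      unfolding x_def by (simp add: aug_diff aug_sum sscale_def aug_fscale right_diff_distrib sum_subtractf)
    finally have "aug (u - x) \<in> ?J" .
    moreover have "u - x \<in> degree_part R 0 (int e)" unfolding x_def
      by (intro subspace_diff[OF subspace_degree_part] u subspace_sum[OF subspace_degree_part]
          subspace_scale[OF subspace_degree_part] yC)
    ultimately have "u - x \<in> B k 0 (int e)" unfolding B_0_iff by blast
    then have "u - x \<in> span (y ` G \<union> B k 0 (int e))" by (intro span_base) auto
    moreover have "x \<in> span (y ` G \<union> B k 0 (int e))" unfolding x_def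
      by (intro span_sum span_scale span_base) auto
    ultimately have "(u - x) + x \<in> span (y ` G \<union> B k 0 (int e))" by (rule span_add)
    then show "u \<in> span (y ` G \<union> B k 0 (int e))" by simp
  qed
  then show ?thesis unfolding hom_le_def using G card_image_le[OF G(1), of y]
    by (intro exI[of _ "y ` G"]) auto
qed

end

section \<open>Regular sequences in Cohen--Macaulay complexes\<close>

definition qcos :: "'a::comm_ring_1 set \<Rightarrow> 'a \<Rightarrow> 'a set" where
  "qcos I x = I +>\<^bsub>ring_of_type_algebra\<^esub> x"

abbreviation qring :: "'a::comm_ring_1 set \<Rightarrow> 'a set ring" where
  "qring I \<equiv> ring_of_type_algebra Quot I"

context
  fixes I :: "'a::comm_ring_1 set"
  assumes I: "ideal.subspace I"
begin

lemma ideal_I: "ideal I (ring_of_type_algebra :: 'a ring)"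
  using I by (simp add: ideal_type_ring_iff)

lemma ring_type: "ring (ring_of_type_algebra :: 'a ring)"
  using cring_type_ring by (rule cring.axioms)

lemma cring_qring: "cring (qring I)"
  by (rule ideal.quotient_is_cring[OF ideal_I cring_type_ring])

lemma qcos_hom: "qcos I \<in> ring_hom ring_of_type_algebra (qring I)"
  using ideal.rcos_ring_hom[OF ideal_I] by (simp add: qcos_def[abs_def])

lemma qcos_mult: "qcos I x \<otimes>\<^bsub>qring I\<^esub> qcos I y = qcos I (x * y)"
  using ring_hom_mult[OF qcos_hom, of x y] by simp

lemma carrier_qring: "carrier (qring I) = range (qcos I)"
  by (simp add: carrier_Quot_type_ring qcos_def)

lemma ideal_image:
  assumes "ideal.subspace J"
  shows "ideal (qcos I ` J) (qring I)"
  using ring.ring_ideal_imp_quot_ideal[OF ring_type ideal_I, of J] assms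
  by (simp add: ideal_type_ring_iff qcos_def[abs_def])

lemma ideal_vimage:
  assumes "ideal K (qring I)"
  shows "ideal.subspace {x. qcos I x \<in> K}"
proof -
  have "ring_hom_ring ring_of_type_algebra (qring I) (qcos I)"
    using ideal.rcos_ring_hom_ring[OF ideal_I] by (simp add: qcos_def[abs_def])
  from ring_hom_ring.ideal_vimage[OF this assms] show ?thesis by (simp add: ideal_type_ring_iff)
qed

lemma qcos_mem_image:
  assumes "ideal.subspace J" "I \<subseteq> J"
  shows "qcos I x \<in> qcos I ` J \<longleftrightarrow> x \<in> J"
proof
  assume "qcos I x \<in> qcos I ` J"
  then obtain y where "y \<in> J" "qcos I x = qcos I y" by auto
  then have "x - y \<in> J" using coset_eq_iff[OF I] assms(2) unfolding qcos_def by auto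
  then have "(x - y) + y \<in> J" using \<open>y \<in> J\<close> by (rule ideal.subspace_add[OF assms(1)])
  then show "x \<in> J" by simp
qed auto

lemma genideal_image: "Idl\<^bsub>qring I\<^esub> (qcos I ` T) = qcos I ` ideal.span (I \<union> T)"
proof
  interpret Q: cring "qring I" by (rule cring_qring)
  have "T \<subseteq> ideal.span (I \<union> T)" by (auto intro: ideal.span_base)
  then show "Idl\<^bsub>qring I\<^esub> (qcos I ` T) \<subseteq> qcos I ` ideal.span (I \<union> T)"
    by (intro Q.genideal_minimal ideal_image image_mono) auto
  have sub: "qcos I ` T \<subseteq> carrier (qring I)" by (auto simp: carrier_qring)
  have id: "ideal (Idl\<^bsub>qring I\<^esub> (qcos I ` T)) (qring I)" by (rule Q.genideal_ideal[OF sub])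
  have "qcos I x = \<zero>\<^bsub>qring I\<^esub>" if "x \<in> I" for x
    using that coset_eq_self_iff[OF I] by (simp add: zero_Quot qcos_def)
  then have "I \<union> T \<subseteq> {x. qcos I x \<in> Idl\<^bsub>qring I\<^esub> (qcos I ` T)}"
    using Q.genideal_self[OF sub] additive_subgroup.zero_closed[OF ideal.axioms(1)[OF id]] by auto
  from ideal.span_minimal[OF this ideal_vimage[OF id]]
  show "qcos I ` ideal.span (I \<union> T) \<subseteq> Idl\<^bsub>qring I\<^esub> (qcos I ` T)" by auto
qed

lemma primeideal_image:
  assumes "ideal.subspace J" "I \<subseteq> J" "1 \<notin> J" "\<And>a b. a * b \<in> J \<Longrightarrow> a \<in> J \<or> b \<in> J"
  shows "primeideal (qcos I ` J) (qring I)"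
proof (rule primeidealI[OF ideal_image[OF assms(1)] cring_qring])
  have "qcos I 1 \<notin> qcos I ` J" using qcos_mem_image[OF assms(1,2)] assms(3) by simp
  then show "carrier (qring I) \<noteq> qcos I ` J" by (auto simp: carrier_qring)
next
  fix a b assume "a \<in> carrier (qring I)" "b \<in> carrier (qring I)" "a \<otimes>\<^bsub>qring I\<^esub> b \<in> qcos I ` J"
  then obtain x y where xy: "a = qcos I x" "b = qcos I y" "qcos I (x * y) \<in> qcos I ` J"
    by (auto simp: carrier_qring qcos_mult)
  then have "x * y \<in> J" by (simp only: qcos_mem_image[OF assms(1,2)])
  then show "a \<in> qcos I ` J \<or> b \<in> qcos I ` J" using assms(4)[of x y] xy by blast
qed

lemma maximalideal_image:
  assumes J: "ideal.subspace J" "I \<subseteq> J" "1 \<notin> J"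
    and max: "\<And>x. x \<notin> J \<Longrightarrow> \<exists>y. 1 - y * x \<in> J"
  shows "maximalideal (qcos I ` J) (qring I)"
proof (rule maximalidealI[OF ideal_image[OF J(1)]])
  have "qcos I 1 \<notin> qcos I ` J" using qcos_mem_image[OF J(1,2)] J(3) by simp
  then show "carrier (qring I) \<noteq> qcos I ` J" by (auto simp: carrier_qring)
next
  fix K assume K: "ideal K (qring I)" "qcos I ` J \<subseteq> K" "K \<subseteq> carrier (qring I)"
  let ?K = "{x. qcos I x \<in> K}"
  have sub: "ideal.subspace ?K" by (rule ideal_vimage[OF K(1)])
  show "K = qcos I ` J \<or> K = carrier (qring I)"
  proof (cases "?K \<subseteq> J")
    case True
    have "K \<subseteq> qcos I ` J"
    proof
      fix z assume z: "z \<in> K"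
      then obtain x where "z = qcos I x" using K(3) carrier_qring by blast
      then show "z \<in> qcos I ` J" using z True by blast
    qed
    then show ?thesis using K(2) by blast
  next
    case False
    then obtain x where x: "qcos I x \<in> K" "x \<notin> J" by auto
    obtain y where "1 - y * x \<in> J" using max x(2) by blast
    then have "1 - y * x \<in> ?K" using K(2) by auto
    moreover have "y * x \<in> ?K" using x(1) by (intro ideal.subspace_scale[OF sub]) auto
    ultimately have "(1 - y * x) + y * x \<in> ?K" by (rule ideal.subspace_add[OF sub])
    then have "1 \<in> ?K" by simp
    then have "z * 1 \<in> ?K" for z by (rule ideal.subspace_scale[OF sub])
    then have "carrier (qring I) \<subseteq> K" by (auto simp: carrier_qring)
    then show ?thesis using K(3) by blast
  qed
qed

lemma ideal_regular_of_regular_sequence: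
  assumes "regular_sequence (qring I) (map (qcos I) ys)"
  shows "ideal_regular I ys"
  unfolding ideal_regular_def
proof (intro allI impI)
  fix s a assume s: "s < length ys" and *: "ys ! s * a \<in> ideal.span (I \<union> set (take s ys))"
  have Idl: "Idl\<^bsub>qring I\<^esub> (set (take s (map (qcos I) ys))) = qcos I ` ideal.span (I \<union> set (take s ys))"
    by (simp add: take_map genideal_image)
  have "I \<subseteq> ideal.span (I \<union> set (take s ys))" by (auto intro: ideal.span_base)
  note mem = qcos_mem_image[OF ideal.subspace_span this]
  have "map (qcos I) ys ! s \<otimes>\<^bsub>qring I\<^esub> qcos I a \<in> Idl\<^bsub>qring I\<^esub> (set (take s (map (qcos I) ys)))"
    using s * by (simp add: Idl mem qcos_mult)
  then have "qcos I a \<in> Idl\<^bsub>qring I\<^esub> (set (take s (map (qcos I) ys)))"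
    using assms s unfolding regular_sequence_def by (auto simp: carrier_qring)
  then show "a \<in> ideal.span (I \<union> set (take s ys))" by (simp add: Idl mem)
qed

end

lemma ideal_regular_take: "ideal_regular J ys \<Longrightarrow> ideal_regular J (take k ys)"
  unfolding ideal_regular_def by (auto simp: min_def)

section \<open>Prime ideals generated by variables\<close>

text \<open>The ideal generated by the variables in \<open>W\<close>, described by supports so that
  membership is decided one monomial at a time.\<close>

definition var_prime :: "'v set \<Rightarrow> ('v, 'k::field) mpoly set" where
  "var_prime W = {f. \<forall>m\<in>Poly_Mapping.keys f. Poly_Mapping.keys m \<inter> W \<noteq> {}}"

lemma subspace_var_prime: "ideal.subspace (var_prime W)"
proof (rule ideal.subspaceI)
  fix x y :: "('a, 'b) mpoly" assume "x \<in> var_prime W" "y \<in> var_prime W"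
  then show "x + y \<in> var_prime W" using Poly_Mapping.keys_add[of x y] unfolding var_prime_def by blast
next
  fix c x :: "('a, 'b) mpoly" assume x: "x \<in> var_prime W"
  have "Poly_Mapping.keys m \<inter> W \<noteq> {}" if m: "m \<in> Poly_Mapping.keys (c * x)" for m
  proof -
    obtain a b where "m = a + b" "b \<in> Poly_Mapping.keys x"
      using subsetD[OF Poly_Mapping.keys_mult m] by auto
    then show ?thesis using x by (auto simp: var_prime_def keys_add_nat)
  qed
  then show "c * x \<in> var_prime W" by (simp add: var_prime_def)
qed (simp add: var_prime_def)

lemma lookup_mult_sum:
  fixes f g :: "('v, 'k::field) mpoly"
  shows "Poly_Mapping.lookup (f * g) m =
    (\<Sum>a\<in>Poly_Mapping.keys f. \<Sum>b\<in>Poly_Mapping.keys g.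
       if a + b = m then Poly_Mapping.lookup f a * Poly_Mapping.lookup g b else 0)"
proof -
  have "f * g = (\<Sum>a\<in>Poly_Mapping.keys f. Poly_Mapping.single a (Poly_Mapping.lookup f a)) *
      (\<Sum>b\<in>Poly_Mapping.keys g. Poly_Mapping.single b (Poly_Mapping.lookup g b))"
    by (simp only: sum_single_lookup)
  also have "\<dots> = (\<Sum>a\<in>Poly_Mapping.keys f. \<Sum>b\<in>Poly_Mapping.keys g.
      Poly_Mapping.single (a + b) (Poly_Mapping.lookup f a * Poly_Mapping.lookup g b))"
    by (simp add: sum_product mult_single)
  finally show ?thesis by (simp add: lookup_sum lookup_single when_def)
qed

text \<open>The leading monomials with respect to a monomial order, among the monomials that avoid
  the given variables, multiply to a monomial that cannot cancel.\<close>
lemma var_prime_prime: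
  fixes f g :: "('v::finite, 'k::field) mpoly"
  assumes "f * g \<in> var_prime W"
  shows "f \<in> var_prime W \<or> g \<in> var_prime W"
proof (rule ccontr)
  assume neg: "\<not> ?thesis"
  obtain enc :: "'v \<Rightarrow> nat" where enc: "inj enc"
    using finite_imp_inj_to_nat_seg[of "UNIV :: 'v set"] by auto
  define \<phi> :: "'v monom \<Rightarrow> nat monom" where "\<phi> m = (\<Sum>v\<in>UNIV. Poly_Mapping.single (enc v) (Poly_Mapping.lookup m v))" for m
  have \<phi>_add: "\<phi> (a + b) = \<phi> a + \<phi> b" for a b by (simp add: \<phi>_def lookup_add single_add sum.distrib)
  have \<phi>_lookup: "Poly_Mapping.lookup (\<phi> m) (enc v) = Poly_Mapping.lookup m v" for m v
  proof -
    have "Poly_Mapping.lookup (\<phi> m) (enc v) = (\<Sum>v'\<in>UNIV. if v' = v then Poly_Mapping.lookup m v else 0)"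
      unfolding \<phi>_def lookup_sum using enc by (intro sum.cong refl) (auto simp: lookup_single when_def inj_eq)
    then show ?thesis by simp
  qed
  have \<phi>_inj: "\<phi> a = \<phi> b \<Longrightarrow> a = b" for a b by (metis \<phi>_lookup poly_mapping_eqI)
  define A where "A h = {m \<in> Poly_Mapping.keys h. Poly_Mapping.keys m \<inter> W = {}}" for h :: "('v, 'k) mpoly"
  have finA: "finite (A h)" for h by (simp add: A_def)
  have lead: "\<exists>m\<in>A h. \<forall>m'\<in>A h. \<phi> m' \<le> \<phi> m" if "h \<notin> var_prime W" for h
  proof -
    have "A h \<noteq> {}" using that by (auto simp: A_def var_prime_def)
    then have "Max (\<phi> ` A h) \<in> \<phi> ` A h" using finA by (intro Max_in) auto
    then show ?thesis using finA by (metis (no_types, lifting) Max_ge finite_imageI imageE imageI)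
  qed
  obtain mf where mf: "mf \<in> A f" "\<And>m. m \<in> A f \<Longrightarrow> \<phi> m \<le> \<phi> mf"
    using lead[of f] neg by auto
  obtain mg where mg: "mg \<in> A g" "\<And>m. m \<in> A g \<Longrightarrow> \<phi> m \<le> \<phi> mg"
    using lead[of g] neg by auto
  have uniq: "a = mf \<and> b = mg" if "a \<in> Poly_Mapping.keys f" "b \<in> Poly_Mapping.keys g" "a + b = mf + mg" for a b
  proof -
    have "Poly_Mapping.keys (a + b) \<inter> W = {}" using mf mg unfolding that(3) by (auto simp: A_def keys_add_nat)
    then have "Poly_Mapping.keys a \<inter> W = {}" "Poly_Mapping.keys b \<inter> W = {}"
      unfolding keys_add_nat by auto
    then have "a \<in> A f" "b \<in> A g" using that by (auto simp: A_def)
    then have "\<phi> a \<le> \<phi> mf" "\<phi> b \<le> \<phi> mg" using mf mg by auto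
    moreover have "\<phi> a + \<phi> b = \<phi> mf + \<phi> mg" using that(3) by (metis \<phi>_add)
    ultimately have "\<phi> a = \<phi> mf"
      by (metis add_left_mono add_le_cancel_right antisym)
    then have "a = mf" by (rule \<phi>_inj)
    then show ?thesis using that(3) by simp
  qed
  have "Poly_Mapping.lookup (f * g) (mf + mg) =
      (\<Sum>a\<in>Poly_Mapping.keys f. \<Sum>b\<in>Poly_Mapping.keys g.
         if a = mf \<and> b = mg then Poly_Mapping.lookup f mf * Poly_Mapping.lookup g mg else 0)"
    unfolding lookup_mult_sum using uniq by (intro sum.cong refl) auto
  also have "\<dots> = (\<Sum>a\<in>Poly_Mapping.keys f. if a = mf then Poly_Mapping.lookup f mf * Poly_Mapping.lookup g mg else 0)"
    using mg by (intro sum.cong refl) (auto simp: A_def)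
  also have "\<dots> = Poly_Mapping.lookup f mf * Poly_Mapping.lookup g mg" using mf by (simp add: A_def)
  also have "\<dots> \<noteq> 0" using mf mg by (simp add: A_def in_keys_iff)
  finally have "mf + mg \<in> Poly_Mapping.keys (f * g)" by (simp add: in_keys_iff)
  then have "Poly_Mapping.keys (mf + mg) \<inter> W \<noteq> {}" using assms unfolding var_prime_def by blast
  then show False using mf mg by (auto simp: A_def keys_add_nat)
qed

lemma one_notin_var_prime: "1 \<notin> var_prime W" by (simp add: var_prime_def)

lemma var_prime_mono: "W \<subseteq> W' \<Longrightarrow> var_prime W \<subseteq> var_prime W'"
  unfolding var_prime_def by blast

lemma pvar_in_var_prime: "pvar v \<in> var_prime W \<longleftrightarrow> v \<in> W"
  by (simp add: var_prime_def pvar_def mvar_def)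

text \<open>The \<open>{0}\<close> is the zero ideal in the role of \<open>J\<close>, matching the
  form of \<open>ideal_regular\<close>.\<close>

lemma ideal_span_pvar: "ideal.span ({0} \<union> pvar ` W) = (var_prime W :: ('v, 'k::field) mpoly set)"
proof
  show "ideal.span ({0} \<union> pvar ` W) \<subseteq> (var_prime W :: ('v, 'k) mpoly set)"
    by (intro ideal.span_minimal subspace_var_prime)
      (auto simp: pvar_in_var_prime ideal.subspace_0[OF subspace_var_prime])
  show "(var_prime W :: ('v, 'k) mpoly set) \<subseteq> ideal.span ({0} \<union> pvar ` W)"
  proof
    fix f :: "('v, 'k) mpoly" assume f: "f \<in> var_prime W"
    have "Poly_Mapping.single m (Poly_Mapping.lookup f m) \<in> ideal.span ({0} \<union> pvar ` W)" if m: "m \<in> Poly_Mapping.keys f" for m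
    proof -
      obtain v where v: "v \<in> Poly_Mapping.keys m" "v \<in> W" using f m unfolding var_prime_def by blast
      have "sqmon {v} = mvar v" by (simp add: sqmon_def)
      then have "m = (m - mvar v) + mvar v" using sqmon_le_split[of "{v}" m] v by simp
      then have eq: "Poly_Mapping.single m (Poly_Mapping.lookup f m) =
          Poly_Mapping.single (m - mvar v) (Poly_Mapping.lookup f m) * pvar v"
        by (simp add: pvar_def mult_single)
      have "pvar v \<in> ideal.span ({0} \<union> pvar ` W)" using v by (intro ideal.span_base) auto
      then show ?thesis unfolding eq by (rule ideal.span_scale)
    qed
    then have "(\<Sum>m\<in>Poly_Mapping.keys f. Poly_Mapping.single m (Poly_Mapping.lookup f m)) \<in> ideal.span ({0} \<union> pvar ` W)"
      by (rule ideal.span_sum)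
    then show "f \<in> ideal.span ({0} \<union> pvar ` W)" by (simp add: sum_single_lookup)
  qed
qed

lemma var_prime_UNIV: "f \<in> var_prime UNIV \<longleftrightarrow> Poly_Mapping.lookup f 0 = 0"
  by (auto simp: var_prime_def in_keys_iff[of 0, symmetric]) (metis in_keys_iff keys_eq_empty)

lemma SR_ideal_subset_var_prime:
  assumes "simplicial_complex \<Delta>" "F \<in> \<Delta>" "- F \<subseteq> W"
  shows "(SR_ideal \<Delta> :: ('v::finite, 'k::field) mpoly set) \<subseteq> var_prime W"
proof
  fix f :: "('v, 'k) mpoly" assume f: "f \<in> SR_ideal \<Delta>"
  have "Poly_Mapping.keys m \<inter> W \<noteq> {}" if m: "m \<in> Poly_Mapping.keys f" for m
  proof -
    obtain G where "G \<notin> \<Delta>" "G \<subseteq> Poly_Mapping.keys m" using keys_SR_ideal[OF f m] by blast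
    moreover have "\<not> G \<subseteq> F" using assms(1,2) \<open>G \<notin> \<Delta>\<close> unfolding simplicial_complex_def by blast
    ultimately show ?thesis using assms(3) by blast
  qed
  then show "f \<in> var_prime W" by (simp add: var_prime_def)
qed

text \<open>Adding the vertices of \<open>F\<close> one at a time to its complement gives a chain of
  primes generated by variables, above the Stanley-Reisner ideal and ending at the irrelevant
  maximal ideal. Its height is thus at least \<open>card F\<close>, and so is its depth.\<close>

theorem cohen_macaulay_regular_sequence:
  fixes \<Delta> :: "('v::finite) set set"
  assumes \<Delta>: "simplicial_complex \<Delta>" "cohen_macaulay_complex TYPE('k::field) \<Delta>" "F \<in> \<Delta>"
  obtains ys :: "('v, 'k::field) mpoly list" where "length ys = card F" "ideal_regular (SR_ideal \<Delta>) ys"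
    "\<And>y. y \<in> set ys \<Longrightarrow> Poly_Mapping.lookup y 0 = 0"
proof -
  let ?I = "SR_ideal \<Delta> :: ('v, 'k) mpoly set" and ?d = "card F"
  let ?Q = "qring ?I" and ?q = "qcos ?I"
  note subI = subspace_SR_ideal[of \<Delta>, where ?'k = 'k]
  let ?P = "?q ` var_prime UNIV"
  have incl: "?I \<subseteq> var_prime W" if "- F \<subseteq> W" for W using SR_ideal_subset_var_prime[OF \<Delta>(1,3) that] .
  note mem = qcos_mem_image[OF subI subspace_var_prime]
  have max: "maximalideal ?P ?Q"
  proof (rule maximalideal_image[OF subI subspace_var_prime _ one_notin_var_prime])
    show "?I \<subseteq> var_prime UNIV" by (rule incl) simp
    fix x :: "('v, 'k) mpoly" assume "x \<notin> var_prime UNIV"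
    then have c: "Poly_Mapping.lookup x 0 \<noteq> 0" by (simp add: var_prime_UNIV)
    have "Poly_Mapping.lookup (Poly_Mapping.single 0 c * x) 0 = c * Poly_Mapping.lookup x 0" for c
      by (simp add: mult_map_scale_conv_mult[symmetric] Poly_Mapping.map.rep_eq when_def)
    then have "1 - Poly_Mapping.single 0 (inverse (Poly_Mapping.lookup x 0)) * x \<in> var_prime UNIV"
      using c by (simp add: var_prime_UNIV lookup_minus)
    then show "\<exists>y. 1 - y * x \<in> var_prime UNIV" by blast
  qed
  obtain xs where xs: "set xs = F" "distinct xs" using finite_distinct_list[of F] by auto
  then have len: "length xs = ?d" using distinct_card by fastforce
  define W where "W t = - F \<union> set (take t xs)" for t
  have "enat ?d \<le> prime_height ?Q ?P"
  proof -
    let ?C = "\<lambda>t. ?q ` var_prime (W t)"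
    have "primeideal (?C t) ?Q" for t
    proof (rule primeideal_image[OF subI subspace_var_prime _ one_notin_var_prime])
      show "?I \<subseteq> var_prime (W t)" by (rule incl) (simp add: W_def)
    qed (rule var_prime_prime)
    moreover have "?C t \<subset> ?C (Suc t)" if t: "t < ?d" for t
    proof -
      have "W t \<subseteq> W (Suc t)" unfolding W_def using set_take_subset_set_take[of t "Suc t" xs] by auto
      then have "?C t \<subseteq> ?C (Suc t)" by (intro image_mono var_prime_mono)
      moreover have "xs ! t \<in> W (Suc t)" using t len by (auto simp: W_def take_Suc_conv_app_nth)
      then have "?q (pvar (xs ! t)) \<in> ?C (Suc t)" by (auto simp: pvar_in_var_prime)
      moreover have "xs ! t \<notin> W t"
        using t len xs nth_mem[of t xs] by (auto simp: W_def in_set_conv_nth nth_eq_iff_index_eq)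
      then have "?q (pvar (xs ! t)) \<notin> ?C t" 
        using mem[of "W t"] incl[of "W t"] by (auto simp: pvar_in_var_prime W_def)
      ultimately show ?thesis by blast
    qed
    moreover have "?C ?d = ?P" using xs len by (simp add: W_def Compl_partition)
    ultimately show ?thesis unfolding prime_height_def
      by (intro Sup_upper CollectI exI[of _ ?d] conjI exI[of _ ?C]) auto
  qed
  moreover have "ideal_depth ?Q ?P = prime_height ?Q ?P"
    using \<Delta>(2) max unfolding cohen_macaulay_complex_def cohen_macaulay_ring_def SR_ring_def by blast
  ultimately have depth: "enat ?d \<le> ideal_depth ?Q ?P" by simp
  \<comment> \<open>Depth is a supremum, possibly infinite; if all lengths were below
    \<open>?d\<close>, it would be at most \<open>?d - 1\<close>. The case \<open>?d = 0\<close>,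
    where this subtraction truncates, is kept apart.\<close>
  have "\<exists>zs. set zs \<subseteq> ?P \<and> regular_sequence ?Q zs \<and> ?d \<le> length zs \<or> ?d = 0"
  proof (rule ccontr)
    assume neg: "\<not> ?thesis"
    have "ideal_depth ?Q ?P \<le> enat (?d - 1)"
      unfolding ideal_depth_def using neg by (intro Sup_least) force
    then have "enat ?d \<le> enat (?d - 1)" using depth by (rule order_trans[rotated])
    then have "?d \<le> ?d - 1" by (simp only: enat_ord_simps)
    moreover have "?d \<noteq> 0" using neg by blast
    ultimately show False by linarith
  qed
  then consider zs where "set zs \<subseteq> ?P" "regular_sequence ?Q zs" "?d \<le> length zs" | "?d = 0"
    by (elim exE disjE conjE) (simp_all only:)
  then show ?thesis
  proof cases
    case 1
    have "\<exists>y. y \<in> var_prime UNIV \<and> z = ?q y" if "z \<in> set zs" for z using 1(1) that by auto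
    then obtain f where f: "\<And>z. z \<in> set zs \<Longrightarrow> f z \<in> var_prime UNIV" "\<And>z. z \<in> set zs \<Longrightarrow> ?q (f z) = z"
      by metis
    have "map ?q (map f zs) = zs" using f(2) by (simp add: map_idI)
    then have "ideal_regular ?I (map f zs)" using 1(2) by (intro ideal_regular_of_regular_sequence[OF subI]) simp
    then have "ideal_regular ?I (take ?d (map f zs))" by (rule ideal_regular_take)
    moreover have "y \<in> set (take ?d (map f zs)) \<Longrightarrow> Poly_Mapping.lookup y 0 = 0" for y
      using f(1) set_take_subset[of ?d "map f zs"] by (auto simp: var_prime_UNIV)
    ultimately show ?thesis using 1(3) by (intro that[of "take ?d (map f zs)"]) auto
  next
    case 2
    then show ?thesis by (intro that[of "[]"]) (auto simp: ideal_regular_def)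
  qed
qed

section \<open>Tor as the end of the sequence\<close>

definition const_part :: "(nat \<Rightarrow>\<^sub>0 ('v, 'k::field) mpoly) \<Rightarrow> (nat \<Rightarrow>\<^sub>0 'k)" where
  "const_part v = Poly_Mapping.map (\<lambda>f. Poly_Mapping.lookup f 0) v"

definition const_vec :: "(nat \<Rightarrow>\<^sub>0 'k::field) \<Rightarrow> (nat \<Rightarrow>\<^sub>0 ('v, 'k) mpoly)" where
  "const_vec w = Poly_Mapping.map (Poly_Mapping.single 0) w"

lemma lookup_const_part: "Poly_Mapping.lookup (const_part v) b = Poly_Mapping.lookup (Poly_Mapping.lookup v b) 0"
  by (simp add: const_part_def Poly_Mapping.map.rep_eq when_def)

lemma lookup_const_vec: "Poly_Mapping.lookup (const_vec w) b = Poly_Mapping.single 0 (Poly_Mapping.lookup w b)"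
  by (simp add: const_vec_def Poly_Mapping.map.rep_eq when_def)

lemma const_part_vec [simp]: "const_part (const_vec w) = w"
  by (rule poly_mapping_eqI) (simp add: lookup_const_part lookup_const_vec)

lemma add_monom_eq_0_iff: "a + b = (0 :: 'v monom) \<longleftrightarrow> a = 0 \<and> b = 0"
  using mdeg_add[of a b] by (auto simp: mdeg_eq_0_iff[symmetric])

lemma lookup_mult_0: "Poly_Mapping.lookup (f * g :: ('v, 'k::field) mpoly) 0 = Poly_Mapping.lookup f 0 * Poly_Mapping.lookup g 0"
proof -
  have "Poly_Mapping.lookup (f * g) 0 =
      (\<Sum>a\<in>Poly_Mapping.keys f. \<Sum>b\<in>Poly_Mapping.keys g.
         if b = 0 then (if a = 0 then Poly_Mapping.lookup f 0 * Poly_Mapping.lookup g 0 else 0) else 0)"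
    unfolding lookup_mult_sum by (intro sum.cong refl) (auto simp: add_monom_eq_0_iff)
  then show ?thesis by (cases "Poly_Mapping.lookup g 0 = 0") (auto simp: in_keys_iff)
qed

lemma const_part_add: "const_part (u + v) = const_part u + const_part v"
  by (rule poly_mapping_eqI) (simp add: lookup_const_part lookup_add)

lemma const_part_0 [simp]: "const_part 0 = 0"
  by (rule poly_mapping_eqI) (simp add: lookup_const_part)

lemma const_part_sum: "const_part (sum f A) = (\<Sum>x\<in>A. const_part (f x))"
  by (induction A rule: infinite_finite_induct) (auto simp: const_part_add)

lemma const_part_fscale: "const_part (fscale f v) = fscale (Poly_Mapping.lookup f 0) (const_part v)"
  by (rule poly_mapping_eqI) (simp add: lookup_const_part lookup_fscale lookup_mult_0)

lemma const_part_lin_ext: "const_part (lin_ext D v) = lin_ext (\<lambda>a. const_part (D a)) (const_part v)"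
proof -
  have "Poly_Mapping.keys (const_part v) \<subseteq> Poly_Mapping.keys v"
    by (auto simp: in_keys_iff lookup_const_part)
  then show ?thesis
    by (subst lin_ext_superset[of "Poly_Mapping.keys v"])
      (simp_all add: lin_ext_def const_part_sum const_part_fscale lookup_const_part)
qed

lemma tensor_diff_eq: "tensor_diff R i = lin_ext (\<lambda>a. const_part (gf_diff R i a))"
  by (simp add: tensor_diff_def const_part_def)

lemma zero_const_in_span:
  assumes "Poly_Mapping.lookup f 0 = (0 :: 'k::field)" "\<And>v. pvar v \<in> ideal.span T"
  shows "f \<in> ideal.span T"
proof -
  have "f \<in> ideal.span ({0} \<union> range pvar)"
    unfolding ideal_span_pvar var_prime_UNIV by (rule assms(1))
  moreover have "ideal.span ({0} \<union> range pvar) \<subseteq> ideal.span T"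
    by (rule ideal.span_minimal) (use assms(2) ideal.span_zero in auto)
  ultimately show ?thesis by blast
qed

lemma homogeneous_1_const: "homogeneous 1 f \<Longrightarrow> Poly_Mapping.lookup f 0 = 0"
  using in_keys_iff[of 0 f] by (fastforce simp: homogeneous_def)

lemma span_const_zero:
  fixes f :: "('v, 'k::field) mpoly"
  assumes "f \<in> ideal.span T" "\<And>g. g \<in> T \<Longrightarrow> Poly_Mapping.lookup g 0 = 0"
  shows "Poly_Mapping.lookup f 0 = 0"
  using assms(1)
proof (induction f rule: ideal.span_induct_alt)
  case (step c x y)
  then show ?case using assms(2) by (simp add: lookup_add lookup_mult_0)
qed simp

context graded_resolution
begin

text \<open>Once the forms generate all variables, the complex modulo them is the tensor product
  with the field. Taking constant terms sends generators of \<open>Z\<close> modulo \<open>B\<close>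
  to generators modulo the tensor boundaries, and every tensor cycle is reached because its lift to
  a constant vector lies in \<open>Z\<close>.\<close>

lemma tor_dim_le:
  assumes hom: "hom_le n i (int c) r" and vars: "\<And>v. pvar v \<in> ideal.span (\<theta> ` {..<n})"
  shows "vector_space.dim fscale (tensor_cycles R i c) -
    vector_space.dim fscale (tensor_boundaries R i c) \<le> r"
proof -
  interpret F: vector_space "fscale :: 'k \<Rightarrow> _" by (rule vector_space_fscale)
  obtain G where G: "finite G" "card G \<le> r" "Z n i (int c) \<subseteq> span (G \<union> B n i (int c))"
    using hom unfolding hom_le_def by auto
  let ?T = "const_part ` G \<union> tensor_boundaries R i c"
  have const_mod: "const_part x \<in> tensor_mod R i' c" if "x \<in> degree_part R i' (int c)" for x i'
    unfolding tensor_mod_def free_mod_def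
  proof (intro CollectI subsetI)
    fix a assume a: "a \<in> Poly_Mapping.keys (const_part x)"
    then have 0: "0 \<in> Poly_Mapping.keys (Poly_Mapping.lookup x a)" by (simp add: in_keys_iff lookup_const_part)
    then have "Poly_Mapping.lookup x a \<noteq> 0" by auto
    then have "a < gf_rank R i'" using that
      by (auto simp: degree_part_def gf_mod_def free_mod_def in_keys_iff subset_iff)
    moreover have "int (mdeg (0 :: 'v monom) + gf_deg R i' a) = int c"
      using that 0 unfolding degree_part_def by blast
    ultimately show "a < gf_rank R i' \<and> gf_deg R i' a = c" by simp
  qed
  have B: "const_part b \<in> F.span ?T" if bB: "b \<in> B n i (int c)" for b
  proof -
    obtain x y where xy: "b = lin_ext (gf_diff R i) x + y" "x \<in> degree_part R (Suc i) (int c)" "y \<in> N n i (int c)"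
      using bB unfolding B_def by auto
    have "const_part y = 0"
    proof (rule poly_mapping_eqI)
      fix a
      have "Poly_Mapping.lookup y a \<in> ideal.span (\<theta> ` {..<n})" using xy(3) unfolding N_iff by blast
      then show "Poly_Mapping.lookup (const_part y) a = Poly_Mapping.lookup 0 a"
        unfolding lookup_const_part lookup_zero by (rule span_const_zero) (use homogeneous_1_const[OF \<theta>] in auto)
    qed
    then have "const_part b = tensor_diff R i (const_part x)"
      unfolding xy(1) const_part_add const_part_lin_ext tensor_diff_eq by simp
    then have "const_part b \<in> tensor_boundaries R i c"
      unfolding tensor_boundaries_def using const_mod[OF xy(2)] by blast
    then show ?thesis by (intro F.span_base) auto
  qed
  have "F.subspace (F.span ?T)" by simp
  then have "subspace {v. const_part v \<in> F.span ?T}"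
    by (auto simp: subspace_def const_part_add sscale_def const_part_fscale F.span_zero F.span_add F.span_scale)
  moreover have "G \<union> B n i (int c) \<subseteq> {v. const_part v \<in> F.span ?T}"
    using B by (auto intro: F.span_base)
  ultimately have span: "span (G \<union> B n i (int c)) \<subseteq> {v. const_part v \<in> F.span ?T}" by (intro span_minimal)
  have cyc: "tensor_cycles R i c \<subseteq> F.span ?T"
  proof
    fix w assume w: "w \<in> tensor_cycles R i c"
    then have wmod: "w \<in> tensor_mod R i c" by (auto simp: tensor_cycles_def split: nat.splits)
    have deg: "const_vec w \<in> degree_part R i (int c)"
      unfolding degree_part_def gf_mod_def free_mod_def
    proof (intro CollectI conjI allI ballI subsetI)
      fix a assume "a \<in> Poly_Mapping.keys (const_vec w :: nat \<Rightarrow>\<^sub>0 ('v, 'k) mpoly)"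
      then have "a \<in> Poly_Mapping.keys w" by (auto simp: in_keys_iff lookup_const_vec)
      then show "a \<in> {..<gf_rank R i}" using wmod by (auto simp: tensor_mod_def free_mod_def)
    next
      fix a m assume "m \<in> Poly_Mapping.keys (Poly_Mapping.lookup (const_vec w :: nat \<Rightarrow>\<^sub>0 ('v, 'k) mpoly) a)"
      then have "m = 0" "a \<in> Poly_Mapping.keys w" by (auto simp: lookup_const_vec in_keys_iff split: if_splits)
      then show "int (mdeg m + gf_deg R i a) = int c" using wmod by (auto simp: tensor_mod_def free_mod_def)
    qed
    have "const_vec w \<in> Z n i (int c)"
    proof (cases i)
      case 0
      then show ?thesis using deg by (simp add: Z_def)
    next
      case (Suc i')
      have "tensor_diff R i' w = 0" using w Suc by (simp add: tensor_cycles_def)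
      then have "const_part (lin_ext (gf_diff R i') (const_vec w)) = 0"
        unfolding const_part_lin_ext tensor_diff_eq by simp
      then have "Poly_Mapping.lookup (Poly_Mapping.lookup (lin_ext (gf_diff R i') (const_vec w)) a) 0 = 0" for a
        by (metis lookup_const_part lookup_zero)
      then have "Poly_Mapping.lookup (lin_ext (gf_diff R i') (const_vec w)) a \<in> ideal.span (\<theta> ` {..<n})" for a
        using vars by (rule zero_const_in_span)
      moreover have "lin_ext (gf_diff R i') (const_vec w) \<in> degree_part R i' (int c)"
        using d_closed deg Suc by blast
      ultimately show ?thesis using deg Suc by (simp add: Z_def N_iff)
    qed
    then have "const_part (const_vec w :: nat \<Rightarrow>\<^sub>0 ('v, 'k) mpoly) \<in> F.span ?T" using G(3) span by blast
    then show "w \<in> F.span ?T" by simp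
  qed
  have "F.dim (tensor_cycles R i c) \<le> card (const_part ` G) + F.dim (tensor_boundaries R i c)"
  proof (rule F.dim_le_card_add_dim[OF _ _ _ cyc])
    let ?W = "(\<lambda>a. Poly_Mapping.single a 1) ` {..<gf_rank R i} :: (nat \<Rightarrow>\<^sub>0 'k) set"
    show "tensor_boundaries R i c \<subseteq> F.span ?W"
    proof
      fix w assume "w \<in> tensor_boundaries R i c"
      then obtain x where x: "x \<in> free_mod {..<gf_rank R (Suc i)}" "w = tensor_diff R i x"
        unfolding tensor_boundaries_def tensor_mod_def free_mod_def by auto
      have "const_part (gf_diff R i a) \<in> free_mod {..<gf_rank R i}" if "a < gf_rank R (Suc i)" for a
        using diff_closed[OF that]
        unfolding gf_mod_def free_mod_def subset_iff in_keys_iff mem_Collect_eq lookup_const_part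
        by (metis lookup_zero)
      then have w: "w \<in> free_mod {..<gf_rank R i}"
        unfolding x(2) tensor_diff_eq using x(1) by (intro lin_ext_closed) auto
      have "Poly_Mapping.single a (Poly_Mapping.lookup w a) = fscale (Poly_Mapping.lookup w a) (Poly_Mapping.single a 1)" for a
        by (simp add: fscale_single)
      then have "Poly_Mapping.single a (Poly_Mapping.lookup w a) \<in> F.span ?W" if "a \<in> Poly_Mapping.keys w" for a
        using w that by (metis (no_types, lifting) F.span_base F.span_scale free_mod_def imageI mem_Collect_eq subsetD)
      then have "(\<Sum>a\<in>Poly_Mapping.keys w. Poly_Mapping.single a (Poly_Mapping.lookup w a)) \<in> F.span ?W"
        by (rule F.span_sum)
      then show "w \<in> F.span ?W" by (simp add: sum_single_lookup)
    qed
  qed (use G in auto)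
  also have "card (const_part ` G) \<le> r" using card_image_le[OF G(1), of const_part] G(2) by simp
  finally show ?thesis by simp
qed

end

section \<open>Cliques and lexicographic counting\<close>

definition cliques :: "'a set \<Rightarrow> ('a \<Rightarrow> 'a \<Rightarrow> bool) \<Rightarrow> nat \<Rightarrow> 'a set set" where
  "cliques V E j = {Q. Q \<subseteq> V \<and> card Q = j \<and> (\<forall>x\<in>Q. \<forall>y\<in>Q. x \<noteq> y \<longrightarrow> E x y)}"

definition nbrs :: "'a set \<Rightarrow> ('a \<Rightarrow> 'a \<Rightarrow> bool) \<Rightarrow> 'a \<Rightarrow> 'a set" where
  "nbrs V E v = {u \<in> V. u \<noteq> v \<and> E v u}"

lemma finite_cliques: "finite V \<Longrightarrow> finite (cliques V E j)"
  unfolding cliques_def by (rule finite_subset[of _ "Pow V"]) auto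

lemma finite_nbrs: "finite V \<Longrightarrow> finite (nbrs V E v)"
  unfolding nbrs_def by simp

lemma card_cliques_split:
  assumes V: "finite V" "v \<in> V" and sym: "\<And>x y. E x y \<Longrightarrow> E y x"
  shows "card (cliques V E (Suc j)) = card (cliques (V - {v}) E (Suc j)) + card (cliques (nbrs V E v) E j)"
proof -
  have eq: "cliques V E (Suc j) = cliques (V - {v}) E (Suc j) \<union> insert v ` cliques (nbrs V E v) E j"
  proof (intro equalityI subsetI)
    fix Q assume Q: "Q \<in> cliques V E (Suc j)"
    show "Q \<in> cliques (V - {v}) E (Suc j) \<union> insert v ` cliques (nbrs V E v) E j"
    proof (cases "v \<in> Q")
      case True
      have "finite Q" using Q V(1) by (auto simp: cliques_def intro: finite_subset)
      then have "Q - {v} \<in> cliques (nbrs V E v) E j"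
        using Q True by (auto simp: cliques_def nbrs_def)
      moreover have "Q = insert v (Q - {v})" using True by auto
      ultimately show ?thesis by blast
    qed (use Q in \<open>auto simp: cliques_def\<close>)
  next
    fix Q assume "Q \<in> cliques (V - {v}) E (Suc j) \<union> insert v ` cliques (nbrs V E v) E j"
    then show "Q \<in> cliques V E (Suc j)"
    proof
      assume "Q \<in> insert v ` cliques (nbrs V E v) E j"
      then obtain P where P: "Q = insert v P" "P \<in> cliques (nbrs V E v) E j" by auto
      have "finite P" "v \<notin> P" using P V(1) by (auto simp: cliques_def nbrs_def intro: finite_subset)
      then show ?thesis using P V(2) sym by (auto simp: cliques_def nbrs_def)
    qed (auto simp: cliques_def)
  qed
  have inj: "inj_on (insert v) (cliques (nbrs V E v) E j)"
  proof (rule inj_onI)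
    fix P Q assume "P \<in> cliques (nbrs V E v) E j" "Q \<in> cliques (nbrs V E v) E j" "insert v P = insert v Q"
    moreover from this have "v \<notin> P" "v \<notin> Q" by (auto simp: cliques_def nbrs_def)
    ultimately show "P = Q" by (metis insert_ident)
  qed
  show ?thesis unfolding eq using V
    by (subst card_Un_disjoint) (auto simp: finite_cliques finite_nbrs card_image[OF inj], auto simp: cliques_def)
qed

lemma card_cliques_1: "finite V \<Longrightarrow> card (cliques V E (Suc 0)) = card V"
proof -
  assume "finite V"
  have "cliques V E (Suc 0) = (\<lambda>x. {x}) ` V" by (auto simp: cliques_def card_1_singleton_iff)
  then show ?thesis by (simp add: card_image)
qed

lemma card_cliques_le_choose:
  assumes "finite V"
  shows "card (cliques V E j) \<le> card V choose j"
proof -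
  have "card (cliques V E j) \<le> card {Q. Q \<subseteq> V \<and> card Q = j}"
    using assms by (intro card_mono) (auto simp: cliques_def intro: finite_subset[of _ "Pow V"])
  then show ?thesis using n_subsets[OF assms] by simp
qed

lemma card_edges_split:
  assumes "finite V" "v \<in> V" "\<And>x y. E x y \<Longrightarrow> E y x"
  shows "card (cliques V E 2) = card (cliques (V - {v}) E 2) + card (nbrs V E v)"
  using card_cliques_split[OF assms, where j = "Suc 0"] card_cliques_1[OF finite_nbrs[OF assms(1)]]
  by (simp add: numeral_2_eq_2)

text \<open>Deleting a vertex removes at least \<open>\<delta>\<close> edges and lowers each other
  degree by at most one, so the edges number at least \<delta> + (\<delta> - 1) + ... + 1.\<close>

lemma min_degree_edges:
  assumes "finite V" "V \<noteq> {}" "\<And>x y. E x y \<Longrightarrow> E y x" "\<And>v. v \<in> V \<Longrightarrow> \<delta> \<le> card (nbrs V E v)"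
  shows "Suc \<delta> choose 2 \<le> card (cliques V E 2)"
  using assms(1,2,4)
proof (induction \<delta> arbitrary: V)
  case (Suc \<delta>)
  then obtain v where v: "v \<in> V" by auto
  have deg: "\<delta> \<le> card (nbrs (V - {v}) E u)" if "u \<in> V - {v}" for u
  proof -
    have "nbrs V E u \<subseteq> insert v (nbrs (V - {v}) E u)" by (auto simp: nbrs_def)
    then have "card (nbrs V E u) \<le> Suc (card (nbrs (V - {v}) E u))"
      using card_mono[of "insert v (nbrs (V - {v}) E u)" "nbrs V E u"] Suc.prems(1)
      by (simp add: finite_nbrs card_insert_if split: if_splits)
    then show ?thesis using Suc.prems(3)[of u] that by simp
  qed
  have "nbrs V E v \<noteq> {}" using Suc.prems(3)[OF v] by auto
  then have ne: "V - {v} \<noteq> {}" by (auto simp: nbrs_def)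
  have "Suc \<delta> choose 2 \<le> card (cliques (V - {v}) E 2)"
    by (rule Suc.IH[OF finite_Diff[OF Suc.prems(1)] ne deg])
  then have "(Suc \<delta> choose 2) + Suc \<delta> \<le> card (cliques V E 2)"
    using card_edges_split[OF Suc.prems(1) v, of E] assms(3) Suc.prems(3)[OF v] by simp
  then show ?case by (simp add: numeral_2_eq_2)
qed (simp add: numeral_2_eq_2)

text \<open>Convexity of binomial coefficients in the upper index: of two pairs with the same sum,
  the more spread pair has the larger total.\<close>

lemma choose_convex: "((e + t + c) choose r) + ((e + s + c) choose r) \<le> ((e + s + t + c) choose r) + ((e + c) choose r)"
proof (cases r)
  case (Suc r')
  show ?thesis
  proof (induction t)
    case (Suc t)
    have "(e + t + c) choose r' \<le> (e + s + t + c) choose r'" by (rule binomial_right_mono) simp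
    with Suc.IH show ?case by (simp add: \<open>r = Suc r'\<close>)
  qed simp
qed simp

text \<open>A weak form of the Kruskal--Katona theorem, with the bound that Macaulay's theorem gives for
  multisets: delete a vertex of minimal degree.\<close>
lemma card_cliques_le:
  fixes V :: "'a set"
  assumes "finite V" and sym: "\<And>x y. E x y \<Longrightarrow> E y x"
    and "card (cliques V E 2) \<le> (Suc k choose 2) + e" "e \<le> k"
  shows "card (cliques V E (Suc (Suc j))) \<le> ((k + Suc j) choose Suc (Suc j)) + ((e + j) choose Suc j)"
  using assms(1,3,4)
proof (induction "card V" arbitrary: V k e)
  case 0
  then have "cliques V E (Suc (Suc j)) = {}" by (auto simp: cliques_def)
  then show ?case by simp
next
  case (Suc n)
  have fin: "finite V" and ne: "V \<noteq> {}" using Suc.hyps(2) by (auto intro: card_ge_0_finite)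
  define \<delta> where "\<delta> = Min ((\<lambda>v. card (nbrs V E v)) ` V)"
  have "\<delta> \<in> (\<lambda>v. card (nbrs V E v)) ` V" unfolding \<delta>_def using fin ne by (intro Min_in) auto
  then obtain v where v: "v \<in> V" "card (nbrs V E v) = \<delta>" by auto
  have min: "\<delta> \<le> card (nbrs V E u)" if "u \<in> V" for u unfolding \<delta>_def using fin that by simp
  have edges: "card (cliques V E 2) = card (cliques (V - {v}) E 2) + \<delta>"
    using card_edges_split[OF fin v(1), of E] sym v(2) by simp
  have cl: "card (cliques V E (Suc (Suc j))) \<le> card (cliques (V - {v}) E (Suc (Suc j))) + (\<delta> choose Suc j)"
    using card_cliques_split[OF fin v(1), of E "Suc j"] sym v(2)
      card_cliques_le_choose[OF finite_nbrs[OF fin], of E v E "Suc j"] by simp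
  have n: "n = card (V - {v})" "finite (V - {v})" using Suc.hyps(2) v(1) fin by auto
  \<comment> \<open>A minimal degree above \<open>k\<close> would force
    \<open>Suc (Suc k) choose 2\<close> edges, which is \<open>Suc k\<close> more than
    \<open>Suc k choose 2\<close>, while \<open>e\<close> is at most \<open>k\<close>.\<close>
  have "\<delta> \<le> k"
  proof (rule ccontr)
    assume "\<not> \<delta> \<le> k"
    then have "Suc (Suc k) choose 2 \<le> card (cliques V E 2)"
      using min by (intro min_degree_edges[OF fin ne sym]) force+
    then show False using Suc.prems(2,3) by (simp add: numeral_2_eq_2)
  qed
  \<comment> \<open>The count of subsets of the neighbourhood is relaxed to the multiset count in
    which the bound is expressed.\<close>
  have d: "\<delta> choose Suc j \<le> (\<delta> + j) choose Suc j" by (rule binomial_right_mono) simp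
  \<comment> \<open>If \<open>\<delta>\<close> is at most \<open>e\<close>, the lost edges are
    charged to \<open>e\<close>. Otherwise \<open>k\<close> is borrowed from
    \<open>Suc k choose 2\<close>, and the remainder \<open>k + e - \<delta>\<close> is at most
    \<open>k - 1\<close>, as the induction hypothesis requires.\<close>
  show ?case
  proof (cases "\<delta> \<le> e")
    case True
    have "card (cliques (V - {v}) E 2) \<le> (Suc k choose 2) + (e - \<delta>)" using edges Suc.prems(2) True by simp
    then have "card (cliques (V - {v}) E (Suc (Suc j))) \<le> ((k + Suc j) choose Suc (Suc j)) + ((e - \<delta> + j) choose Suc j)"
      using Suc.prems(3) by (intro Suc.hyps(1)[OF n]) auto
    moreover have "((e - \<delta> + j) choose Suc j) + ((\<delta> + j) choose Suc j) \<le> ((e + j) choose Suc j)"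
      using choose_convex[of 0 "e - \<delta>" j "Suc j" \<delta>] True by (simp add: add.commute binomial_eq_0)
    ultimately show ?thesis using cl d by linarith
  next
    case False
    then obtain k' where k': "k = Suc k'" using \<open>\<delta> \<le> k\<close> by (cases k) auto
    have "card (cliques (V - {v}) E 2) \<le> (Suc k' choose 2) + (k + e - \<delta>)"
      using edges Suc.prems(2) \<open>\<delta> \<le> k\<close> by (simp add: k' numeral_2_eq_2)
    then have "card (cliques (V - {v}) E (Suc (Suc j))) \<le> ((k' + Suc j) choose Suc (Suc j)) + ((k + e - \<delta> + j) choose Suc j)"
      using False k' by (intro Suc.hyps(1)[OF n]) auto
    moreover have "((k + e - \<delta> + j) choose Suc j) + ((\<delta> + j) choose Suc j) \<le> ((k + j) choose Suc j) + ((e + j) choose Suc j)"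
      using choose_convex[of e "k - \<delta>" j "Suc j" "\<delta> - e"] False \<open>\<delta> \<le> k\<close> by (simp add: add.commute)
    moreover have "(k + Suc j) choose Suc (Suc j) = ((k' + Suc j) choose Suc (Suc j)) + ((k + j) choose Suc j)"
      by (simp add: k')
    ultimately show ?thesis using cl d by linarith
  qed
qed

section \<open>Quadratic monomials in lexicographic order\<close>

lemma mvar_less_iff: "(mvar t :: nat monom) < mvar q \<longleftrightarrow> q < t"
proof
  assume "q < t"
  then show "(mvar t :: nat monom) < mvar q"
    unfolding monom_less_iff_lex by (intro exI[of _ q]) (auto simp: mvar_def lookup_single when_def)
next
  assume "(mvar t :: nat monom) < mvar q"
  then obtain k where "Poly_Mapping.lookup (mvar t) k < Poly_Mapping.lookup (mvar q :: nat monom) k"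
      "\<forall>l<k. Poly_Mapping.lookup (mvar t) l = Poly_Mapping.lookup (mvar q :: nat monom) l"
    unfolding monom_less_iff_lex by auto
  then show "q < t" by (auto simp: mvar_def lookup_single when_def split: if_splits)
qed

lemma mvar_pair_less:
  assumes "s \<le> t" "p \<le> q"
  shows "(mvar s + mvar t :: nat monom) < mvar p + mvar q \<longleftrightarrow> p < s \<or> s = p \<and> q < t"
proof -
  have less: "(mvar s + mvar t :: nat monom) < mvar p + mvar q" if "p < s" "s \<le> t" "p \<le> q" for s t p q
    unfolding monom_less_iff_lex using that
    by (intro exI[of _ p] conjI allI impI) (auto simp: mvar_def lookup_single when_def lookup_add)
  have less2: "(mvar p + mvar t :: nat monom) < mvar p + mvar q" if "q < t" for t p q
    using that mvar_less_iff by (intro add_strict_left_mono) auto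
  show ?thesis
    using less[of p s t q] less[of s p q t] less2[of q t p] less2[of t q p] assms
    by (cases "p < s"; cases "s < p"; cases "q < t"; cases "t < q") (auto dest: less_asym)
qed

text \<open>Index pairs of the quadratic monomials in the \<open>k\<close> variables following the
  \<open>a\<close>-th one.\<close>

definition incr_pairs :: "nat \<Rightarrow> nat \<Rightarrow> (nat \<times> nat) set" where
  "incr_pairs a k = {(s, t). a < s \<and> s \<le> t \<and> t \<le> a + k}"

lemma finite_incr_pairs: "finite (incr_pairs a k)"
  unfolding incr_pairs_def by (rule finite_subset[of _ "{..a + k} \<times> {..a + k}"]) auto

lemma card_incr_pairs: "card (incr_pairs a k) = Suc k choose 2"
proof (induction k)
  case 0
  have "incr_pairs a 0 = {}" by (auto simp: incr_pairs_def)
  then show ?case by (simp add: numeral_2_eq_2)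
next
  case (Suc k)
  have eq: "incr_pairs a (Suc k) = incr_pairs a k \<union> (\<lambda>s. (s, a + Suc k)) ` {a<..a + Suc k}"
  proof (rule Set.set_eqI)
    fix x :: "nat \<times> nat"
    obtain s t where x: "x = (s, t)" by (cases x)
    have "a < s \<and> s \<le> t \<and> t \<le> a + Suc k \<longleftrightarrow>
        a < s \<and> s \<le> t \<and> t \<le> a + k \<or> t = a + Suc k \<and> a < s \<and> s \<le> a + Suc k"
      by arith
    then show "x \<in> incr_pairs a (Suc k) \<longleftrightarrow> x \<in> incr_pairs a k \<union> (\<lambda>s. (s, a + Suc k)) ` {a<..a + Suc k}"
      unfolding x incr_pairs_def image_def by (simp add: conj_ac)
  qed
  have "(s, a + Suc k) \<notin> incr_pairs a k" for s by (simp add: incr_pairs_def)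
  then have "incr_pairs a k \<inter> (\<lambda>s. (s, a + Suc k)) ` {a<..a + Suc k} = {}" by blast
  then have "card (incr_pairs a (Suc k)) = card (incr_pairs a k) + card ((\<lambda>s. (s, a + Suc k)) ` {a<..a + Suc k})"
    unfolding eq by (intro card_Un_disjoint finite_incr_pairs finite_imageI finite_greaterThanAtMost)
  also have "card ((\<lambda>s. (s, a + Suc k)) ` {a<..a + Suc k}) = Suc k"
    by (subst card_image) (auto simp: inj_on_def)
  finally show ?case using Suc by (simp add: numeral_2_eq_2)
qed

lemma monomials_2: "monomials m 2 = (\<lambda>(s, t). mvar s + mvar t) ` incr_pairs 0 m"
proof (intro equalityI subsetI)
  fix u assume u: "u \<in> monomials m 2"
  have split: "\<exists>v w. v \<in> Poly_Mapping.keys u \<and> u = w + mvar v \<and> Suc (mdeg w) = mdeg u" if "mdeg u \<noteq> 0" for u :: "nat monom"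
  proof -
    have "Poly_Mapping.keys u \<noteq> {}" using that by (auto simp: mdeg_def)
    then obtain v where v: "v \<in> Poly_Mapping.keys u" by blast
    have eq: "u = (u - mvar v) + mvar v"
      using v by (intro poly_mapping_eqI) (auto simp: lookup_add lookup_minus mvar_def lookup_single when_def in_keys_iff)
    have fin: "finite (Poly_Mapping.keys u)" by simp
    have "mdeg (u - mvar v) = (\<Sum>x\<in>Poly_Mapping.keys u. Poly_Mapping.lookup (u - mvar v) x)"
      unfolding mdeg_def by (intro sum.mono_neutral_left) (auto simp: in_keys_iff lookup_minus)
    moreover have "mdeg u = (\<Sum>x\<in>Poly_Mapping.keys u. Poly_Mapping.lookup (u - mvar v) x + (if x = v then 1 else 0))"
      unfolding mdeg_def using v
      by (intro sum.cong refl) (auto simp: lookup_minus mvar_def lookup_single when_def in_keys_iff)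
    ultimately have "Suc (mdeg (u - mvar v)) = mdeg u" using v by (simp add: sum.distrib)
    then show ?thesis using v eq by blast
  qed
  have mu: "mdeg u = 2" "Poly_Mapping.keys u \<subseteq> {1..m}" using u by (auto simp: monomials_def)
  then obtain v w where vw: "v \<in> Poly_Mapping.keys u" "u = w + mvar v" "mdeg w = 1" using split[of u] by auto
  then obtain v' w' where vw': "v' \<in> Poly_Mapping.keys w" "w = w' + mvar v'" "mdeg w' = 0" using split[of w] by auto
  have "w' = 0" using vw'(3) by (intro poly_mapping_eqI) (auto simp: mdeg_def in_keys_iff)
  then have u': "u = mvar v' + mvar v" using vw(2) vw'(2) by simp
  then have "v' \<in> Poly_Mapping.keys u" by (auto simp: in_keys_iff lookup_add mvar_def lookup_single)
  then have range: "1 \<le> v" "v \<le> m" "1 \<le> v'" "v' \<le> m" using vw(1) mu(2) by auto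
  show "u \<in> (\<lambda>(s, t). mvar s + mvar t) ` incr_pairs 0 m"
  proof (cases "v \<le> v'")
    case True
    then show ?thesis using u' range by (intro image_eqI[of _ _ "(v, v')"]) (auto simp: incr_pairs_def add.commute)
  next
    case False
    then show ?thesis using u' range by (intro image_eqI[of _ _ "(v', v)"]) (auto simp: incr_pairs_def)
  qed
next
  fix u :: "nat monom" assume "u \<in> (\<lambda>(s, t). mvar s + mvar t) ` incr_pairs 0 m"
  then obtain s t where st: "u = mvar s + mvar t" "(s, t) \<in> incr_pairs 0 m" by auto
  have lk: "Poly_Mapping.lookup u x = (if x = s then 1 else 0) + (if x = t then 1 else 0)" for x
    unfolding st(1) by (simp add: lookup_add mvar_def lookup_single when_def)
  have "Poly_Mapping.keys u = {s, t}" by (auto simp: in_keys_iff lk split: if_splits)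
  moreover from this have "mdeg u = 2" unfolding mdeg_def by (cases "s = t") (auto simp: lk)
  ultimately show "u \<in> monomials m 2" using st(2) by (auto simp: monomials_def incr_pairs_def)
qed

lemma inj_on_mvar_pair: "inj_on (\<lambda>(s, t). mvar s + mvar t :: nat monom) (incr_pairs a k)"
proof (rule inj_onI, clarsimp simp: incr_pairs_def)
  fix s t p q assume *: "s \<le> t" "p \<le> q" and eq: "(mvar s + mvar t :: nat monom) = mvar p + mvar q"
  show "s = p \<and> t = q"
    using mvar_pair_less[OF *] mvar_pair_less[OF *(2,1)] eq by (metis less_irrefl linorder_neqE_nat)
qed

lemma card_le_less_split:
  fixes u :: "'a::linorder"
  assumes "finite A"
  shows "card A = card {w \<in> A. u \<le> w} + card {w \<in> A. w < u}"
proof -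
  have "{w \<in> A. u \<le> w} \<union> {w \<in> A. w < u} = A"
    using linorder_le_less_linear[of u] by blast
  moreover have "card ({w \<in> A. u \<le> w} \<union> {w \<in> A. w < u}) = card {w \<in> A. u \<le> w} + card {w \<in> A. w < u}"
  proof (rule card_Un_disjoint)
    show "{w \<in> A. u \<le> w} \<inter> {w \<in> A. w < u} = {}" using linorder_not_le[of u] by blast
  qed (simp_all add: assms)
  ultimately show ?thesis by (simp only:)
qed

text \<open>Below \<open>x_p x_q\<close> lie the quadratic monomials in the \<open>m - p\<close>
  variables after \<open>x_p\<close>, and the \<open>m - q\<close> products of \<open>x_p\<close>
  with a variable after \<open>x_q\<close>.\<close>

lemma kth_largest_count:
  assumes "kth_largest b (monomials m 2) (mvar p + mvar q)" "p \<le> q"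
  shows "1 \<le> p" "q \<le> m" "b + (Suc (m - p) choose 2) + (m - q) = Suc m choose 2"
proof -
  let ?u = "mvar p + mvar q :: nat monom" and ?A = "monomials m 2"
  let ?f = "\<lambda>(s, t). mvar s + mvar t :: nat monom"
  have u: "?u \<in> ?A" and b: "card {w \<in> ?A. ?u \<le> w} = b" using assms by (auto simp: kth_largest_def)
  then obtain s t where st: "(s, t) \<in> incr_pairs 0 m" "?u = mvar s + mvar t" unfolding monomials_2 by auto
  then have "s = p \<and> t = q"
    using mvar_pair_less[of s t p q] mvar_pair_less[of p q s t] assms(2)
    by (auto simp: incr_pairs_def)
  then show p: "1 \<le> p" and q: "q \<le> m" using st by (auto simp: incr_pairs_def)
  have finA: "finite ?A" unfolding monomials_2 using finite_incr_pairs by simp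
  have "card ?A = card {w \<in> ?A. ?u \<le> w} + card {w \<in> ?A. w < ?u}"
    by (rule card_le_less_split[OF finA])
  moreover have "card ?A = Suc m choose 2"
    unfolding monomials_2 card_image[OF inj_on_mvar_pair] card_incr_pairs ..
  moreover have "card {w \<in> ?A. w < ?u} = (Suc (m - p) choose 2) + (m - q)"
  proof -
    have eq: "{w \<in> ?A. w < ?u} = ?f ` (incr_pairs p (m - p) \<union> Pair p ` {q<..m})"
    proof (intro equalityI subsetI)
      fix w assume "w \<in> {w \<in> ?A. w < ?u}"
      then obtain s t where st: "(s, t) \<in> incr_pairs 0 m" "w = mvar s + mvar t" "mvar s + mvar t < ?u"
        unfolding monomials_2 by auto
      then have "p < s \<or> s = p \<and> q < t" using mvar_pair_less[of s t p q] assms(2) by (auto simp: incr_pairs_def)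
      then have "(s, t) \<in> incr_pairs p (m - p) \<union> Pair p ` {q<..m}" using st(1) by (auto simp: incr_pairs_def)
      then show "w \<in> ?f ` (incr_pairs p (m - p) \<union> Pair p ` {q<..m})" using st(2) by (force intro: image_eqI[of _ _ "(s, t)"])
    next
      fix w assume "w \<in> ?f ` (incr_pairs p (m - p) \<union> Pair p ` {q<..m})"
      then obtain s t where st: "(s, t) \<in> incr_pairs p (m - p) \<union> Pair p ` {q<..m}" "w = mvar s + mvar t" by auto
      then have "(s, t) \<in> incr_pairs 0 m" "p < s \<or> s = p \<and> q < t" using p q assms(2) by (auto simp: incr_pairs_def)
      then show "w \<in> {w \<in> ?A. w < ?u}" unfolding monomials_2
        using st(2) mvar_pair_less[of s t p q] assms(2) by (auto simp: incr_pairs_def intro!: rev_image_eqI)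
    qed
    have sub: "incr_pairs p (m - p) \<union> Pair p ` {q<..m} \<subseteq> incr_pairs 0 m"
      using p q assms(2) by (auto simp: incr_pairs_def)
    have "card {w \<in> ?A. w < ?u} = card (incr_pairs p (m - p) \<union> Pair p ` {q<..m})"
      unfolding eq by (rule card_image[OF inj_on_subset[OF inj_on_mvar_pair sub]])
    also have "\<dots> = card (incr_pairs p (m - p)) + card (Pair p ` {q<..m})"
    proof (rule card_Un_disjoint)
      have "(p, t) \<notin> incr_pairs p (m - p)" for t by (simp add: incr_pairs_def)
      then show "incr_pairs p (m - p) \<inter> Pair p ` {q<..m} = {}" by blast
    qed (auto simp: finite_incr_pairs)
    also have "card (Pair p ` {q<..m}) = m - q" by (subst card_image) (auto simp: inj_on_def)
    finally show ?thesis unfolding card_incr_pairs .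
  qed
  ultimately show "b + (Suc (m - p) choose 2) + (m - q) = Suc m choose 2" using b by simp
qed

text \<open>The pair \<open>(c, a)\<close> stands for the \<open>a\<close>-th variable of colour \<open>c\<close>. Step \<open>r\<close> identifies the pair
  \<open>ms ! r = (c, a)\<close> with \<open>(c0, a)\<close>, whose product with any variable of colour \<open>c\<close> then vanishes.\<close>
locale merge_order =
  fixes C :: "nat set" and m :: "nat \<Rightarrow> nat" and c0 :: nat and ms :: "(nat \<times> nat) list"
  assumes finC: "finite C" and c0: "c0 \<in> C" and max: "\<And>c. c \<in> C \<Longrightarrow> m c \<le> m c0"
    and dist: "distinct ms" and setms: "set ms = {(c, a). c \<in> C \<and> c \<noteq> c0 \<and> 1 \<le> a \<and> a \<le> m c}"
    and sort: "sorted (map snd ms)"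
begin

text \<open>The vertices not merged so far. Levels start at 1, since index 0 of each colour is
  reserved for the variable eliminated by the colour sum.\<close>

definition verts :: "nat \<Rightarrow> (nat \<times> nat) set" where
  "verts r = Pair c0 ` {1..m c0} \<union> set (drop r ms)"

definition adj :: "nat \<Rightarrow> nat \<times> nat \<Rightarrow> nat \<times> nat \<Rightarrow> bool" where
  "adj r x y \<longleftrightarrow> fst x \<noteq> fst y \<and> (fst x = c0 \<longrightarrow> (fst y, snd x) \<notin> set (take r ms)) \<and>
     (fst y = c0 \<longrightarrow> (fst x, snd y) \<notin> set (take r ms))"

abbreviation edges :: "nat \<Rightarrow> nat" where
  "edges r \<equiv> card (cliques (verts r) (adj r) 2)"

lemma adj_sym: "adj r x y \<Longrightarrow> adj r y x" by (auto simp: adj_def)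

lemma finite_verts: "finite (verts r)" by (simp add: verts_def)

lemma drop_no_c0 [simp]: "(c0, a) \<notin> set (drop r ms)"
  using set_drop_subset[of r ms] setms by auto

lemma card_verts: "card (verts r) = m c0 + (length ms - r)"
proof -
  have "card (verts r) = card (Pair c0 ` {1..m c0}) + card (set (drop r ms))"
    unfolding verts_def by (intro card_Un_disjoint) auto
  then show ?thesis using dist by (simp add: card_image inj_on_def distinct_card)
qed

text \<open>Because the list is sorted by level, exactly the lower pairs of colour \<open>c\<close>
  are merged before \<open>(c, a)\<close>.\<close>

lemma take_levels:
  assumes r: "r < length ms" and w: "ms ! r = (c, a)"
  shows "{a'. (c, a') \<in> set (take r ms)} = {1..<a}"
proof (intro equalityI subsetI)
  fix a' assume "a' \<in> {a'. (c, a') \<in> set (take r ms)}"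
  then have *: "(c, a') \<in> set (take r ms)" by simp
  then obtain s where s: "s < r" "ms ! s = (c, a')" using r by (auto simp: in_set_conv_nth)
  have "snd (ms ! s) \<le> snd (ms ! r)" using sorted_nth_mono[OF sort, of s r] s r by simp
  moreover have "ms ! s \<noteq> ms ! r" using nth_eq_iff_index_eq[OF dist, of s r] s r by simp
  moreover have "(c, a') \<in> set ms" using * set_take_subset by fast
  ultimately show "a' \<in> {1..<a}" using s w setms by auto
next
  fix a' assume a': "a' \<in> {1..<a}"
  have "(c, a) \<in> set ms" using w r nth_mem by force
  then have "(c, a') \<in> set ms" using a' setms by auto
  then obtain s where s: "s < length ms" "ms ! s = (c, a')" by (auto simp: in_set_conv_nth)
  have "s < r"
  proof (rule ccontr)
    assume "\<not> s < r"
    then have "snd (ms ! r) \<le> snd (ms ! s)" using sorted_nth_mono[OF sort, of r s] s by simp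
    then show False using s w a' by simp
  qed
  then have "(c, a') \<in> set (take r ms)" using s r by (force simp: in_set_conv_nth)
  then show "a' \<in> {a'. (c, a') \<in> set (take r ms)}" by simp
qed

text \<open>The vertex \<open>(c, a)\<close> is adjacent to the remaining vertices of colours other
  than \<open>c\<close> and \<open>c0\<close>, and to \<open>(c0, a')\<close> for \<open>a'\<close>
  at least \<open>a\<close>; its partner \<open>(c0, a)\<close> loses its remaining neighbours of
  colour \<open>c\<close>. Together this counts all vertices except \<open>(c, a)\<close> and
  \<open>a - 1\<close> vertices of colour \<open>c0\<close>.\<close>

lemma edges_step:
  assumes r: "r < length ms" and w: "ms ! r = (c, a)"
  shows "edges r = edges (Suc r) + (card (verts r) - a)" "1 \<le> a" "a \<le> m c0"
proof -
  let ?w = "(c, a)" and ?U = "verts (Suc r)" and ?z = "(c0, a)" and ?D = "set (drop (Suc r) ms)"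
  have wms: "?w \<in> set ms" using r w nth_mem by force
  then have ca: "c \<in> C" "c \<noteq> c0" "1 \<le> a" "a \<le> m c" using setms by auto
  then show a: "1 \<le> a" "a \<le> m c0" using max[of c] by auto
  have drop: "drop r ms = ?w # drop (Suc r) ms" using r w by (metis Cons_nth_drop_Suc)
  have wD: "?w \<notin> ?D" using dist drop by (metis distinct.simps(2) distinct_drop)
  have wT: "?w \<notin> set (take r ms)" using take_levels[OF r w] by auto
  have tk: "set (take (Suc r) ms) = insert ?w (set (take r ms))" using r w by (simp add: take_Suc_conv_app_nth)
  have V: "verts r = insert ?w ?U" by (auto simp: verts_def drop)
  have wU: "?w \<notin> ?U" using wD ca by (auto simp: verts_def)
  have zU: "?z \<in> ?U" using a by (auto simp: verts_def)
  have VU: "verts r - {?w} = ?U" using V wU by auto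
  have 1: "edges r = card (cliques ?U (adj r) 2) + card (nbrs (verts r) (adj r) ?w)"
    using card_edges_split[OF finite_verts, of ?w r "adj r"] adj_sym V VU by auto
  have 2: "card (cliques ?U (adj r) 2) = card (cliques (?U - {?z}) (adj r) 2) + card (nbrs ?U (adj r) ?z)"
    using card_edges_split[OF finite_verts zU, of "adj r"] adj_sym by auto
  have 3: "edges (Suc r) = card (cliques (?U - {?z}) (adj (Suc r)) 2) + card (nbrs ?U (adj (Suc r)) ?z)"
    using card_edges_split[OF finite_verts zU, of "adj (Suc r)"] adj_sym by auto
  have "(fst y, snd x) \<noteq> ?w" if "fst x = c0" "x \<noteq> ?z" for x y :: "nat \<times> nat"
    using that by (cases x) auto
  then have adj_eq: "adj r x y \<longleftrightarrow> adj (Suc r) x y" if "x \<noteq> ?z" "y \<noteq> ?z" for x y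
    using that unfolding adj_def tk insert_iff by blast
  have 4: "cliques (?U - {?z}) (adj r) 2 = cliques (?U - {?z}) (adj (Suc r)) 2"
    unfolding cliques_def
  proof (intro Collect_cong conj_cong refl ball_cong imp_cong)
    fix Q x y assume "Q \<subseteq> ?U - {?z}" "x \<in> Q" "y \<in> Q"
    then show "adj r x y \<longleftrightarrow> adj (Suc r) x y" by (intro adj_eq) auto
  qed
  have nz: "nbrs ?U (adj k) ?z = {x \<in> ?D. (fst x, a) \<notin> set (take k ms)}" for k
    by (auto simp: nbrs_def adj_def verts_def)
  have nb: "nbrs ?U (adj r) ?z = nbrs ?U (adj (Suc r)) ?z \<union> {x \<in> ?D. fst x = c}"
    unfolding nz tk using wT by auto
  have disj: "nbrs ?U (adj (Suc r)) ?z \<inter> {x \<in> ?D. fst x = c} = {}" unfolding nz tk by auto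
  have 5: "card (nbrs ?U (adj r) ?z) = card (nbrs ?U (adj (Suc r)) ?z) + card {x \<in> ?D. fst x = c}"
    unfolding nb by (rule card_Un_disjoint[OF finite_nbrs[OF finite_verts] _ disj]) simp
  have cM: "(c, x) \<in> set (take r ms) \<longleftrightarrow> x \<in> {1..<a}" for x using take_levels[OF r w] by blast
  have nw: "nbrs (verts r) (adj r) ?w = {x \<in> ?D. fst x \<noteq> c} \<union> Pair c0 ` ({1..m c0} - {1..<a})"
  proof (rule Set.set_eqI)
    fix x :: "nat \<times> nat"
    obtain c' a' where x: "x = (c', a')" by (cases x)
    have "x \<in> nbrs (verts r) (adj r) ?w \<longleftrightarrow>
        (x \<in> ?U \<and> c' \<noteq> c \<and> (c' = c0 \<longrightarrow> a' \<notin> {1..<a}))"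
      unfolding nbrs_def V adj_def x mem_Collect_eq fst_conv snd_conv cM using ca(2) by blast
    also have "\<dots> \<longleftrightarrow> x \<in> {x \<in> ?D. fst x \<noteq> c} \<union> Pair c0 ` ({1..m c0} - {1..<a})"
      unfolding verts_def x using ca(2) by (cases "c' = c0") auto
    finally show "x \<in> nbrs (verts r) (adj r) ?w \<longleftrightarrow>
      x \<in> {x \<in> ?D. fst x \<noteq> c} \<union> Pair c0 ` ({1..m c0} - {1..<a})" .
  qed
  have disj': "{x \<in> ?D. fst x \<noteq> c} \<inter> Pair c0 ` ({1..m c0} - {1..<a}) = {}" by auto
  have 6: "card (nbrs (verts r) (adj r) ?w) =
      card {x \<in> ?D. fst x \<noteq> c} + card (Pair c0 ` ({1..m c0} - {1..<a}))"
    unfolding nw by (rule card_Un_disjoint[OF _ _ disj']) simp_all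
  have 7: "card (Pair c0 ` ({1..m c0} - {1..<a})) = m c0 - (a - 1)"
  proof -
    have "{1..m c0} - {1..<a} = {a..m c0}" using a by auto
    then show ?thesis using a by (simp add: card_image inj_on_def)
  qed
  have D: "{x \<in> ?D. fst x = c} \<union> {x \<in> ?D. fst x \<noteq> c} = ?D" by blast
  have "card ({x \<in> ?D. fst x = c} \<union> {x \<in> ?D. fst x \<noteq> c}) = card {x \<in> ?D. fst x = c} + card {x \<in> ?D. fst x \<noteq> c}"
    by (rule card_Un_disjoint) auto
  then have "card {x \<in> ?D. fst x = c} + card {x \<in> ?D. fst x \<noteq> c} = card ?D" by (simp only: D)
  also have "\<dots> = length ms - Suc r" using dist by (simp add: distinct_card)
  finally show "edges r = edges (Suc r) + (card (verts r) - a)"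
    using 1 2 3 5 6 7 a r unfolding card_verts 4 by linarith
qed

lemma edges_end: "edges (length ms) = 0"
proof -
  have "cliques (verts (length ms)) (adj (length ms)) 2 = {}"
  proof (rule ccontr)
    assume "\<not> ?thesis"
    then obtain Q where Q: "Q \<subseteq> Pair c0 ` {1..m c0}" "card Q = 2"
        "\<forall>x\<in>Q. \<forall>y\<in>Q. x \<noteq> y \<longrightarrow> adj (length ms) x y"
      by (auto simp: cliques_def verts_def)
    then obtain x y where xy: "x \<in> Q" "y \<in> Q" "x \<noteq> y" by (metis card_2_iff insertI1 insert_subset subset_insertI)
    have "fst x = c0" "fst y = c0" using xy Q(1) by auto
    moreover have "adj (length ms) x y" using Q(3) xy by blast
    ultimately show False by (simp add: adj_def)
  qed
  then show ?thesis by simp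
qed

lemma verts_0: "verts 0 = (\<Union>c\<in>C. Pair c ` {1..m c})"
  unfolding verts_def using setms c0 by auto

lemma card_verts_0: "card (verts 0) = (\<Sum>c\<in>C. m c)"
  unfolding verts_0 using finC by (subst card_UN_disjoint) (auto simp: card_image inj_on_def)

text \<open>The initial graph is complete multipartite: its nonadjacent pairs are those within a
  colour.\<close>

lemma edges_start: "edges 0 + (\<Sum>c\<in>C. m c choose 2) = (\<Sum>c\<in>C. m c) choose 2"
proof -
  define S where "S c = Pair c ` {1..m c}" for c
  have V: "verts 0 = (\<Union>c\<in>C. S c)" unfolding verts_0 S_def ..
  have cardS: "card (S c) = m c" "finite (S c)" for c by (auto simp: S_def card_image inj_on_def)
  let ?T = "\<lambda>A :: (nat \<times> nat) set. {Q. Q \<subseteq> A \<and> card Q = 2}"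
  have "?T (verts 0) = cliques (verts 0) (adj 0) 2 \<union> (\<Union>c\<in>C. ?T (S c))"
  proof (intro equalityI subsetI)
    fix Q assume Q: "Q \<in> ?T (verts 0)"
    then obtain x y where xy: "Q = {x, y}" "x \<noteq> y" by (auto simp: card_2_iff)
    show "Q \<in> cliques (verts 0) (adj 0) 2 \<union> (\<Union>c\<in>C. ?T (S c))"
    proof (cases "fst x = fst y")
      case True
      then have "Q \<subseteq> S (fst x)" "fst x \<in> C" using Q xy by (auto simp: V S_def)
      then show ?thesis using Q by auto
    next
      case False
      then have "Q \<in> cliques (verts 0) (adj 0) 2" using Q xy by (auto simp: cliques_def adj_def)
      then show ?thesis by simp
    qed
  next
    fix Q assume "Q \<in> cliques (verts 0) (adj 0) 2 \<union> (\<Union>c\<in>C. ?T (S c))"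
    then show "Q \<in> ?T (verts 0)" by (auto simp: V cliques_def)
  qed
  moreover have "cliques (verts 0) (adj 0) 2 \<inter> (\<Union>c\<in>C. ?T (S c)) = {}"
  proof (rule ccontr)
    assume "\<not> ?thesis"
    then obtain Q c where Q: "Q \<in> cliques (verts 0) (adj 0) 2" "Q \<subseteq> S c" "card Q = 2" by auto
    then obtain x y where "Q = {x, y}" "x \<noteq> y" by (auto simp: card_2_iff)
    then show False using Q by (auto simp: cliques_def adj_def S_def)
  qed
  moreover have "card (\<Union>c\<in>C. ?T (S c)) = (\<Sum>c\<in>C. m c choose 2)"
  proof -
    have "card (\<Union>c\<in>C. ?T (S c)) = (\<Sum>c\<in>C. card (?T (S c)))"
    proof (rule card_UN_disjoint[OF finC])
      show "\<forall>c\<in>C. finite (?T (S c))" using cardS(2) by simp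
      show "\<forall>c\<in>C. \<forall>c'\<in>C. c \<noteq> c' \<longrightarrow> ?T (S c) \<inter> ?T (S c') = {}"
      proof (intro ballI impI, rule ccontr)
        fix c c' assume "c \<noteq> c'" "?T (S c) \<inter> ?T (S c') \<noteq> {}"
        then obtain Q where Q: "Q \<subseteq> S c" "Q \<subseteq> S c'" "card Q = 2" by auto
        then obtain x where "x \<in> Q" by (metis card_2_iff insertI1)
        then show False using Q \<open>c \<noteq> c'\<close> by (auto simp: S_def)
      qed
    qed
    then show ?thesis using n_subsets[OF cardS(2)] cardS(1) by simp
  qed
  moreover have "card (?T (verts 0)) = (\<Sum>c\<in>C. m c) choose 2"
    using n_subsets[OF finite_verts] card_verts_0 by simp
  moreover have "finite (cliques (verts 0) (adj 0) 2)" by (rule finite_cliques[OF finite_verts])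
  moreover have "finite (\<Union>c\<in>C. ?T (S c))" using finC cardS(2) by simp
  ultimately show ?thesis by (simp only: card_Un_disjoint)
qed

text \<open>The deficit with respect to the lexicographic count changes by \<open>p - a\<close>, up to the
  correction at \<open>q\<close>, when a pair of level \<open>a\<close> is merged. Since the levels increase, the deficit
  first grows and then decreases to a nonnegative final value.\<close>
theorem edges_le:
  assumes pq: "p \<le> q" "1 \<le> p" and start: "edges 0 \<le> (Suc (card (verts 0) - p) choose 2) + (card (verts 0) - q)"
    and r: "r \<le> length ms"
  shows "edges r \<le> (Suc (card (verts r) - p) choose 2) + (card (verts r) - q)"
proof -
  define f where "f l = (Suc (l - p) choose 2) + (l - q)" for l
  have f_Suc: "f (Suc l) = f l + (if p \<le> l then Suc l - p else 0) + (if q \<le> l then 1 else 0)" for l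
    using pq by (auto simp: f_def Suc_diff_le numeral_2_eq_2)
  have vSuc: "card (verts s) = Suc (card (verts (Suc s)))" if "s < length ms" for s
    using that by (simp add: card_verts)
  \<comment> \<open>For \<open>a < p\<close> the gain \<open>p - a\<close> is at least 1 and covers
    the correction at \<open>q\<close>.\<close>
  have fwd: "edges s \<le> f (card (verts s))" if "s \<le> length ms" "\<forall>t<s. snd (ms ! t) < p" for s
    using that
  proof (induction s)
    case 0
    then show ?case using start by (simp add: f_def)
  next
    case (Suc s)
    have s: "s < length ms" using Suc.prems by simp
    obtain c a where w: "ms ! s = (c, a)" by (cases "ms ! s")
    note st = edges_step[OF s w]
    have "a < p" using Suc.prems(2)[rule_format, of s] w by simp
    moreover have "edges s \<le> f (card (verts s))" using Suc by simp
    moreover have "a \<le> card (verts (Suc s))" using st(3) by (simp add: card_verts)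
    ultimately show ?case using st(1) f_Suc[of "card (verts (Suc s))"] unfolding vSuc[OF s]
      by (auto split: if_splits)
  qed
  \<comment> \<open>For \<open>a\<close> at least \<open>p\<close> the deficit never grows, so it is
    at least its final value, which is nonnegative because no edge remains.\<close>
  have bwd: "edges s \<le> f (card (verts s))" if "s \<le> length ms" "\<forall>t<length ms. s \<le> t \<longrightarrow> p \<le> snd (ms ! t)" for s
    using that
  proof (induction s rule: inc_induct)
    case base
    then show ?case by (simp add: edges_end)
  next
    case (step s)
    obtain c a where w: "ms ! s = (c, a)" by (cases "ms ! s")
    note st = edges_step[OF step.hyps(2) w]
    have "p \<le> a" using step.prems step.hyps w by force
    moreover have "edges (Suc s) \<le> f (card (verts (Suc s)))" using step by simp
    moreover have "a \<le> card (verts (Suc s))" using st(3) by (simp add: card_verts)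
    ultimately show ?case using st(1) f_Suc[of "card (verts (Suc s))"] unfolding vSuc[OF step.hyps(2)]
      by (auto split: if_splits)
  qed
  have "edges r \<le> f (card (verts r))"
  proof (cases "r < length ms \<and> p \<le> snd (ms ! r)")
    case True
    have "p \<le> snd (ms ! t)" if "t < length ms" "r \<le> t" for t
      using sorted_nth_mono[OF sort, of r t] that True by auto
    then show ?thesis using bwd r by blast
  next
    case False
    show ?thesis
    proof (cases "r < length ms")
      case True
      have "snd (ms ! t) < p" if "t < r" for t
        using sorted_nth_mono[OF sort, of t r] that True False by auto
      then show ?thesis using fwd r by blast
    next
      case False
      then show ?thesis using r edges_end by simp
    qed
  qed
  then show ?thesis by (simp add: f_def)
qed

end

section \<open>Spanning sets by cliques\<close>

text \<open>The span of \<open>G\<close> over the field modulo \<open>J\<close>, in the form of the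
  hypothesis of \<open>hom_le_0\<close>.\<close>

definition span_mod :: "('v, 'k::field) mpoly set \<Rightarrow> ('v, 'k) mpoly set \<Rightarrow> ('v, 'k) mpoly set" where
  "span_mod J G = {f. \<exists>t. f - (\<Sum>g\<in>G. Poly_Mapping.single 0 (t g) * g) \<in> J}"

context
  fixes J :: "('v, 'k::field) mpoly set"
  assumes J: "ideal.subspace J"
begin

lemma span_mod_ideal: "f \<in> J \<Longrightarrow> f \<in> span_mod J G"
  unfolding span_mod_def by (intro CollectI exI[of _ "\<lambda>_. 0"]) simp

lemma span_mod_0: "0 \<in> span_mod J G"
  using span_mod_ideal ideal.subspace_0[OF J] .

lemma span_mod_add:
  assumes "f \<in> span_mod J G" "h \<in> span_mod J G"
  shows "f + h \<in> span_mod J G"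
proof -
  obtain t u where "f - (\<Sum>g\<in>G. Poly_Mapping.single 0 (t g) * g) \<in> J" "h - (\<Sum>g\<in>G. Poly_Mapping.single 0 (u g) * g) \<in> J"
    using assms unfolding span_mod_def by auto
  then have "(f - (\<Sum>g\<in>G. Poly_Mapping.single 0 (t g) * g)) + (h - (\<Sum>g\<in>G. Poly_Mapping.single 0 (u g) * g)) \<in> J"
    by (rule ideal.subspace_add[OF J])
  also have "(f - (\<Sum>g\<in>G. Poly_Mapping.single 0 (t g) * g)) + (h - (\<Sum>g\<in>G. Poly_Mapping.single 0 (u g) * g)) =
      (f + h) - (\<Sum>g\<in>G. Poly_Mapping.single 0 (t g + u g) * g)"
    by (simp add: single_add distrib_right sum.distrib)
  finally show ?thesis unfolding span_mod_def by (intro CollectI exI[of _ "\<lambda>g. t g + u g"])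
qed

lemma span_mod_const:
  assumes "f \<in> span_mod J G"
  shows "Poly_Mapping.single 0 c * f \<in> span_mod J G"
proof -
  obtain t where "f - (\<Sum>g\<in>G. Poly_Mapping.single 0 (t g) * g) \<in> J" using assms unfolding span_mod_def by auto
  then have "Poly_Mapping.single 0 c * (f - (\<Sum>g\<in>G. Poly_Mapping.single 0 (t g) * g)) \<in> J"
    by (rule ideal.subspace_scale[OF J])
  also have "Poly_Mapping.single 0 c * (f - (\<Sum>g\<in>G. Poly_Mapping.single 0 (t g) * g)) =
      Poly_Mapping.single 0 c * f - (\<Sum>g\<in>G. Poly_Mapping.single 0 (c * t g) * g)"
    by (simp add: right_diff_distrib sum_distrib_left mult.assoc[symmetric] mult_single)
  finally show ?thesis unfolding span_mod_def by (intro CollectI exI[of _ "\<lambda>g. c * t g"])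
qed

lemma span_mod_uminus:
  assumes "f \<in> span_mod J G"
  shows "- f \<in> span_mod J G"
proof -
  have "Poly_Mapping.single 0 (- 1) * f \<in> span_mod J G" using assms by (rule span_mod_const)
  then show ?thesis by (simp add: single_uminus)
qed

lemma span_mod_sum: "(\<And>x. x \<in> A \<Longrightarrow> f x \<in> span_mod J G) \<Longrightarrow> sum f A \<in> span_mod J G"
  by (induction A rule: infinite_finite_induct) (auto intro: span_mod_0 span_mod_add)

lemma span_mod_base:
  assumes "finite G" "g \<in> G"
  shows "g \<in> span_mod J G"
proof -
  have "(\<Sum>h\<in>G. Poly_Mapping.single 0 (if h = g then 1 else 0) * h) = (\<Sum>h\<in>G. if h = g then g else 0)"
    by (intro sum.cong refl) auto
  also have "\<dots> = g" using assms by simp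
  finally show ?thesis unfolding span_mod_def using ideal.subspace_0[OF J]
    by (intro CollectI exI[of _ "\<lambda>h. if h = g then 1 else 0"]) (simp only: diff_self)
qed

lemma span_mod_induct:
  assumes "f \<in> span_mod J G" "\<And>g. g \<in> G \<Longrightarrow> h * g \<in> span_mod J G'"
  shows "h * f \<in> span_mod J G'"
proof -
  obtain t where t: "f - (\<Sum>g\<in>G. Poly_Mapping.single 0 (t g) * g) \<in> J" using assms(1) unfolding span_mod_def by auto
  have eq: "h * f = h * (f - (\<Sum>g\<in>G. Poly_Mapping.single 0 (t g) * g)) + (\<Sum>g\<in>G. Poly_Mapping.single 0 (t g) * (h * g))"
    by (simp add: right_diff_distrib sum_distrib_left mult.left_commute)
  have 1: "h * (f - (\<Sum>g\<in>G. Poly_Mapping.single 0 (t g) * g)) \<in> span_mod J G'"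
    by (intro span_mod_ideal ideal.subspace_scale[OF J] t)
  have 2: "(\<Sum>g\<in>G. Poly_Mapping.single 0 (t g) * (h * g)) \<in> span_mod J G'"
    by (intro span_mod_sum span_mod_const assms(2))
  show ?thesis using span_mod_add[OF 1 2] by (simp only: eq[symmetric])
qed

text \<open>Multiplying the product over a clique by \<open>\<xi> x\<close> lands in
  \<open>J\<close> or gives the product over a clique with one more vertex; a repeated factor is
  covered because squares lie in \<open>J\<close>. Monomials are built up one variable at a
  time.\<close>

lemma clique_products_span:
  fixes \<xi> :: "'i \<Rightarrow> ('v, 'k) mpoly"
  assumes fin: "finite Y" and vars: "\<And>v. pvar v \<in> span_mod J (\<xi> ` Y)"
    and nonadj: "\<And>x y. x \<in> Y \<Longrightarrow> y \<in> Y \<Longrightarrow> x = y \<or> \<not> E x y \<Longrightarrow> \<xi> x * \<xi> y \<in> J"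
    and sym: "\<And>x y. E x y \<Longrightarrow> E y x"
    and f: "homogeneous e f"
  shows "f \<in> span_mod J ((\<lambda>Q. \<Prod>x\<in>Q. \<xi> x) ` cliques Y E e)"
proof -
  let ?T = "\<lambda>e. span_mod J ((\<lambda>Q. \<Prod>x\<in>Q. \<xi> x) ` cliques Y E e)"
  have finG: "finite ((\<lambda>Q. \<Prod>x\<in>Q. \<xi> x) ` cliques Y E e)" for e using finite_cliques[OF fin] by simp
  have step: "\<xi> x * g \<in> ?T (Suc e)" if x: "x \<in> Y" and g: "g \<in> ?T e" for x g e
  proof (rule span_mod_induct[OF g])
    fix h assume "h \<in> (\<lambda>Q. \<Prod>x\<in>Q. \<xi> x) ` cliques Y E e"
    then obtain Q where Q: "h = (\<Prod>x\<in>Q. \<xi> x)" "Q \<in> cliques Y E e" by auto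
    have finQ: "finite Q" using Q(2) fin by (auto simp: cliques_def intro: finite_subset)
    show "\<xi> x * h \<in> ?T (Suc e)"
    proof (cases "\<exists>y\<in>Q. x = y \<or> \<not> E x y")
      case True
      then obtain y where y: "y \<in> Q" "x = y \<or> \<not> E x y" by auto
      have eq: "\<xi> x * h = (\<Prod>x\<in>Q - {y}. \<xi> x) * (\<xi> x * \<xi> y)"
        unfolding Q(1) using prod.remove[OF finQ y(1), of \<xi>] by (simp add: ac_simps)
      have "\<xi> x * \<xi> y \<in> J" using nonadj x y Q(2) by (auto simp: cliques_def)
      then show ?thesis unfolding eq by (intro span_mod_ideal) (rule ideal.subspace_scale[OF J])
    next
      case False
      then have "x \<notin> Q" by auto
      then have eq: "\<xi> x * h = (\<Prod>x\<in>insert x Q. \<xi> x)" using finQ Q(1) by simp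
      have "insert x Q \<in> cliques Y E (Suc e)"
        using Q(2) False x \<open>x \<notin> Q\<close> finQ sym by (auto simp: cliques_def)
      then show ?thesis unfolding eq by (intro span_mod_base[OF finG] imageI)
    qed
  qed
  have mon: "Poly_Mapping.single m 1 \<in> ?T e" if "mdeg m = e" for m e
    using that
  proof (induction e arbitrary: m)
    case 0
    have "{} \<in> cliques Y E 0" by (simp add: cliques_def)
    then have "(\<Prod>x\<in>{}. \<xi> x) \<in> ?T 0" by (intro span_mod_base[OF finG] imageI)
    then show ?case using 0 by (simp add: mdeg_eq_0_iff)
  next
    case (Suc e)
    then have "m \<noteq> 0" by auto
    then obtain v where v: "v \<in> Poly_Mapping.keys m" using keys_eq_empty by blast
    have "sqmon {v} = mvar v" by (simp add: sqmon_def)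
    then have m: "m = (m - mvar v) + mvar v" using sqmon_le_split[of "{v}" m] v by simp
    have "mdeg m = mdeg (m - mvar v) + 1" by (subst m) (simp only: mdeg_add mdeg_mvar)
    then have "Poly_Mapping.single (m - mvar v) 1 \<in> ?T e" using Suc by simp
    note g = this
    have "Poly_Mapping.single (m - mvar v) 1 * pvar v \<in> ?T (Suc e)"
    proof (rule span_mod_induct[OF vars])
      fix h assume "h \<in> \<xi> ` Y"
      then obtain x where x: "x \<in> Y" "h = \<xi> x" by auto
      show "Poly_Mapping.single (m - mvar v) 1 * h \<in> ?T (Suc e)"
        using step[OF x(1) g] x(2) by (simp add: mult.commute)
    qed
    also have "Poly_Mapping.single (m - mvar v) 1 * pvar v = Poly_Mapping.single m (1 :: 'k)"
      unfolding pvar_def mult_single using m by simp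
    finally show ?case .
  qed
  have "(\<Sum>m\<in>Poly_Mapping.keys f. Poly_Mapping.single 0 (Poly_Mapping.lookup f m) * Poly_Mapping.single m 1) \<in> ?T e"
    using f by (intro span_mod_sum span_mod_const mon) (auto simp: homogeneous_def)
  then show ?thesis by (simp add: mult_single sum_single_lookup)
qed

lemma span_mod_empty: "f \<in> span_mod J {} \<longleftrightarrow> f \<in> J"
  by (simp add: span_mod_def)

end

text \<open>The earlier variables generate a prime ideal that does not contain the next one.\<close>

lemma ideal_regular_pvar:
  assumes "distinct vs"
  shows "ideal_regular {0 :: ('v::finite, 'k::field) mpoly} (map pvar vs)"
  unfolding ideal_regular_def
proof (intro allI impI)
  fix s and a :: "('v, 'k) mpoly"
  assume s: "s < length (map pvar vs :: ('v, 'k) mpoly list)"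
    and *: "map pvar vs ! s * a \<in> ideal.span ({0} \<union> set (take s (map pvar vs)))"
  have eq: "set (take s (map pvar vs)) = (pvar ` set (take s vs) :: ('v, 'k) mpoly set)" by (simp add: take_map)
  have "vs ! s \<notin> set (take s vs)"
  proof
    assume "vs ! s \<in> set (take s vs)"
    then obtain i where "i < s" "vs ! i = vs ! s" using s by (auto simp: in_set_conv_nth)
    then show False using nth_eq_iff_index_eq[OF assms, of i s] s by simp
  qed
  then have "pvar (vs ! s) \<notin> (var_prime (set (take s vs)) :: ('v, 'k) mpoly set)" by (simp add: pvar_in_var_prime)
  then show "a \<in> ideal.span ({0} \<union> set (take s (map pvar vs)))"
    using * s var_prime_prime[of "pvar (vs ! s)" a "set (take s vs)"] unfolding eq ideal_span_pvar by simp
qed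

lemma keys_power_mdeg:
  assumes "Poly_Mapping.lookup y 0 = (0 :: 'k::field)" "m \<in> Poly_Mapping.keys (y ^ e :: ('v, 'k) mpoly)"
  shows "e \<le> mdeg m"
  using assms(2)
proof (induction e arbitrary: m)
  case (Suc e)
  then have "m \<in> Poly_Mapping.keys (y * y ^ e)" by simp
  then obtain a b where ab: "m = a + b" "a \<in> Poly_Mapping.keys y" "b \<in> Poly_Mapping.keys (y ^ e)"
    using subsetD[OF Poly_Mapping.keys_mult] by blast
  have "a \<noteq> 0" using ab(2) assms(1) by (auto simp: in_keys_iff)
  then have "mdeg a \<noteq> 0" by (simp add: mdeg_eq_0_iff)
  then show ?case using Suc.IH[OF ab(3)] by (simp add: ab(1) mdeg_add)
qed simp

section \<open>Explicit linear forms for a balanced complex\<close>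

text \<open>A colour class has \<open>m c + 1\<close> vertices, numbered from 0; vertex 0 is
  eliminated by the colour sum. The list \<open>ys\<close> stands for the regular sequence supplied
  by Cohen-Macaulayness.\<close>

locale balanced_parameters = merge_order "{1..d}" m c0 ms
  for d :: nat and m :: "nat \<Rightarrow> nat" and c0 :: nat and ms :: "(nat \<times> nat) list" +
  fixes \<Delta> :: "('v::finite) set set" and V :: "nat \<Rightarrow> 'v set" and vert :: "nat \<Rightarrow> nat \<Rightarrow> 'v"
    and ys :: "('v, 'k::field) mpoly list"
  assumes vert: "\<And>c. c \<in> {1..d} \<Longrightarrow> bij_betw (vert c) {..m c} (V c)"
    and cover: "(\<Union>c\<in>{1..d}. V c) = UNIV"
    and colour: "\<And>F c. F \<in> \<Delta> \<Longrightarrow> c \<in> {1..d} \<Longrightarrow> card (F \<inter> V c) \<le> 1"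
    and ys: "length ys = d" "ideal_regular (SR_ideal \<Delta>) ys" "\<And>y. y \<in> set ys \<Longrightarrow> Poly_Mapping.lookup y 0 = 0"
begin

abbreviation I :: "('v, 'k) mpoly set" where "I \<equiv> SR_ideal \<Delta>"

definition form :: "nat \<times> nat \<Rightarrow> ('v, 'k) mpoly" where
  "form x = (if snd x = 0 then \<Sum>v\<in>V (fst x). pvar v
     else if fst x = c0 then pvar (vert c0 (snd x))
     else pvar (vert (fst x) (snd x)) - pvar (vert c0 (snd x)))"

text \<open>Colour sums, then merges by level, and last the variables of colour \<open>c0\<close>
  with positive index, which complete the list to generators of all linear forms.\<close>

definition param_order :: "(nat \<times> nat) list" where
  "param_order = map (\<lambda>c. (c, 0)) [1..<Suc d] @ ms @ map (Pair c0) [1..<Suc (m c0)]"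

text \<open>The default 0 counts as homogeneous of degree 1, as \<open>graded_resolution\<close>
  demands for every index.\<close>

definition \<theta> :: "nat \<Rightarrow> ('v, 'k) mpoly" where
  "\<theta> l = (if l < length param_order then form (param_order ! l) else 0)"

lemma length_order: "length param_order = d + (length ms + m c0)"
  by (simp add: param_order_def del: upt_Suc)

lemma homogeneous_theta: "homogeneous 1 (\<theta> l)"
  unfolding \<theta>_def form_def by (auto intro!: homogeneous_sum homogeneous_diff homogeneous_pvar simp del: One_nat_def)

lemma theta_image: "k \<le> length param_order \<Longrightarrow> \<theta> ` {..<k} = form ` set (take k param_order)"
proof -
  assume k: "k \<le> length param_order"
  have "\<theta> ` {..<k} = (\<lambda>l. form (param_order ! l)) ` {..<k}" using k by (intro image_cong) (auto simp: \<theta>_def)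
  also have "\<dots> = form ` (nth param_order ` {0..<k})" by (simp add: image_image lessThan_atLeast0)
  finally show ?thesis using nth_image[OF k] by simp
qed

lemma vert_in: "c \<in> {1..d} \<Longrightarrow> a \<le> m c \<Longrightarrow> vert c a \<in> V c"
  using bij_betwE[OF vert, of c] by auto

lemma vert_obtain:
  obtains c a where "c \<in> {1..d}" "a \<le> m c" "v = vert c a"
proof -
  obtain c where c: "c \<in> {1..d}" "v \<in> V c" using cover by blast
  then have "v \<in> vert c ` {..m c}" using bij_betw_imp_surj_on[OF vert[OF c(1)]] by simp
  then show ?thesis using c that by auto
qed

lemma sum_colour:
  assumes "c \<in> {1..d}"
  shows "(\<Sum>v\<in>V c. pvar v) = pvar (vert c 0) + (\<Sum>a=1..m c. pvar (vert c a) :: ('v, 'k) mpoly)"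
proof -
  have "(\<Sum>v\<in>V c. pvar v :: ('v, 'k) mpoly) = (\<Sum>a\<in>{..m c}. pvar (vert c a))"
    by (rule sum.reindex_bij_betw[OF vert[OF assms], symmetric])
  also have "{..m c} = insert 0 {1..m c}" by auto
  finally show ?thesis by simp
qed

lemma pvar_in_span_theta: "pvar v \<in> ideal.span (\<theta> ` {..<length param_order})"
proof -
  let ?S = "ideal.span (form ` set param_order)"
  have mem: "form x \<in> ?S" if "x \<in> set param_order" for x using that by (intro ideal.span_base) auto
  have 1: "pvar (vert c0 a) \<in> ?S" if "1 \<le> a" "a \<le> m c0" for a
  proof -
    have "form (c0, a) \<in> ?S" using that by (intro mem) (auto simp: param_order_def)
    then show ?thesis using that by (simp add: form_def)
  qed
  have 2: "pvar (vert c a) \<in> ?S" if "c \<in> {1..d}" "1 \<le> a" "a \<le> m c" for c a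
  proof (cases "c = c0")
    case False
    have "form (c, a) \<in> ?S" using that False setms by (intro mem) (auto simp: param_order_def)
    moreover have "pvar (vert c0 a) \<in> ?S" using that max[OF that(1)] by (intro 1) auto
    ultimately have "form (c, a) + pvar (vert c0 a) \<in> ?S" by (rule ideal.span_add)
    then show ?thesis using that False by (simp add: form_def)
  qed (use 1 that in auto)
  have 3: "pvar (vert c 0) \<in> ?S" if c: "c \<in> {1..d}" for c
  proof -
    have "form (c, 0) \<in> ?S" using that by (intro mem) (auto simp: param_order_def)
    moreover have "(\<Sum>a=1..m c. pvar (vert c a)) \<in> ?S" using that by (intro ideal.span_sum 2) auto
    ultimately have "form (c, 0) - (\<Sum>a=1..m c. pvar (vert c a)) \<in> ?S" by (rule ideal.span_diff)
    then show ?thesis using sum_colour[OF c] by (simp add: form_def)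
  qed
  obtain c a where "c \<in> {1..d}" "a \<le> m c" "v = vert c a" by (rule vert_obtain)
  then have "pvar v \<in> ?S" using 2 3 by (cases "a = 0") auto
  then show ?thesis using theta_image[of "length param_order"] by simp
qed

text \<open>The offset \<open>d\<close> skips the colour sums, so that \<open>r\<close> counts
  merges, in step with \<open>verts r\<close> and \<open>adj r\<close>.\<close>

definition J :: "nat \<Rightarrow> ('v, 'k) mpoly set" where
  "J r = ideal.span (I \<union> \<theta> ` {..<d + r})"

lemma J_mono: "r \<le> r' \<Longrightarrow> J r \<subseteq> J r'"
  unfolding J_def by (intro ideal.span_mono) auto

lemma subspace_J: "ideal.subspace (J r)" unfolding J_def by (rule ideal.subspace_span)

lemma form_in_J:
  assumes r: "r \<le> length ms"
  shows "c \<in> {1..d} \<Longrightarrow> form (c, 0) \<in> J r" "x \<in> set (take r ms) \<Longrightarrow> form x \<in> J r"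
proof -
  have "take (d + r) param_order = map (\<lambda>c. (c, 0)) [1..<Suc d] @ take r ms"
    using r by (simp add: param_order_def del: upt_Suc)
  then have "\<theta> ` {..<d + r} = form ` ((\<lambda>c. (c, 0)) ` {1..d} \<union> set (take r ms))"
    using theta_image[of "d + r"] r length_order by (simp add: atLeastLessThanSuc_atLeastAtMost del: upt_Suc)
  then have "form x \<in> J r" if "x \<in> (\<lambda>c. (c, 0)) ` {1..d} \<union> set (take r ms)" for x
    unfolding J_def using that by (intro ideal.span_base) auto
  then show "c \<in> {1..d} \<Longrightarrow> form (c, 0) \<in> J r" "x \<in> set (take r ms) \<Longrightarrow> form x \<in> J r" by auto
qed

text \<open>Two distinct vertices of one colour form a nonface. The square of a variable is its
  product with the colour sum minus such mixed products.\<close>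

lemma same_colour_product:
  assumes c: "c \<in> {1..d}" and uv: "u \<in> V c" "v \<in> V c" and r: "r \<le> length ms"
  shows "pvar u * pvar v \<in> J r"
proof -
  have ne: "pvar u * pvar v \<in> J r" if uv: "u \<in> V c" "v \<in> V c" "u \<noteq> v" for u v
  proof -
    have "{u, v} \<notin> \<Delta>"
    proof
      assume "{u, v} \<in> \<Delta>"
      then have "card ({u, v} \<inter> V c) \<le> 1" using colour c by blast
      moreover have "{u, v} \<inter> V c = {u, v}" using uv by auto
      ultimately show False using uv(3) by simp
    qed
    then have "Poly_Mapping.single (sqmon {u, v}) 1 \<in> I"
      by (intro single_in_SR_ideal[of "{u, v}"]) (auto simp: keys_sqmon)
    moreover have "Poly_Mapping.single (sqmon {u, v}) 1 = (\<Prod>v\<in>{u, v}. pvar v :: ('v, 'k) mpoly)"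
      by (simp only: prod_pvar)
    ultimately have "pvar u * pvar v \<in> I" using uv(3) by simp
    then show ?thesis unfolding J_def by (intro ideal.span_base) auto
  qed
  show ?thesis
  proof (cases "u = v")
    case True
    have "pvar u * form (c, 0) \<in> J r" by (intro ideal.subspace_scale[OF subspace_J] form_in_J(1)[OF r] c)
    moreover have "(\<Sum>w\<in>V c - {u}. pvar u * pvar w) \<in> J r"
      using uv by (intro ideal.subspace_sum[OF subspace_J] ne) auto
    ultimately have "pvar u * form (c, 0) - (\<Sum>w\<in>V c - {u}. pvar u * pvar w) \<in> J r"
      by (rule ideal.subspace_diff[OF subspace_J])
    also have "pvar u * form (c, 0) - (\<Sum>w\<in>V c - {u}. pvar u * pvar w) = pvar u * (pvar u :: ('v, 'k) mpoly)"
    proof -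
      have "form (c, 0) = pvar u + (\<Sum>w\<in>V c - {u}. pvar w)"
        unfolding form_def using uv by (simp add: sum.remove[of "V c" u])
      then show ?thesis by (simp add: distrib_left sum_distrib_left)
    qed
    finally show ?thesis using True by simp
  qed (use ne uv in auto)
qed

definition \<xi> :: "nat \<times> nat \<Rightarrow> ('v, 'k) mpoly" where "\<xi> x = pvar (vert (fst x) (snd x))"

lemma verts_range: "x \<in> verts r \<Longrightarrow> fst x \<in> {1..d} \<and> 1 \<le> snd x \<and> snd x \<le> m (fst x)"
  using set_drop_subset[of r ms] setms c0 by (auto simp: verts_def)

text \<open>If \<open>(c, a)\<close> has been merged, the variable of \<open>(c0, a)\<close> may be
  exchanged for that of \<open>(c, a)\<close>, and the product with a variable of colour
  \<open>c\<close> becomes one within a colour.\<close>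

lemma nonadjacent_product:
  assumes r: "r \<le> length ms" and xy: "x \<in> verts r" "y \<in> verts r" "x = y \<or> \<not> adj r x y"
  shows "\<xi> x * \<xi> y \<in> J r"
proof -
  note rx = verts_range[OF xy(1)] and ry = verts_range[OF xy(2)]
  have merged: "\<xi> x * \<xi> y \<in> J r" if "fst x = c0" "(fst y, snd x) \<in> set (take r ms)"
    "y \<in> verts r" for x y
  proof -
    have "(fst y, snd x) \<in> set ms" using that(2) set_take_subset by fast
    then have y: "fst y \<noteq> c0" "1 \<le> snd x" "snd x \<le> m (fst y)" "fst y \<in> {1..d}" using setms by auto
    let ?z = "pvar (vert (fst y) (snd x)) :: ('v, 'k) mpoly"
    have "\<xi> x = ?z - form (fst y, snd x)" using y that by (simp add: \<xi>_def form_def)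
    then have eq: "\<xi> x * \<xi> y = ?z * \<xi> y - \<xi> y * form (fst y, snd x)"
      by (simp only: left_diff_distrib mult.commute[of "form _"])
    have "?z * \<xi> y \<in> J r" unfolding \<xi>_def
      using y verts_range[OF that(3)] by (intro same_colour_product[OF y(4) _ _ r] vert_in) auto
    moreover have "\<xi> y * form (fst y, snd x) \<in> J r"
      using form_in_J(2)[OF r that(2)] by (rule ideal.subspace_scale[OF subspace_J])
    ultimately show ?thesis unfolding eq by (rule ideal.subspace_diff[OF subspace_J])
  qed
  consider "fst x = fst y" | "fst x = c0" "(fst y, snd x) \<in> set (take r ms)" | "fst y = c0" "(fst x, snd y) \<in> set (take r ms)"
    using xy(3) unfolding adj_def by blast
  then show ?thesis
  proof cases
    case 1
    have "vert (fst x) (snd x) \<in> V (fst x)" "vert (fst y) (snd y) \<in> V (fst x)"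
      using rx ry 1 vert_in by auto
    then show ?thesis unfolding \<xi>_def using rx by (intro same_colour_product[OF _ _ _ r]) auto
  next
    case 2
    then show ?thesis using merged xy by blast
  next
    case 3
    then have "\<xi> y * \<xi> x \<in> J r" using merged xy by blast
    then show ?thesis by (simp add: mult.commute)
  qed
qed

lemma pvar_span_verts:
  assumes r: "r \<le> length ms"
  shows "pvar v \<in> span_mod (J r) (\<xi> ` verts r)"
proof -
  let ?T = "span_mod (J r) (\<xi> ` verts r)"
  note base = span_mod_base[OF subspace_J finite_imageI[OF finite_verts]]
  note add = span_mod_add[OF subspace_J]
  have 1: "pvar (vert c0 a) \<in> ?T" if "1 \<le> a" "a \<le> m c0" for a
  proof -
    have "\<xi> (c0, a) \<in> ?T" using that by (intro base imageI) (auto simp: verts_def)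
    then show ?thesis by (simp add: \<xi>_def)
  qed
  have 2: "pvar (vert c a) \<in> ?T" if "c \<in> {1..d}" "1 \<le> a" "a \<le> m c" for c a
  proof (cases "c = c0")
    case False
    then have "(c, a) \<in> set ms" using that setms by auto
    then have "(c, a) \<in> set (take r ms) \<or> (c, a) \<in> set (drop r ms)" by (metis append_take_drop_id set_append Un_iff)
    then show ?thesis
    proof
      assume "(c, a) \<in> set (take r ms)"
      then have "form (c, a) \<in> ?T" by (intro span_mod_ideal[OF subspace_J] form_in_J(2)[OF r])
      moreover have "pvar (vert c0 a) \<in> ?T" using that max[OF that(1)] by (intro 1) auto
      ultimately have "form (c, a) + pvar (vert c0 a) \<in> ?T" by (rule add)
      then show ?thesis using that False by (simp add: form_def)
    next
      assume "(c, a) \<in> set (drop r ms)"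
      then have "\<xi> (c, a) \<in> ?T" by (intro base imageI) (auto simp: verts_def)
      then show ?thesis by (simp add: \<xi>_def)
    qed
  qed (use 1 that in auto)
  have 3: "pvar (vert c 0) \<in> ?T" if c: "c \<in> {1..d}" for c
  proof -
    have "form (c, 0) \<in> ?T" by (intro span_mod_ideal[OF subspace_J] form_in_J(1)[OF r] c)
    moreover have "- (\<Sum>a=1..m c. pvar (vert c a)) \<in> ?T"
      using that by (intro span_mod_uminus[OF subspace_J] span_mod_sum[OF subspace_J] 2) auto
    ultimately have "form (c, 0) + - (\<Sum>a=1..m c. pvar (vert c a)) \<in> ?T" by (rule add)
    then show ?thesis using sum_colour[OF c] by (simp add: form_def)
  qed
  obtain c a where "c \<in> {1..d}" "a \<le> m c" "v = vert c a" by (rule vert_obtain)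
  then show ?thesis using 2 3 by (cases "a = 0") auto
qed

lemma homogeneous_span:
  assumes "r \<le> length ms" "homogeneous e f"
  shows "f \<in> span_mod (J r) ((\<lambda>Q. \<Prod>x\<in>Q. \<xi> x) ` cliques (verts r) (adj r) e)"
  by (rule clique_products_span[OF subspace_J finite_verts pvar_span_verts[OF assms(1)]
        nonadjacent_product[OF assms(1)] adj_sym assms(2)])

text \<open>A clique has at most one vertex of each colour, hence at most \<open>d\<close> vertices.
  The quotient by the colour sums is therefore zero in high degrees, so these are
  parameters.\<close>

lemma large_degree_in_J:
  assumes "homogeneous e f" "d < e"
  shows "f \<in> J 0"
proof -
  have "cliques (verts 0) (adj 0) e = {}"
  proof (rule ccontr)
    assume "\<not> ?thesis"
    then obtain Q where Q: "Q \<subseteq> verts 0" "card Q = e" "\<forall>x\<in>Q. \<forall>y\<in>Q. x \<noteq> y \<longrightarrow> adj 0 x y"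
      by (auto simp: cliques_def)
    have "inj_on fst Q" using Q(3) by (intro inj_onI) (auto simp: adj_def)
    moreover have "fst ` Q \<subseteq> {1..d}" using Q(1) verts_range by blast
    ultimately have "card Q \<le> card {1..d}" by (intro card_inj_on_le) auto
    then show False using Q(2) assms(2) by simp
  qed
  then show ?thesis using homogeneous_span[of 0 e f] assms(1) by (simp add: span_mod_empty[OF subspace_J])
qed

lemma theta_regular_mod_I:
  assumes "k < d" "homogeneous e f" "\<theta> k * f \<in> ideal.span (I \<union> \<theta> ` {..<k})"
  shows "f \<in> ideal.span (I \<union> \<theta> ` {..<k})"
proof (rule graded_parameters_regular[OF graded_SR_ideal _ ys(2) _ _ assms])
  show "homogeneous 1 (\<theta> i)" for i by (rule homogeneous_theta)
  show "d \<le> length ys" using ys(1) by simp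
  fix y assume "y \<in> set ys"
  then have y: "Poly_Mapping.lookup y 0 = 0" by (rule ys(3))
  \<comment> \<open>Since \<open>y\<close> has no constant term, its power has no component of
    degree at most \<open>d\<close>; the other components are too large to survive modulo
    \<open>J 0\<close>.\<close>
  have "hcomp e (y ^ Suc d) \<in> J 0" for e
  proof (cases "d < e")
    case False
    have "hcomp e (y ^ Suc d) = 0"
    proof (rule poly_mapping_eqI)
      fix m
      show "Poly_Mapping.lookup (hcomp e (y ^ Suc d)) m = Poly_Mapping.lookup 0 m"
      proof (cases "m \<in> Poly_Mapping.keys (y ^ Suc d)")
        case True
        then have "mdeg m \<noteq> e" using keys_power_mdeg[OF y True] False by simp
        then show ?thesis by (simp add: lookup_hcomp)
      qed (simp add: lookup_hcomp in_keys_iff del: power_Suc)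
    qed
    then show ?thesis using ideal.subspace_0[OF subspace_J] by simp
  qed (rule large_degree_in_J[OF homogeneous_hcomp])
  then have "(\<Sum>e\<in>mdeg ` Poly_Mapping.keys (y ^ Suc d). hcomp e (y ^ Suc d)) \<in> J 0"
    by (intro ideal.subspace_sum[OF subspace_J])
  then have "y ^ Suc d \<in> ideal.span (I \<union> \<theta> ` {..<d})"
    using sum_hcomp[of "y ^ Suc d"] by (simp only: J_def add_0_right)
  then show "\<exists>e. y ^ e \<in> ideal.span (I \<union> \<theta> ` {..<d})" by blast
qed

text \<open>The criterion with the zero ideal, where the regular sequence consists of all variables:
  they lie in the ideal of the parameters and are equally many. This takes the place of a linear
  change of coordinates.\<close>

lemma theta_regular:
  assumes n: "length param_order = card (UNIV :: 'v set)"
    and "k < length param_order" "homogeneous e f" "\<theta> k * f \<in> ideal.span (\<theta> ` {..<k})"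
  shows "f \<in> ideal.span (\<theta> ` {..<k})"
proof -
  obtain vs :: "'v list" where vs: "set vs = UNIV" "distinct vs" 
    using finite_distinct_list[of "UNIV :: 'v set"] by auto
  have sp: "ideal.span ({0} \<union> A) = ideal.span A" for A :: "('v, 'k) mpoly set"
    using hull_redundant[of 0 ideal.subspace A] ideal.span_zero[of A] by (simp add: ideal.span_def)
  have "f \<in> ideal.span ({0} \<union> \<theta> ` {..<k})"
  proof (rule graded_parameters_regular[OF _ _ ideal_regular_pvar[OF vs(2)] _ _ assms(2,3)])
    show "graded_ideal {0 :: ('v, 'k) mpoly}" by (simp add: graded_ideal_def ideal.subspace_single_0)
    show "homogeneous 1 (\<theta> i)" for i by (rule homogeneous_theta)
    show "length param_order \<le> length (map pvar vs)" using vs distinct_card[of vs] n by simp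
    show "\<theta> k * f \<in> ideal.span ({0} \<union> \<theta> ` {..<k})" using assms(4) unfolding sp .
    fix y :: "('v, 'k) mpoly" assume "y \<in> set (map pvar vs)"
    then have "y ^ 1 \<in> ideal.span ({0} \<union> \<theta> ` {..<length param_order})"
      unfolding sp using pvar_in_span_theta by auto
    then show "\<exists>e. y ^ e \<in> ideal.span ({0} \<union> \<theta> ` {..<length param_order})" by blast
  qed
  then show ?thesis unfolding sp .
qed

theorem betti_bound:
  assumes R: "graded_free_resolution I R"
    and n: "length param_order = card (UNIV :: 'v set)"
    and pq: "p \<le> q" "1 \<le> p"
    and start: "edges 0 \<le> (Suc (card (verts 0) - p) choose 2) + (card (verts 0) - q)"
  defines "M \<equiv> length ms + m c0"
  shows "vector_space.dim fscale (tensor_cycles R (Suc i) (Suc i + Suc (Suc j))) -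
      vector_space.dim fscale (tensor_boundaries R (Suc i) (Suc i + Suc (Suc j)))
    \<le> (\<Sum>l<M. ((M - 1 - l) choose i) *
         (((M - l - p + Suc j) choose Suc (Suc j)) + ((M - l - q + j) choose Suc j)))"
    and "0 < e \<Longrightarrow> vector_space.dim fscale (tensor_cycles R 0 e) -
      vector_space.dim fscale (tensor_boundaries R 0 e) = 0"
proof -
  interpret gr: graded_resolution I R \<theta>
    by unfold_locales (rule graded_SR_ideal, rule R, rule homogeneous_theta)
  let ?q = "\<lambda>l. ((M - l - p + Suc j) choose Suc (Suc j)) + ((M - l - q + j) choose Suc j)"
  let ?e = "Suc (Suc j)"
  have card_v: "card (verts r) = M - r" if "r \<le> length ms" for r using that by (simp add: card_verts M_def)
  \<comment> \<open>The clique bound is applied with \<open>k = M - r - p\<close> and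
    \<open>e = M - r - q\<close>; the condition \<open>e \<le> k\<close> is
    \<open>p \<le> q\<close>.\<close>
  have cl: "card (cliques (verts r) (adj r) ?e) \<le> ?q r" if "r \<le> length ms" for r
    using card_cliques_le[OF finite_verts adj_sym edges_le[OF pq start that], of j] pq(1)
    by (simp add: card_v[OF that])
  have q: "gr.hom_le (d + r) 0 (int ?e) (?q r)" if r: "d + r < d + M" for r
  proof (cases "r \<le> length ms")
    case True
    let ?G = "(\<lambda>Q. \<Prod>x\<in>Q. \<xi> x) ` cliques (verts r) (adj r) ?e"
    have fin: "finite (cliques (verts r) (adj r) ?e)" by (rule finite_cliques[OF finite_verts])
    show ?thesis
    proof (rule gr.hom_le_0)
      show "finite ?G" using fin by simp
      show "card ?G \<le> ?q r" using card_image_le[OF fin] cl[OF True] by (rule order_trans)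
      show "\<exists>t. f - (\<Sum>g\<in>?G. Poly_Mapping.single 0 (t g) * g) \<in> ideal.span (I \<union> \<theta> ` {..<d + r})"
        if "homogeneous ?e f" for f
        using homogeneous_span[OF True that] unfolding span_mod_def J_def by blast
    qed
  next
    case False
    \<comment> \<open>After the last merge there are no edges, so the quotient is zero in this
      degree (the clique bound with \<open>k = e = 0\<close>), and adding the remaining variables
      keeps it zero.\<close>
    let ?r = "length ms"
    have "card (cliques (verts ?r) (adj ?r) ?e) \<le> ((0 + Suc j) choose ?e) + ((0 + j) choose Suc j)"
      by (rule card_cliques_le[OF finite_verts adj_sym]) (simp_all add: edges_end)
    then have "card (cliques (verts ?r) (adj ?r) ?e) = 0" by (simp add: binomial_eq_0)
    then have empty: "cliques (verts ?r) (adj ?r) ?e = {}" using finite_cliques[OF finite_verts] by simp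
    show ?thesis
    proof (rule gr.hom_le_0)
      fix f :: "('v, 'k) mpoly" assume f: "homogeneous ?e f"
      have "f \<in> J ?r" using homogeneous_span[OF order_refl f] unfolding empty by (simp add: span_mod_empty[OF subspace_J])
      then have "f \<in> J r" using J_mono[of ?r r] False by auto
      then show "\<exists>t. f - (\<Sum>g\<in>{}. Poly_Mapping.single 0 (t g) * g) \<in> ideal.span (I \<union> \<theta> ` {..<d + r})"
        by (simp add: J_def)
    qed auto
  qed
  have nM: "d + M = length param_order" unfolding M_def length_order ..
  have reg: "u \<in> gr.N k i c"
    if "k < d + M" "u \<in> degree_part R i c" "fscale (\<theta> k) u \<in> gr.N k i (c + 1)" for k i c u
  proof (rule gr.N_regular[OF _ that(2,3)])
    have k: "k < length param_order" using that(1) unfolding nM .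
    show "f \<in> ideal.span (\<theta> ` {..<k})" if "homogeneous e f" "\<theta> k * f \<in> ideal.span (\<theta> ` {..<k})" for e f
      by (rule theta_regular[OF n k that])
  qed
  have K0: "gr.K k 0 c \<subseteq> gr.B k 0 c" if "k < d" for k c
    by (rule gr.K_0_subset_B) (rule theta_regular_mod_I[OF that])
  have "gr.hom_le (d + M) (Suc i) (int (Suc i) + int ?e) (\<Sum>l<M. ((M - 1 - l) choose i) * ?q l)"
  proof (rule gr.hom_le_chain[where n = "d + M"])
    show "u \<in> gr.N k i c"
      if "k < d + M" "u \<in> degree_part R i c" "fscale (\<theta> k) u \<in> gr.N k i (c + 1)" for k i c u
      by (rule reg[OF that])
    show "gr.K k 0 c \<subseteq> gr.B k 0 c" if "k < d" for k c by (rule K0[OF that])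
    show "gr.hom_le (d + l) 0 (int ?e) (?q l)" if "d + l < d + M" for l by (rule q[OF that])
  qed (rule Nat.le_refl)
  then have hom: "gr.hom_le (length param_order) (Suc i) (int (Suc i + ?e)) (\<Sum>l<M. ((M - 1 - l) choose i) * ?q l)"
    by (simp only: nM of_nat_add)
  show "vector_space.dim fscale (tensor_cycles R (Suc i) (Suc i + ?e)) -
      vector_space.dim fscale (tensor_boundaries R (Suc i) (Suc i + ?e))
    \<le> (\<Sum>l<M. ((M - 1 - l) choose i) * ?q l)"
    by (rule gr.tor_dim_le[OF hom pvar_in_span_theta])
  \<comment> \<open>Forms of positive degree lie in the ideal of all parameters, so in position 0
    the empty set of generators suffices.\<close>
  show "vector_space.dim fscale (tensor_cycles R 0 e) - vector_space.dim fscale (tensor_boundaries R 0 e) = 0" if e: "0 < e"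
  proof -
    have "gr.hom_le (length param_order) 0 (int e) 0"
    proof (rule gr.hom_le_0)
      fix f :: "('v, 'k) mpoly" assume f: "homogeneous e f"
      have "0 \<notin> Poly_Mapping.keys f" using f e unfolding homogeneous_def by force
      then have "Poly_Mapping.lookup f 0 = 0" by (simp add: in_keys_iff)
      then have "f \<in> ideal.span (\<theta> ` {..<length param_order})" by (rule zero_const_in_span) (rule pvar_in_span_theta)
      then have "f \<in> ideal.span (I \<union> \<theta> ` {..<length param_order})"
        using ideal.span_mono[of "\<theta> ` {..<length param_order}" "I \<union> \<theta> ` {..<length param_order}"] by auto
      then show "\<exists>t. f - (\<Sum>g\<in>{}. Poly_Mapping.single 0 (t g) * g) \<in> ideal.span (I \<union> \<theta> ` {..<length param_order})"
        by simp
    qed auto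
    from gr.tor_dim_le[OF this pvar_in_span_theta] show ?thesis by simp
  qed
qed

end

section \<open>Class sizes and the lexicographic bound\<close>

text \<open>A face with \<open>d\<close> vertices meets each of the \<open>d\<close> classes at most
  once, hence exactly once; so no class is empty.\<close>

lemma balanced_facet:
  assumes "simplicial_complex \<Delta>" "balanced_colouring \<Delta> d V"
  obtains F where "F \<in> \<Delta>" "card F = d" "\<And>c. c \<in> {1..d} \<Longrightarrow> V c \<noteq> {}"
proof -
  have fin: "finite \<Delta>" by simp
  have "{} \<in> \<Delta>" using assms(1) by (simp add: simplicial_complex_def)
  then have "Max (card ` \<Delta>) \<in> card ` \<Delta>" using fin by (intro Max_in) auto
  moreover have "Max (card ` \<Delta>) = d"
    using assms(2) unfolding balanced_colouring_def complex_dim_def by linarith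
  ultimately obtain F where F: "F \<in> \<Delta>" "card F = d" by auto
  have V: "(\<Union>c\<in>{1..d}. V c) = UNIV" "disjoint_family_on V {1..d}"
    and le: "\<And>c. c \<in> {1..d} \<Longrightarrow> card (F \<inter> V c) \<le> 1"
    using assms(2) F(1) unfolding balanced_colouring_def by auto
  have "F = (\<Union>c\<in>{1..d}. F \<inter> V c)" using V(1) by blast
  then have "card F = card (\<Union>c\<in>{1..d}. F \<inter> V c)" by (rule arg_cong)
  also have "\<dots> = (\<Sum>c\<in>{1..d}. card (F \<inter> V c))"
  proof (rule card_UN_disjoint)
    show "\<forall>c\<in>{1..d}. \<forall>c'\<in>{1..d}. c \<noteq> c' \<longrightarrow> F \<inter> V c \<inter> (F \<inter> V c') = {}"
      using V(2) unfolding disjoint_family_on_def by blast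
  qed auto
  finally have sum: "(\<Sum>c\<in>{1..d}. card (F \<inter> V c)) = d" using F(2) by simp
  have "V c \<noteq> {}" if c: "c \<in> {1..d}" for c
  proof
    assume "V c = {}"
    moreover have "(\<Sum>c\<in>{1..d}. card (F \<inter> V c)) = card (F \<inter> V c) + (\<Sum>c\<in>{1..d} - {c}. card (F \<inter> V c))"
      using c by (intro sum.remove) auto
    ultimately have "(\<Sum>c\<in>{1..d}. card (F \<inter> V c)) = (\<Sum>c\<in>{1..d} - {c}. card (F \<inter> V c))"
      by simp
    also have "\<dots> \<le> (\<Sum>c\<in>{1..d} - {c}. 1)" by (intro sum_mono le) auto
    also have "\<dots> = d - 1" using c by (simp add: card_Diff_singleton)
    finally show False using sum c by simp
  qed
  then show ?thesis using F that by blast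
qed

text \<open>The index is replaced by \<open>M - l\<close>. Summands with index at most
  \<open>p\<close>, respectively \<open>q\<close>, vanish because the truncated difference leaves an
  upper index below the lower one.\<close>

lemma lex_sum_eq:
  assumes "p \<le> q" "1 \<le> p"
  shows "(\<Sum>l<M. ((M - 1 - l) choose i) *
         (((M - l - p + Suc j) choose Suc (Suc j)) + ((M - l - q + j) choose Suc j))) =
      (\<Sum>l=p+1..M. ibinom (l - p + Suc (Suc j) - 1) (int (Suc (Suc j))) * ibinom (l - 1) (int (Suc i) - 1)) +
      (\<Sum>l=q+1..M. ibinom (l - q + Suc (Suc j) - 2) (int (Suc (Suc j)) - 1) * ibinom (l - 1) (int (Suc i) - 1))"
proof -
  let ?A = "\<lambda>l. ((l - p + Suc j) choose Suc (Suc j)) * ((l - 1) choose i)"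
  let ?B = "\<lambda>l. ((l - q + j) choose Suc j) * ((l - 1) choose i)"
  have ib: "ibinom n (int (Suc k) - 1) = n choose k" "ibinom n (int k) = n choose k" for n k
    by (simp_all add: ibinom_def)
  have "(\<Sum>l<M. ((M - 1 - l) choose i) * (((M - l - p + Suc j) choose Suc (Suc j)) + ((M - l - q + j) choose Suc j))) =
      (\<Sum>l=1..M. ?A l + ?B l)"
    by (rule sum.reindex_bij_witness[of _ "\<lambda>l. M - l" "\<lambda>l. M - l"]) (auto simp: algebra_simps)
  also have "\<dots> = (\<Sum>l=1..M. ?A l) + (\<Sum>l=1..M. ?B l)" by (rule sum.distrib)
  also have "(\<Sum>l=1..M. ?A l) = (\<Sum>l=p+1..M. ?A l)"
    using assms by (intro sum.mono_neutral_right) (auto simp: binomial_eq_0)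
  also have "(\<Sum>l=1..M. ?B l) = (\<Sum>l=q+1..M. ?B l)"
    using assms by (intro sum.mono_neutral_right) (auto simp: binomial_eq_0)
  also have "(\<Sum>l=p+1..M. ?A l) =
      (\<Sum>l=p+1..M. ibinom (l - p + Suc (Suc j) - 1) (int (Suc (Suc j))) * ibinom (l - 1) (int (Suc i) - 1))"
    unfolding ib by (intro sum.cong refl) simp
  also have "(\<Sum>l=q+1..M. ?B l) =
      (\<Sum>l=q+1..M. ibinom (l - q + Suc (Suc j) - 2) (int (Suc (Suc j)) - 1) * ibinom (l - 1) (int (Suc i) - 1))"
    unfolding ib by (intro sum.cong refl) simp
  finally show ?thesis .
qed

theorem theorem4p7:
  fixes \<Delta> :: "('v::finite) set set"
    and V :: "nat \<Rightarrow> 'v set"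
    and n d b p q i j :: nat
  assumes "simplicial_complex \<Delta>"
    and "balanced_colouring \<Delta> d V"
    and "cohen_macaulay_complex TYPE('k::field) \<Delta>"
    and "n = card (UNIV :: 'v set)"
    and "b = (\<Sum>i=1..d. card (V i) choose 2)"
    and "p \<le> q"
    and "kth_largest b (monomials (n - d) 2) (mvar p + mvar q)"
    and "2 \<le> j" and "j \<le> d"
  shows "graded_betti TYPE('k) \<Delta> i (i + j) \<le>
      (\<Sum>l=p+1..n-d. ibinom (l - p + j - 1) (int j) * ibinom (l - 1) (int i - 1)) +
      (\<Sum>l=q+1..n-d. ibinom (l - q + j - 2) (int j - 1) * ibinom (l - 1) (int i - 1))"
proof -
  obtain F where F: "F \<in> \<Delta>" "card F = d" and ne: "\<And>c. c \<in> {1..d} \<Longrightarrow> V c \<noteq> {}"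
    using balanced_facet[OF assms(1,2)] by blast
  have V: "(\<Union>c\<in>{1..d}. V c) = UNIV" "disjoint_family_on V {1..d}"
    and colour: "\<And>F c. F \<in> \<Delta> \<Longrightarrow> c \<in> {1..d} \<Longrightarrow> card (F \<inter> V c) \<le> 1"
    using assms(2) unfolding balanced_colouring_def by auto
  define m where "m c = card (V c) - 1" for c
  have card_V: "card (V c) = Suc (m c)" if "c \<in> {1..d}" for c
    using ne[OF that] unfolding m_def by (simp add: card_gt_0_iff)
  have "\<exists>h. bij_betw h {..m c} (V c)" if "c \<in> {1..d}" for c
    using ex_bij_betw_nat_finite[of "V c"] card_V[OF that]
    by (simp add: atLeast0LessThan lessThan_Suc_atMost)
  then obtain vert where vert: "\<And>c. c \<in> {1..d} \<Longrightarrow> bij_betw (vert c) {..m c} (V c)" by metis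
  \<comment> \<open>From \<open>2 \<le> j\<close> and \<open>j \<le> d\<close> there is at least one
    colour, so a largest class exists.\<close>
  have "Max (m ` {1..d}) \<in> m ` {1..d}" using assms(8,9) by (intro Max_in) auto
  then obtain c0 where c0: "c0 \<in> {1..d}" "m c0 = Max (m ` {1..d})" by auto
  have m_le: "m c \<le> m c0" if "c \<in> {1..d}" for c
    using Max_ge[of "m ` {1..d}" "m c"] imageI[OF that, of m] unfolding c0(2) by blast
  define S where "S = {(c, a). c \<in> {1..d} \<and> c \<noteq> c0 \<and> 1 \<le> a \<and> a \<le> m c}"
  have "S \<subseteq> {1..d} \<times> {..m c0}" 
  proof
    fix x assume "x \<in> S"
    then obtain c a where "x = (c, a)" "c \<in> {1..d}" "a \<le> m c" unfolding S_def by auto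
    then show "x \<in> {1..d} \<times> {..m c0}" using m_le[of c] by simp
  qed
  then have "finite S" by (rule finite_subset) simp
  then obtain ms0 where ms0: "set ms0 = S" "distinct ms0" using finite_distinct_list by blast
  define ms where "ms = sort_key snd ms0"
  obtain ys :: "('v, 'k) mpoly list" where ys: "length ys = card F" "ideal_regular (SR_ideal \<Delta>) ys"
      "\<And>y. y \<in> set ys \<Longrightarrow> Poly_Mapping.lookup y 0 = 0"
    using cohen_macaulay_regular_sequence[OF assms(1,3) F(1)] by blast
  interpret balanced_parameters d m c0 ms \<Delta> V vert ys
  proof unfold_locales
    show "set ms = {(c, a). c \<in> {1..d} \<and> c \<noteq> c0 \<and> 1 \<le> a \<and> a \<le> m c}"
      unfolding ms_def using ms0(1) S_def by simp
    show "m c \<le> m c0" if "c \<in> {1..d}" for c by (rule m_le[OF that])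
    show "sorted (map snd ms)" unfolding ms_def by simp
    show "distinct ms" unfolding ms_def using ms0(2) by simp
  qed (use c0 vert V colour ys F(2) in auto)
  define M where "M = length ms + m c0"
  have sum_m: "(\<Sum>c\<in>{1..d}. m c) = M" using card_verts_0 card_verts[of 0] by (simp add: M_def)
  have "card (UNIV :: 'v set) = (\<Sum>c\<in>{1..d}. card (V c))"
    unfolding V(1)[symmetric] using V(2) by (intro card_UN_disjoint) (auto simp: disjoint_family_on_def)
  also have "\<dots> = (\<Sum>c\<in>{1..d}. Suc (m c))" by (rule sum.cong[OF refl card_V])
  also have "\<dots> = (\<Sum>c\<in>{1..d}. m c) + card {1..d}" by (rule sum_Suc)
  also have "\<dots> = d + M" unfolding sum_m by simp
  finally have n: "n = d + M" using assms(4) by simp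
  have len: "length param_order = card (UNIV :: 'v set)" using n assms(4) by (simp add: length_order M_def)
  have kth: "1 \<le> p" "b + (Suc (M - p) choose 2) + (M - q) = Suc M choose 2"
    using kth_largest_count[OF assms(7,6)] n by simp_all
  \<comment> \<open>\<open>b\<close> exceeds the number of pairs within colours, counted without the
    eliminated vertices, by \<open>M\<close>, and \<open>Suc M choose 2\<close> exceeds
    \<open>M choose 2\<close> by \<open>M\<close> too. Hence the number of edges equals the number
    of monomials below \<open>x_p x_q\<close>.\<close>
  have "b = (\<Sum>c\<in>{1..d}. Suc (m c) choose 2)"
    unfolding assms(5) by (intro sum.cong refl) (simp only: card_V)
  also have "\<dots> = (\<Sum>c\<in>{1..d}. m c + (m c choose 2))"
    by (intro sum.cong refl) (simp only: numeral_2_eq_2 binomial_Suc_Suc binomial_1[unfolded One_nat_def])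
  also have "\<dots> = (\<Sum>c\<in>{1..d}. m c choose 2) + M"
    unfolding sum.distrib sum_m by (rule add.commute)
  finally have "edges 0 = (Suc (M - p) choose 2) + (M - q)"
    using edges_start kth(2) unfolding sum_m by (simp add: numeral_2_eq_2)
  then have start: "edges 0 \<le> (Suc (card (verts 0) - p) choose 2) + (card (verts 0) - q)"
    using card_verts_0 sum_m by simp
  define R where "R = (SOME R. graded_free_resolution (SR_ideal \<Delta> :: ('v, 'k) mpoly set) R)"
  have R: "graded_free_resolution (SR_ideal \<Delta> :: ('v, 'k) mpoly set) R"
    unfolding R_def by (rule someI_ex[OF SR_resolution_exists])
  have betti: "graded_betti TYPE('k) \<Delta> i c = vector_space.dim fscale (tensor_cycles R i c) -
      vector_space.dim fscale (tensor_boundaries R i c)" for i c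
    by (simp add: graded_betti_def tor_dim_def R_def Let_def)
  note bound = betti_bound[OF R len assms(6) kth(1) start]
  obtain j' where j': "j = Suc (Suc j')" using assms(8) by (metis Suc_le_D numeral_2_eq_2 Suc_le_mono)
  show ?thesis
  proof (cases i)
    case 0
    then show ?thesis using bound(2)[of j] assms(8) by (simp add: betti)
  next
    case (Suc i')
    have "n - d = M" using n by simp
    then show ?thesis unfolding betti Suc j' lex_sum_eq[OF assms(6) kth(1), symmetric]
      using bound(1)[of i' j'] unfolding M_def by simp
  qed
qed

end
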